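(* Let $Q=(Q_0,Q_1,\epsilon)$ be an orthosymplectic quiver with $Q_0$-graded vector spaces $\mathbb V,\mathbb W$, and let $G$ and $\mathbf M$ be its gauge group and matter representation, with $\rho:G\to\mathrm{Sp}(\mathbf M)$. Then the pair $(G,\mathbf M)$ satisfies the anomaly cancellation condition $\mathrm{Tr}(d\rho(-),d\rho(-))\in2\,\mathrm{Bil}(G)$ if and only if for any symplectic vertex $i$ (i.e. $\epsilon_i=-$) we have $$\mathbf w_i+\sum_{j-i}\mathbf v_j\equiv0\mod2,$$ where the sum is over vertices $j$ adjacent to $i$. Note that when $i$ is an orthogonal vertex (i.e. $\epsilon_i=+$), this is always true.
   Context: $Q$ is an unoriented simply-laced finite graph without edge loops, with vertex set $Q_0$ and edge set $Q_1$, and $\epsilon:Q_0\to\{\pm\}$ satisfies $\epsilon_i\ne\epsilon_j$ for every edge $i-j$. $\mathbb V,\mathbb W$ are finite-dimensional $Q_0$-graded complex vector spaces such that if $\epsilon_i=+$ then $\mathbb V_i$ carries a nondegenerate symmetric bilinear form and $\mathbb W_i$ a nondegenerate antisymmetric one, and if $\epsilon_i=-$ then $\mathbb V_i$ carries a nondegenerate antisymmetric bilinear form and $\mathbb W_i$ a nondegenerate symmetric one. Write $\mathbf v_i=\dim\mathbb V_i$ and $\mathbf w_i=\dim\mathbb W_i$. With $K_+=\mathrm{SO}$ and $K_-=\mathrm{Sp}$, the gauge group is $G=\prod_{i\in Q_0}K_{\epsilon_i}(\mathbb V_i)$ and the matter representation is $\mathbf M=\bigoplus_{i-j}\mathbb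 V_i\otimes\mathbb V_j\oplus\bigoplus_{i\in Q_0}\mathbb V_i\otimes\mathbb W_i$ (first sum over edges), a symplectic representation of $G$ with the tensor product forms, where $G$ acts trivially on $\mathbb W_i$. For a reductive group $G$ with Lie algebra $\mathfrak g$, $\mathrm{Bil}(G)$ is the abelian group of symmetric $G$-invariant bilinear forms $B:S^2\mathfrak g\to\mathbb C$ such that $B(\lambda,\mu)\in\mathbb Z$ for all cocharacters $\lambda,\mu$ and $B(\nu,\nu)\in2\mathbb Z$ for all coroots $\nu$. $\mathrm{Tr}(d\rho(-),d\rho(-))$ denotes the trace form $(a,b)\mapsto\mathrm{Tr}_{\mathbf M}(d\rho(a)d\rho(b))$ on $\mathfrak g$.
   Formalization: The parity condition is required only at symplectic vertices with V_i nonzero (as stated if all are nonzero): for one symplectic vertex with V=0, dim W=1, G is trivial and the anomaly cancels though w_i is odd. The empty quiver is not covered. *)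

theory Defs
  imports
    "HOL-Analysis.Derivative"
    "HOL-Number_Theory.Cong"
    Jordan_Normal_Form.Determinant
begin

section \<open>Linear algebraic groups inside a finite product of general linear groups\<close>

text \<open>
  A linear algebraic group is given as a set of families \<open>g\<close> of complex matrices, one invertible
  \<open>n i \<times> n i\<close> matrix \<open>g i\<close> for each index \<open>i\<close>, multiplied componentwise.
\<close>

type_synonym 'q matfam = "'q \<Rightarrow> complex mat"

definition fam_one :: "('q \<Rightarrow> nat) \<Rightarrow> 'q matfam" where
  "fam_one n = (\<lambda>i. 1\<^sub>m (n i))"

definition fam_mult :: "'q matfam \<Rightarrow> 'q matfam \<Rightarrow> 'q matfam" where
  "fam_mult g h = (\<lambda>i. g i * h i)"

definition fam_add :: "'q matfam \<Rightarrow> 'q matfam \<Rightarrow> 'q matfam" where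
  "fam_add a b = (\<lambda>i. a i + b i)"

definition fam_smult :: "complex \<Rightarrow> 'q matfam \<Rightarrow> 'q matfam" where
  "fam_smult c a = (\<lambda>i. c \<cdot>\<^sub>m a i)"

definition fam_bracket :: "'q matfam \<Rightarrow> 'q matfam \<Rightarrow> 'q matfam" where
  "fam_bracket a b = (\<lambda>i. a i * b i - b i * a i)"

text \<open>The Lie algebra: velocities at the identity of complex curves in \<open>G\<close>.\<close>

definition lie_alg :: "('q \<Rightarrow> nat) \<Rightarrow> 'q matfam set \<Rightarrow> 'q matfam set" where
  "lie_alg n G = {a. (\<forall>i. a i \<in> carrier_mat (n i) (n i)) \<and>
     (\<exists>\<gamma> :: complex \<Rightarrow> 'q matfam. (\<forall>s. \<gamma> s \<in> G) \<and> \<gamma> 0 = fam_one n \<and>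
        (\<forall>i. \<forall>k<n i. \<forall>l<n i.
           ((\<lambda>s. \<gamma> s i $$ (k, l)) has_field_derivative a i $$ (k, l)) (at 0)))}"

text \<open>\<open>(\<complex>\<^sup>\<times>)\<^sup>r\<close>, and the regular functions on it, i.e. Laurent polynomials in \<open>r\<close> variables.\<close>

definition std_torus :: "nat \<Rightarrow> (nat \<Rightarrow> complex) set" where
  "std_torus r = {..<r} \<rightarrow>\<^sub>E (UNIV - {0})"

definition laurent_fun :: "nat \<Rightarrow> ((nat \<Rightarrow> complex) \<Rightarrow> complex) \<Rightarrow> bool" where
  "laurent_fun r f \<longleftrightarrow>
     (\<exists>(S :: (nat \<Rightarrow> int) set) c. finite S \<and>
        (\<forall>z\<in>std_torus r. f z = (\<Sum>m\<in>S. c m * (\<Prod>k<r. z k powi m k))))"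

definition is_torus_hom ::
    "('q \<Rightarrow> nat) \<Rightarrow> nat \<Rightarrow> 'q matfam set \<Rightarrow> ((nat \<Rightarrow> complex) \<Rightarrow> 'q matfam) \<Rightarrow> bool" where
  "is_torus_hom n r G \<phi> \<longleftrightarrow>
     (\<forall>z\<in>std_torus r. \<phi> z \<in> G) \<and>
     (\<forall>z\<in>std_torus r. \<forall>w\<in>std_torus r.
        \<phi> (\<lambda>k\<in>{..<r}. z k * w k) = fam_mult (\<phi> z) (\<phi> w)) \<and>
     (\<forall>i. \<forall>k<n i. \<forall>l<n i. laurent_fun r (\<lambda>z. \<phi> z i $$ (k, l)))"

definition is_cocharacter ::
    "('q \<Rightarrow> nat) \<Rightarrow> 'q matfam set \<Rightarrow> (complex \<Rightarrow> 'q matfam) \<Rightarrow> bool" where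
  "is_cocharacter n G lam \<longleftrightarrow> is_torus_hom n 1 G (\<lambda>z. lam (z 0))"

text \<open>
  The element of the Lie algebra with which a cocharacter is identified: the image of
  \<open>1 \<in> \<complex> = Lie \<complex>\<^sup>\<times>\<close> under its differential.
\<close>

definition cochar_diff :: "('q \<Rightarrow> nat) \<Rightarrow> (complex \<Rightarrow> 'q matfam) \<Rightarrow> 'q matfam" where
  "cochar_diff n lam = (\<lambda>i. mat (n i) (n i) (\<lambda>(k, l). deriv (\<lambda>z. lam z i $$ (k, l)) 1))"

text \<open>
  A torus is an algebraic subgroup isomorphic to \<open>(\<complex>\<^sup>\<times>)\<^sup>r\<close>. Over \<open>\<complex>\<close> an injective homomorphism of
  algebraic groups is an isomorphism onto its (closed) image, so regularity of the inverse
  need not be demanded.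
\<close>

definition is_torus :: "('q \<Rightarrow> nat) \<Rightarrow> 'q matfam set \<Rightarrow> 'q matfam set \<Rightarrow> bool" where
  "is_torus n G T \<longleftrightarrow>
     (\<exists>r \<phi>. is_torus_hom n r G \<phi> \<and> inj_on \<phi> (std_torus r) \<and> T = \<phi> ` std_torus r)"

definition is_maximal_torus :: "('q \<Rightarrow> nat) \<Rightarrow> 'q matfam set \<Rightarrow> 'q matfam set \<Rightarrow> bool" where
  "is_maximal_torus n G T \<longleftrightarrow>
     is_torus n G T \<and> (\<forall>T'. is_torus n G T' \<and> T \<subseteq> T' \<longrightarrow> T' = T)"

text \<open>
  The root space of a character \<open>\<alpha>\<close> of \<open>T\<close>; the condition \<open>Ad(t) x = \<alpha>(t) x\<close> is written as
  \<open>t x = \<alpha>(t) x t\<close>.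
\<close>

definition root_space ::
    "('q \<Rightarrow> nat) \<Rightarrow> 'q matfam set \<Rightarrow> 'q matfam set \<Rightarrow> ('q matfam \<Rightarrow> complex) \<Rightarrow> 'q matfam set" where
  "root_space n G T \<alpha> =
     {x \<in> lie_alg n G. \<forall>t\<in>T. fam_mult t x = fam_smult (\<alpha> t) (fam_mult x t)}"

text \<open>
  The coroot of a root \<open>\<alpha>\<close> is the cocharacter \<open>\<nu>\<close> of \<open>T\<close> with \<open>\<langle>\<alpha>, \<nu>\<rangle> = 2\<close> whose differential lies in
  \<open>[\<gg>\<^sub>\<alpha>, \<gg>\<^sub>-\<^sub>\<alpha>]\<close>. For a maximal torus the root spaces are lines, so every element of
  \<open>[\<gg>\<^sub>\<alpha>, \<gg>\<^sub>-\<^sub>\<alpha>]\<close> is a single bracket. That \<open>\<alpha>\<close> is a nontrivial character on \<open>T\<close> follows from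
  \<open>x \<noteq> 0\<close> and from \<open>\<alpha> (\<nu> z) = z\<^sup>2\<close>.
\<close>

definition is_coroot ::
    "('q \<Rightarrow> nat) \<Rightarrow> 'q matfam set \<Rightarrow> 'q matfam set \<Rightarrow> (complex \<Rightarrow> 'q matfam) \<Rightarrow> bool" where
  "is_coroot n G T \<nu> \<longleftrightarrow>
     is_cocharacter n T \<nu> \<and>
     (\<exists>\<alpha> x y. x \<in> root_space n G T \<alpha> \<and> y \<in> root_space n G T (\<lambda>t. inverse (\<alpha> t)) \<and>
        x \<noteq> (\<lambda>i. 0\<^sub>m (n i) (n i)) \<and>
        cochar_diff n \<nu> = fam_bracket x y \<and>
        (\<forall>z. z \<noteq> 0 \<longrightarrow> \<alpha> (\<nu> z) = z\<^sup>2))"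

text \<open>
  Invariant symmetric bilinear forms on the Lie algebra (only the values on \<open>lie_alg n G\<close> matter).
  Invariance is stated with \<open>h = g\<inverse>\<close>, so that \<open>Ad(g) a = g a h\<close>.
\<close>

definition invariant_sym_bilinear ::
    "('q \<Rightarrow> nat) \<Rightarrow> 'q matfam set \<Rightarrow> ('q matfam \<Rightarrow> 'q matfam \<Rightarrow> complex) \<Rightarrow> bool" where
  "invariant_sym_bilinear n G B \<longleftrightarrow>
     (\<forall>a\<in>lie_alg n G. \<forall>b\<in>lie_alg n G. B a b = B b a) \<and>
     (\<forall>a\<in>lie_alg n G. \<forall>a'\<in>lie_alg n G. \<forall>b\<in>lie_alg n G.
        B (fam_add a a') b = B a b + B a' b) \<and>
     (\<forall>c. \<forall>a\<in>lie_alg n G. \<forall>b\<in>lie_alg n G. B (fam_smult c a) b = c * B a b) \<and>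
     (\<forall>g\<in>G. \<forall>h\<in>G. fam_mult g h = fam_one n \<longrightarrow>
        (\<forall>a\<in>lie_alg n G. \<forall>b\<in>lie_alg n G.
           B (fam_mult (fam_mult g a) h) (fam_mult (fam_mult g b) h) = B a b))"

text \<open>
  Cocharacters are paired within a common maximal torus \<open>T\<close>, i.e. \<open>\<lambda>\<close> and \<open>\<mu>\<close> range over the
  cocharacter lattice of \<open>T\<close>; as \<open>B\<close> is invariant and maximal tori are conjugate, the
  choice of \<open>T\<close> is immaterial.
\<close>

definition Bil :: "('q \<Rightarrow> nat) \<Rightarrow> 'q matfam set \<Rightarrow> ('q matfam \<Rightarrow> 'q matfam \<Rightarrow> complex) set" where
  "Bil n G = {B. invariant_sym_bilinear n G B \<and>
     (\<forall>T. is_maximal_torus n G T \<longrightarrow>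
        (\<forall>lam mu. is_cocharacter n T lam \<and> is_cocharacter n T mu \<longrightarrow>
           B (cochar_diff n lam) (cochar_diff n mu) \<in> \<int>) \<and>
        (\<forall>\<nu>. is_coroot n G T \<nu> \<longrightarrow>
           (\<exists>k::int. B (cochar_diff n \<nu>) (cochar_diff n \<nu>) = of_int (2 * k))))}"

definition in_twice_Bil ::
    "('q \<Rightarrow> nat) \<Rightarrow> 'q matfam set \<Rightarrow> ('q matfam \<Rightarrow> 'q matfam \<Rightarrow> complex) \<Rightarrow> bool" where
  "in_twice_Bil n G F \<longleftrightarrow>
     (\<exists>B\<in>Bil n G. \<forall>a\<in>lie_alg n G. \<forall>b\<in>lie_alg n G. F a b = 2 * B a b)"

section \<open>Orthosymplectic quivers\<close>

datatype sign = Plus | Minus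

text \<open>
  The vertex set is the finite type \<open>'q\<close>; an edge is the two-element set of its end points.
\<close>

definition orthosymplectic_quiver :: "'q set set \<Rightarrow> ('q \<Rightarrow> sign) \<Rightarrow> bool" where
  "orthosymplectic_quiver Q1 eps \<longleftrightarrow>
     (\<forall>e\<in>Q1. \<exists>i j. i \<noteq> j \<and> e = {i, j}) \<and>
     (\<forall>i j. {i, j} \<in> Q1 \<longrightarrow> eps i \<noteq> eps j)"

definition sym_form :: "nat \<Rightarrow> complex mat \<Rightarrow> bool" where
  "sym_form d A \<longleftrightarrow> A \<in> carrier_mat d d \<and> transpose_mat A = A \<and> invertible_mat A"

definition antisym_form :: "nat \<Rightarrow> complex mat \<Rightarrow> bool" where
  "antisym_form d A \<longleftrightarrow> A \<in> carrier_mat d d \<and> transpose_mat A = - A \<and> invertible_mat A"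

text \<open>
  After a choice of bases, the graded pieces are \<open>\<complex>^(v i)\<close> and \<open>\<complex>^(w i)\<close>, with bilinear forms given
  by their Gram matrices \<open>omV i\<close> and \<open>omW i\<close>.
\<close>

definition orthosymplectic_spaces ::
    "('q \<Rightarrow> sign) \<Rightarrow> ('q \<Rightarrow> nat) \<Rightarrow> ('q \<Rightarrow> nat) \<Rightarrow> 'q matfam \<Rightarrow> 'q matfam \<Rightarrow> bool" where
  "orthosymplectic_spaces eps v w omV omW \<longleftrightarrow>
     (\<forall>i. case eps i of
            Plus \<Rightarrow> sym_form (v i) (omV i) \<and> antisym_form (w i) (omW i)
          | Minus \<Rightarrow> antisym_form (v i) (omV i) \<and> sym_form (w i) (omW i))"

definition isometries :: "nat \<Rightarrow> complex mat \<Rightarrow> complex mat set" where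
  "isometries d A = {g \<in> carrier_mat d d. transpose_mat g * A * g = A}"

definition SO_group :: "nat \<Rightarrow> complex mat \<Rightarrow> complex mat set" where
  "SO_group d A = {g \<in> isometries d A. det g = 1}"

definition Sp_group :: "nat \<Rightarrow> complex mat \<Rightarrow> complex mat set" where
  "Sp_group d A = isometries d A"

definition gauge_group :: "('q \<Rightarrow> sign) \<Rightarrow> ('q \<Rightarrow> nat) \<Rightarrow> 'q matfam \<Rightarrow> 'q matfam set" where
  "gauge_group eps v omV =
     {g. \<forall>i. g i \<in> (case eps i of Plus \<Rightarrow> SO_group (v i) (omV i)
                              | Minus \<Rightarrow> Sp_group (v i) (omV i))}"

text \<open>
  The basis of \<open>M\<close> given by tensor products of basis vectors of the summands \<open>V\<^sub>i \<otimes> V\<^sub>j\<close> and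
  \<open>V\<^sub>i \<otimes> W\<^sub>i\<close>. Since the two ends of an edge have opposite signs, each unoriented edge is listed
  exactly once by writing its orthogonal end \<open>i\<close> first and its symplectic end \<open>j\<close> second.
\<close>

datatype 'q matter_index = Edge 'q 'q nat nat | Framing 'q nat nat

definition matter_basis ::
    "'q set set \<Rightarrow> ('q \<Rightarrow> sign) \<Rightarrow> ('q \<Rightarrow> nat) \<Rightarrow> ('q \<Rightarrow> nat) \<Rightarrow> 'q matter_index set" where
  "matter_basis Q1 eps v w =
     {Edge i j k l | i j k l. {i, j} \<in> Q1 \<and> eps i = Plus \<and> eps j = Minus \<and> k < v i \<and> l < v j} \<union>
     {Framing i k l | i k l. k < v i \<and> l < w i}"

text \<open>
  \<open>tensor_block A D\<close> is the matrix, in the basis above, of the direct sum of the tensor products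
  \<open>A i \<otimes> A j\<close> over the edges and \<open>A i \<otimes> D i\<close> over the vertices.
\<close>

fun tensor_block ::
    "'q matfam \<Rightarrow> 'q matfam \<Rightarrow> 'q matter_index \<Rightarrow> 'q matter_index \<Rightarrow> complex" where
  "tensor_block A D (Edge i j k l) (Edge i' j' k' l') =
     (if i = i' \<and> j = j' then A i $$ (k, k') * A j $$ (l, l') else 0)"
| "tensor_block A D (Framing i k l) (Framing i' k' l') =
     (if i = i' then A i $$ (k, k') * D i $$ (l, l') else 0)"
| "tensor_block A D _ _ = 0"

definition matter_rep ::
    "('q \<Rightarrow> nat) \<Rightarrow> 'q matfam \<Rightarrow> 'q matter_index \<Rightarrow> 'q matter_index \<Rightarrow> complex" where
  "matter_rep w g = tensor_block g (fam_one w)"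

definition matter_form ::
    "'q matfam \<Rightarrow> 'q matfam \<Rightarrow> 'q matter_index \<Rightarrow> 'q matter_index \<Rightarrow> complex" where
  "matter_form omV omW = tensor_block omV omW"

subsection \<open>The matter representation is symplectic\<close>

lemma finite_matter_basis [simp]: "finite (matter_basis Q1 eps v (w :: 'q::finite \<Rightarrow> nat))"
proof -
  have "matter_basis Q1 eps v w \<subseteq>
      (\<lambda>(i, j, k, l). Edge i j k l) ` (UNIV \<times> UNIV \<times> (\<Union>i. {..<v i}) \<times> (\<Union>j. {..<v j})) \<union>
      (\<lambda>(i, k, l). Framing i k l) ` (UNIV \<times> (\<Union>i. {..<v i}) \<times> (\<Union>j. {..<w j}))"
    by (force simp: matter_basis_def image_iff)
  then show ?thesis by (rule finite_subset) auto
qed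

lemma mat_mult_entry:
  assumes "X \<in> carrier_mat d d" "Y \<in> carrier_mat d d" "k < d" "l < d"
  shows "(X * Y) $$ (k, l) = (\<Sum>m<d. X $$ (k, m) * Y $$ (m, l))"
  using assms by (auto simp: scalar_prod_def lessThan_atLeast0 intro!: sum.cong)

lemma tensor_block_mult:
  fixes v w :: "'q::finite \<Rightarrow> nat"
  assumes A: "\<And>i. A i \<in> carrier_mat (v i) (v i)" and A': "\<And>i. A' i \<in> carrier_mat (v i) (v i)"
    and D: "\<And>i. D i \<in> carrier_mat (w i) (w i)" and D': "\<And>i. D' i \<in> carrier_mat (w i) (w i)"
    and p: "p \<in> matter_basis Q1 eps v w" and r: "r \<in> matter_basis Q1 eps v w"
  shows "(\<Sum>q\<in>matter_basis Q1 eps v w. tensor_block A D p q * tensor_block A' D' q r) =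
         tensor_block (fam_mult A A') (fam_mult D D') p r"
proof (cases p)
  case (Edge i j k l)
  let ?f = "\<lambda>q. tensor_block A D p q * tensor_block A' D' q r"
  let ?S = "(\<lambda>(m, n). Edge i j m n) ` ({..<v i} \<times> {..<v j})"
  have kl: "{i, j} \<in> Q1" "eps i = Plus" "eps j = Minus" "k < v i" "l < v j"
    using p by (auto simp: Edge matter_basis_def)
  have "sum ?f (matter_basis Q1 eps v w) = sum ?f ?S"
  proof (rule sum.mono_neutral_right)
    show "?S \<subseteq> matter_basis Q1 eps v w" using kl by (auto simp: matter_basis_def)
    show "\<forall>q\<in>matter_basis Q1 eps v w - ?S. ?f q = 0"
    proof
      fix q assume "q \<in> matter_basis Q1 eps v w - ?S"
      then show "?f q = 0" by (cases q) (auto simp: Edge matter_basis_def)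
    qed
  qed auto
  also have "\<dots> = (\<Sum>(m, n)\<in>{..<v i} \<times> {..<v j}. ?f (Edge i j m n))"
    by (subst sum.reindex) (auto simp: inj_on_def case_prod_unfold)
  also have "\<dots> = (\<Sum>m<v i. \<Sum>n<v j. ?f (Edge i j m n))"
    by (rule sum.cartesian_product [symmetric])
  also have "\<dots> = tensor_block (fam_mult A A') (fam_mult D D') p r"
  proof (cases r)
    fix i' j' k' l' assume r': "r = Edge i' j' k' l'"
    show ?thesis
    proof (cases "i = i' \<and> j = j'")
      case True
      then have "k' < v i" "l' < v j" using r by (auto simp: r' matter_basis_def)
      then have "tensor_block (fam_mult A A') (fam_mult D D') p r =
          (\<Sum>m<v i. A i $$ (k, m) * A' i $$ (m, k')) * (\<Sum>n<v j. A j $$ (l, n) * A' j $$ (n, l'))"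
        using True mat_mult_entry[OF A A' kl(4), of k'] mat_mult_entry[OF A A' kl(5), of l']
        by (simp add: Edge r' fam_mult_def del: index_mult_mat)
      also have "\<dots> = (\<Sum>m<v i. \<Sum>n<v j. ?f (Edge i j m n))"
        unfolding sum_product using True by (auto simp: Edge r' ac_simps)
      finally show ?thesis by simp
    qed (auto simp: Edge r')
  qed (auto simp: Edge)
  finally show ?thesis .
next
  case (Framing i k l)
  let ?f = "\<lambda>q. tensor_block A D p q * tensor_block A' D' q r"
  let ?S = "(\<lambda>(m, n). Framing i m n) ` ({..<v i} \<times> {..<w i})"
  have kl: "k < v i" "l < w i"
    using p by (auto simp: Framing matter_basis_def)
  have "sum ?f (matter_basis Q1 eps v w) = sum ?f ?S"
  proof (rule sum.mono_neutral_right)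
    show "?S \<subseteq> matter_basis Q1 eps v w" using kl by (auto simp: matter_basis_def)
    show "\<forall>q\<in>matter_basis Q1 eps v w - ?S. ?f q = 0"
    proof
      fix q assume "q \<in> matter_basis Q1 eps v w - ?S"
      then show "?f q = 0" by (cases q) (auto simp: Framing matter_basis_def)
    qed
  qed auto
  also have "\<dots> = (\<Sum>(m, n)\<in>{..<v i} \<times> {..<w i}. ?f (Framing i m n))"
    by (subst sum.reindex) (auto simp: inj_on_def case_prod_unfold)
  also have "\<dots> = (\<Sum>m<v i. \<Sum>n<w i. ?f (Framing i m n))"
    by (rule sum.cartesian_product [symmetric])
  also have "\<dots> = tensor_block (fam_mult A A') (fam_mult D D') p r"
  proof (cases r)
    fix i' k' l' assume r': "r = Framing i' k' l'"
    show ?thesis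
    proof (cases "i = i'")
      case True
      then have "k' < v i" "l' < w i" using r by (auto simp: r' matter_basis_def)
      then have "tensor_block (fam_mult A A') (fam_mult D D') p r =
          (\<Sum>m<v i. A i $$ (k, m) * A' i $$ (m, k')) * (\<Sum>n<w i. D i $$ (l, n) * D' i $$ (n, l'))"
        using True mat_mult_entry[OF A A' kl(1), of k'] mat_mult_entry[OF D D' kl(2), of l']
        by (simp add: Framing r' fam_mult_def del: index_mult_mat)
      also have "\<dots> = (\<Sum>m<v i. \<Sum>n<w i. ?f (Framing i m n))"
        unfolding sum_product using True by (auto simp: Framing r' ac_simps)
      finally show ?thesis by simp
    qed (auto simp: Framing r')
  qed (auto simp: Framing)
  finally show ?thesis .
qed

lemma tensor_block_transpose:
  assumes A: "\<And>i. A i \<in> carrier_mat (v i) (v i)" and D: "\<And>i. D i \<in> carrier_mat (w i) (w i)"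
    and "p \<in> matter_basis Q1 eps v w" "q \<in> matter_basis Q1 eps v w"
  shows "tensor_block (\<lambda>i. transpose_mat (A i)) (\<lambda>i. transpose_mat (D i)) p q = tensor_block A D q p"
  using assms(3,4) carrier_matD[OF A] carrier_matD[OF D]
  by (cases p; cases q) (auto simp: matter_basis_def)

lemma tensor_block_one:
  assumes "p \<in> matter_basis Q1 eps v w" "q \<in> matter_basis Q1 eps v w"
  shows "tensor_block (fam_one v) (fam_one w) p q = (if p = q then 1 else 0)"
  using assms by (cases p; cases q) (auto simp: matter_basis_def fam_one_def)

lemma orthosymplectic_spaces_carrier:
  assumes "orthosymplectic_spaces eps v w omV omW"
  shows "omV i \<in> carrier_mat (v i) (v i)" "omW i \<in> carrier_mat (w i) (w i)"
    "invertible_mat (omV i)" "invertible_mat (omW i)"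
  using assms unfolding orthosymplectic_spaces_def sym_form_def antisym_form_def
  by (auto split: sign.splits dest!: spec[of _ i] simp: all_conj_distrib; cases "eps i"; force)+

lemma gauge_group_carrier:
  assumes "g \<in> gauge_group eps v omV"
  shows "g i \<in> carrier_mat (v i) (v i)" "transpose_mat (g i) * omV i * g i = omV i"
proof -
  have "g i \<in> (case eps i of Plus \<Rightarrow> SO_group (v i) (omV i) | Minus \<Rightarrow> Sp_group (v i) (omV i))"
    using assms by (simp add: gauge_group_def)
  then show "g i \<in> carrier_mat (v i) (v i)" "transpose_mat (g i) * omV i * g i = omV i"
    by (auto simp: SO_group_def Sp_group_def isometries_def split: sign.splits)
qed

lemma matter_rep_mult:
  fixes v w :: "'q::finite \<Rightarrow> nat"
  assumes g: "g \<in> gauge_group eps v omV" and h: "h \<in> gauge_group eps v omV"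
    and "p \<in> matter_basis Q1 eps v w" "r \<in> matter_basis Q1 eps v w"
  shows "(\<Sum>q\<in>matter_basis Q1 eps v w. matter_rep w g p q * matter_rep w h q r) =
         matter_rep w (fam_mult g h) p r"
proof -
  have "fam_mult (fam_one w) (fam_one w) = fam_one w" by (simp add: fam_mult_def fam_one_def)
  then show ?thesis unfolding matter_rep_def
    using tensor_block_mult[OF _ _ _ _ assms(3,4), of g h "fam_one w" "fam_one w"]
      gauge_group_carrier(1)[OF g] gauge_group_carrier(1)[OF h] by (simp add: fam_one_def)
qed

lemma matter_form_antisym:
  assumes Q: "orthosymplectic_quiver Q1 eps" and S: "orthosymplectic_spaces eps v w omV omW"
    and p: "p \<in> matter_basis Q1 eps v w" and q: "q \<in> matter_basis Q1 eps v w"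
  shows "matter_form omV omW q p = - matter_form omV omW p q"
proof -
  have sgn: "omV i $$ (l, k) = (case eps i of Plus \<Rightarrow> 1 | Minus \<Rightarrow> - 1) * omV i $$ (k, l)"
    if "k < v i" "l < v i" for i k l
  proof -
    have "transpose_mat (omV i) $$ (k, l) = omV i $$ (l, k)"
      using that orthosymplectic_spaces_carrier(1)[OF S, of i] by auto
    moreover have "transpose_mat (omV i) = (case eps i of Plus \<Rightarrow> omV i | Minus \<Rightarrow> - omV i)"
      using S by (auto simp: orthosymplectic_spaces_def sym_form_def antisym_form_def
          split: sign.splits)
    ultimately show ?thesis
      using that orthosymplectic_spaces_carrier(1)[OF S, of i]
      by (auto split: sign.splits)
  qed
  have sgn': "omW i $$ (l, k) = (case eps i of Plus \<Rightarrow> - 1 | Minus \<Rightarrow> 1) * omW i $$ (k, l)"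
    if "k < w i" "l < w i" for i k l
  proof -
    have "transpose_mat (omW i) $$ (k, l) = omW i $$ (l, k)"
      using that orthosymplectic_spaces_carrier(2)[OF S, of i] by auto
    moreover have "transpose_mat (omW i) = (case eps i of Plus \<Rightarrow> - omW i | Minus \<Rightarrow> omW i)"
      using S by (auto simp: orthosymplectic_spaces_def sym_form_def antisym_form_def
          split: sign.splits)
    ultimately show ?thesis
      using that orthosymplectic_spaces_carrier(2)[OF S, of i]
      by (auto split: sign.splits)
  qed
  show ?thesis
  proof (cases p)
    case (Edge i j k l)
    show ?thesis
    proof (cases q)
      fix i' j' k' l' assume q': "q = Edge i' j' k' l'"
      show ?thesis
        using p q sgn[of k i k'] sgn[of l j l']
        by (auto simp: matter_form_def Edge q' matter_basis_def)
    qed (simp add: Edge matter_form_def)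
  next
    case (Framing i k l)
    show ?thesis
    proof (cases q)
      fix i' k' l' assume q': "q = Framing i' k' l'"
      show ?thesis
        using p q sgn[of k i k'] sgn'[of l i l']
        by (cases "eps i") (auto simp: matter_form_def Framing q' matter_basis_def)
    qed (simp add: Framing matter_form_def)
  qed
qed

lemma matter_form_nondegenerate:
  fixes v w :: "'q::finite \<Rightarrow> nat"
  assumes S: "orthosymplectic_spaces eps v w omV omW"
  obtains J where "\<And>p r. p \<in> matter_basis Q1 eps v w \<Longrightarrow> r \<in> matter_basis Q1 eps v w \<Longrightarrow>
    (\<Sum>q\<in>matter_basis Q1 eps v w. matter_form omV omW p q * J q r) = (if p = r then 1 else 0)"
proof -
  have inv: "\<exists>Y \<in> carrier_mat d d. X * Y = 1\<^sub>m d"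
    if "X \<in> carrier_mat d d" "invertible_mat X" for X :: "complex mat" and d
  proof -
    have "dim_row X = d" using that(1) by simp
    with that(2) have "\<exists>Y. X * Y = 1\<^sub>m d \<and> Y * X = 1\<^sub>m (dim_row Y)"
      unfolding invertible_mat_def inverts_mat_def by auto
    then obtain Y where Y: "X * Y = 1\<^sub>m d" "Y * X = 1\<^sub>m (dim_row Y)" by blast
    have "dim_col Y = d" using arg_cong[OF Y(1), of dim_col] by simp
    moreover have "dim_row Y = d" using arg_cong[OF Y(2), of dim_col] that(1) by simp
    ultimately have "Y \<in> carrier_mat d d" by blast
    then show ?thesis using Y by blast
  qed
  have "\<forall>i. \<exists>Y. Y \<in> carrier_mat (v i) (v i) \<and> omV i * Y = 1\<^sub>m (v i)"
    using inv[OF orthosymplectic_spaces_carrier(1)[OF S] orthosymplectic_spaces_carrier(3)[OF S]]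
    by blast
  then obtain A where A: "\<And>i. A i \<in> carrier_mat (v i) (v i)" "\<And>i. omV i * A i = 1\<^sub>m (v i)"
    unfolding choice_iff by blast
  have "\<forall>i. \<exists>Y. Y \<in> carrier_mat (w i) (w i) \<and> omW i * Y = 1\<^sub>m (w i)"
    using inv[OF orthosymplectic_spaces_carrier(2)[OF S] orthosymplectic_spaces_carrier(4)[OF S]]
    by blast
  then obtain D where D: "\<And>i. D i \<in> carrier_mat (w i) (w i)" "\<And>i. omW i * D i = 1\<^sub>m (w i)"
    unfolding choice_iff by blast
  have one: "fam_mult omV A = fam_one v" "fam_mult omW D = fam_one w"
    by (auto simp: fam_mult_def fam_one_def A D)
  show thesis
  proof
    fix p r assume pr: "p \<in> matter_basis Q1 eps v w" "r \<in> matter_basis Q1 eps v w"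
    show "(\<Sum>q\<in>matter_basis Q1 eps v w. matter_form omV omW p q * tensor_block A D q r) =
        (if p = r then 1 else 0)"
      unfolding matter_form_def
      using tensor_block_mult[OF orthosymplectic_spaces_carrier(1)[OF S] A(1)
          orthosymplectic_spaces_carrier(2)[OF S] D(1) pr] tensor_block_one[OF pr]
      by (simp add: one)
  qed
qed

lemma matter_rep_isometry:
  fixes v w :: "'q::finite \<Rightarrow> nat"
  assumes S: "orthosymplectic_spaces eps v w omV omW"
    and g: "g \<in> gauge_group eps v omV"
    and p: "p \<in> matter_basis Q1 eps v w" and r: "r \<in> matter_basis Q1 eps v w"
  shows "(\<Sum>p'\<in>matter_basis Q1 eps v w. \<Sum>r'\<in>matter_basis Q1 eps v w.
            matter_rep w g p' p * matter_form omV omW p' r' * matter_rep w g r' r) =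
         matter_form omV omW p r"
proof -
  let ?b = "matter_basis Q1 eps v w"
  note c = orthosymplectic_spaces_carrier(1,2)[OF S] gauge_group_carrier(1)[OF g]
  have one: "fam_one w i \<in> carrier_mat (w i) (w i)" for i by (simp add: fam_one_def)
  have W: "fam_mult omW (fam_one w) = omW" "fam_mult (\<lambda>i. transpose_mat (fam_one w i)) omW = omW"
    by (simp_all add: fam_mult_def fam_one_def left_mult_one_mat[OF c(2)] right_mult_one_mat[OF c(2)])
  have V: "fam_mult (\<lambda>i. transpose_mat (g i)) (fam_mult omV g) = omV"
  proof
    fix i
    have "transpose_mat (g i) * (omV i * g i) = transpose_mat (g i) * omV i * g i"
      using c(1)[of i] c(3)[of i] by (intro assoc_mult_mat [symmetric]) auto
    then show "fam_mult (\<lambda>i. transpose_mat (g i)) (fam_mult omV g) i = omV i"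
      using gauge_group_carrier(2)[OF g, of i] by (simp add: fam_mult_def)
  qed
  have "(\<Sum>p'\<in>?b. \<Sum>r'\<in>?b. matter_rep w g p' p * matter_form omV omW p' r' * matter_rep w g r' r) =
      (\<Sum>p'\<in>?b. matter_rep w g p' p * (\<Sum>r'\<in>?b. matter_form omV omW p' r' * matter_rep w g r' r))"
    by (simp add: sum_distrib_left mult.assoc)
  also have "\<dots> = (\<Sum>p'\<in>?b. matter_rep w g p' p * tensor_block (fam_mult omV g) omW p' r)"
    unfolding matter_form_def matter_rep_def
    by (intro sum.cong refl) (simp only: tensor_block_mult[OF c(1,3) c(2) one _ r] W)
  also have "\<dots> = (\<Sum>p'\<in>?b. tensor_block (\<lambda>i. transpose_mat (g i)) (\<lambda>i. transpose_mat (fam_one w i)) p p'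
       * tensor_block (fam_mult omV g) omW p' r)"
    unfolding matter_rep_def
    by (intro sum.cong refl) (simp only: tensor_block_transpose[OF c(3) one p])
  also have "\<dots> = tensor_block omV omW p r"
  proof -
    have "transpose_mat (g i) \<in> carrier_mat (v i) (v i)"
      "fam_mult omV g i \<in> carrier_mat (v i) (v i)"
      "transpose_mat (fam_one w i) \<in> carrier_mat (w i) (w i)" for i
      using c(1)[of i] c(3)[of i] one[of i] by (simp_all add: fam_mult_def)
    from tensor_block_mult[OF this(1,2,3) c(2) p r] show ?thesis by (simp only: V W)
  qed
  finally show ?thesis by (simp add: matter_form_def)
qed

subsection \<open>The trace form and anomaly cancellation\<close>

text \<open>
  The differential of \<open>\<rho>\<close> at the identity. The matrix entries of \<open>\<rho>(g)\<close> are polynomials in the entries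
  of \<open>g\<close>, so the derivative may be taken along the line \<open>s \<mapsto> 1 + s a\<close>, which is tangent to \<open>G\<close>
  for \<open>a \<in> \<gg>\<close>.
\<close>

definition matter_drep ::
    "('q \<Rightarrow> nat) \<Rightarrow> ('q \<Rightarrow> nat) \<Rightarrow> 'q matfam \<Rightarrow> 'q matter_index \<Rightarrow> 'q matter_index \<Rightarrow> complex" where
  "matter_drep v w a p q =
     deriv (\<lambda>s. matter_rep w (fam_add (fam_one v) (fam_smult s a)) p q) 0"

definition matter_trace_form ::
    "'q set set \<Rightarrow> ('q \<Rightarrow> sign) \<Rightarrow> ('q \<Rightarrow> nat) \<Rightarrow> ('q \<Rightarrow> nat) \<Rightarrow> 'q matfam \<Rightarrow> 'q matfam \<Rightarrow> complex" where
  "matter_trace_form Q1 eps v w a b =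
     (\<Sum>p\<in>matter_basis Q1 eps v w. \<Sum>q\<in>matter_basis Q1 eps v w.
        matter_drep v w a p q * matter_drep v w b q p)"

definition anomaly_cancellation ::
    "'q set set \<Rightarrow> ('q \<Rightarrow> sign) \<Rightarrow> ('q \<Rightarrow> nat) \<Rightarrow> ('q \<Rightarrow> nat) \<Rightarrow> 'q matfam \<Rightarrow> bool" where
  "anomaly_cancellation Q1 eps v w omV \<longleftrightarrow>
     in_twice_Bil v (gauge_group eps v omV) (matter_trace_form Q1 eps v w)"

end

theory Submission
  imports Defs Jordan_Normal_Form.Schur_Decomposition
begin

text \<open>
  Elements of the Lie algebra are traceless, so the trace form of \<open>M\<close> is the sum over the vertices of
  \<open>c i * Tr (a i * b i)\<close> with \<open>c i = w i + (\<Sum>j. v j)\<close>, the sum being over the neighbours \<open>j\<close> of \<open>i\<close>.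

  A cocharacter of an isometry group grades the space by integers, symmetrically under \<open>m \<mapsto> - m\<close>.
  Hence \<open>Tr (a b)\<close> is an integer for commuting cocharacters and \<open>Tr (a a)\<close> is even for every
  cocharacter, whether or not it is a coroot; so evenness of all \<open>c i\<close> suffices. Conversely, at a symplectic
  vertex the coroot \<open>a\<close> of a long root has \<open>Tr (a a) = 2\<close>, which forces \<open>c i\<close> to be even. To have a
  coroot at all one needs a maximal torus: in a basis with antidiagonal Gram matrix the diagonal
  isometries form a torus containing an element with distinct eigenvalues, so it is its own
  centralizer.
\<close>

section \<open>Traces and Laurent polynomials\<close>

text \<open>\<open>Bil\<close> quantifies over every maximal torus, every pair of its cocharacters
  and every coroot, so sufficiency has to be checked on an arbitrary torus, without coordinates.
  This is why cocharacters are expanded as Laurent polynomials in \<open>z\<close> with matrix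
  coefficients: comparing coefficients turns the homomorphism law into the statement that the
  coefficients are mutually orthogonal idempotents, and the trace of an idempotent is an integer.
  Two cocharacters of one torus commute, hence so do their idempotents, and the products are again
  idempotent. For necessity one torus and one coroot are enough, but the torus must be maximal among
  all tori of the whole product group, and this has to be proved for forms given by arbitrary Gram
  matrices. The normal form therefore fixes only which entries of the Gram matrix vanish; this
  already determines the diagonal isometries. On the long coroot at \<open>i\<close> the trace form
  has the value 2 c i, and this must be twice an even integer.\<close>

definition mat_trace :: "complex mat \<Rightarrow> complex" where
  "mat_trace A = (\<Sum>k<dim_row A. A $$ (k, k))"

lemma mat_trace_mult:
  assumes "A \<in> carrier_mat d d" "B \<in> carrier_mat d d"
  shows "mat_trace (A * B) = (\<Sum>k<d. \<Sum>l<d. A $$ (k, l) * B $$ (l, k))"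
  using assms mat_mult_entry[OF assms] by (simp add: mat_trace_def del: index_mult_mat(1))

lemma mat_trace_comm:
  assumes "A \<in> carrier_mat d d" "B \<in> carrier_mat d d"
  shows "mat_trace (A * B) = mat_trace (B * A)"
  unfolding mat_trace_mult[OF assms] mat_trace_mult[OF assms(2,1)]
  by (subst sum.swap) (simp add: mult.commute)

lemma mat_trace_conj:
  assumes "P \<in> carrier_mat d d" "Q \<in> carrier_mat d d" "A \<in> carrier_mat d d" "Q * P = 1\<^sub>m d"
  shows "mat_trace (P * A * Q) = mat_trace A"
proof -
  have "mat_trace (P * A * Q) = mat_trace (Q * (P * A))"
    using assms by (intro mat_trace_comm) auto
  also have "Q * (P * A) = A"
    using assms by (simp flip: assoc_mult_mat)
  finally show ?thesis .
qed

lemma mat_trace_transpose: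
  assumes "A \<in> carrier_mat d d"
  shows "mat_trace (transpose_mat A) = mat_trace A"
  using assms by (auto simp: mat_trace_def intro!: sum.cong)

text \<open>In the sum over \<open>m\<close> the entry of \<open>A\<close> vanishes for
  \<open>m < k\<close> and the entry of \<open>B\<close> for \<open>m > k\<close>.\<close>

lemma upper_triangular_mult_diag:
  fixes A B :: "complex mat"
  assumes "A \<in> carrier_mat d d" "B \<in> carrier_mat d d" "upper_triangular A" "upper_triangular B" "k < d"
  shows "(A * B) $$ (k, k) = A $$ (k, k) * B $$ (k, k)"
proof -
  have "A $$ (k, m) * B $$ (m, k) = 0" if "m < d" "m \<noteq> k" for m
    using that assms upper_triangularD[of A m k] upper_triangularD[of B k m]
    by (cases "m < k") auto
  then have "(\<Sum>m<d. A $$ (k, m) * B $$ (m, k)) = (\<Sum>m\<in>{k}. A $$ (k, m) * B $$ (m, k))"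
    using assms by (intro sum.mono_neutral_right) auto
  then show ?thesis using mat_mult_entry[OF assms(1,2,5,5)] by simp
qed

text \<open>After triangularization each diagonal entry \<open>x\<close> satisfies
  \<open>x * x = x\<close>, so it is 0 or 1 and the trace counts the ones.\<close>

lemma mat_trace_idempotent_Ints:
  assumes P: "P \<in> carrier_mat d d" and idem: "P * P = P"
  shows "mat_trace P \<in> \<int>"
proof -
  obtain es where "char_poly P = (\<Prod>a\<leftarrow>es. [:- a, 1:])"
    using char_poly_factorized[OF P] by blast
  from schur_decomposition_exists[OF P this] obtain B where
    B: "B \<in> carrier_mat d d" "upper_triangular B" and "similar_mat P B" by blast
  then obtain X Y where XY: "similar_mat_wit P B X Y" unfolding similar_mat_def by blast
  note w = similar_mat_witD2[OF P XY]
  have "B = Y * P * X"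
    using similar_mat_witD2[OF B(1) similar_mat_wit_sym[OF XY]] by simp
  moreover have "(Y * P * X) * (Y * P * X) = Y * P * X"
  proof -
    have "(Y * P * X) * (Y * P * X) = Y * P * (X * Y) * P * X"
      using P w(6,7) by (simp add: assoc_mult_mat[of _ d d _ d _ d])
    also have "\<dots> = Y * (P * P) * X"
      using P w(1,6,7) by (simp add: assoc_mult_mat[of _ d d _ d _ d])
    finally show ?thesis by (simp add: idem)
  qed
  ultimately have BB: "B * B = B" by simp
  have "B $$ (k, k) \<in> \<int>" if "k < d" for k
  proof -
    have "B $$ (k, k) * B $$ (k, k) = B $$ (k, k)"
      using upper_triangular_mult_diag[OF B(1) B(1) B(2) B(2) that] by (simp add: BB)
    then have "B $$ (k, k) = 0 \<or> B $$ (k, k) = 1" by auto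
    then show ?thesis by auto
  qed
  then have "mat_trace B \<in> \<int>" using B(1) unfolding mat_trace_def by (intro Ints_sum) auto
  moreover have "mat_trace P = mat_trace B"
    using mat_trace_conj[OF w(6,7,5,2)] w(3) by simp
  ultimately show ?thesis by simp
qed

section \<open>Uniqueness of Laurent coefficients\<close>

lemma laurent_sum_eq_0:
  fixes c :: "int \<Rightarrow> complex"
  assumes "\<And>z. z \<noteq> 0 \<Longrightarrow> (\<Sum>m=-N..N. c m * z powi m) = 0" and "m \<in> {-N..N}"
  shows "c m = 0"
proof -
  \<comment> \<open>The Laurent sum times \<open>z powi N\<close>, an honest polynomial; it vanishes
    at every nonzero \<open>z\<close>, hence at infinitely many points.\<close>
  define p where "p = (\<Sum>m=-N..N. monom (c m) (nat (m + N)))"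
  have "poly p z = 0" if "z \<noteq> 0" for z
  proof -
    have "poly p z = (\<Sum>m=-N..N. c m * z powi m * z powi N)"
      unfolding p_def poly_sum poly_monom
    proof (intro sum.cong refl)
      fix m assume "m \<in> {-N..N}"
      then have "z ^ nat (m + N) = z powi (m + N)" by (simp add: power_int_def)
      then show "c m * z ^ nat (m + N) = c m * z powi m * z powi N"
        using that by (simp add: power_int_add)
    qed
    also have "\<dots> = 0" using assms(1)[OF that] by (simp flip: sum_distrib_right)
    finally show ?thesis .
  qed
  then have "UNIV - {0} \<subseteq> {z. poly p z = 0}" by blast
  moreover have "infinite (UNIV - {0 :: complex})" by (simp add: infinite_UNIV_char_0)
  ultimately have "p = 0" using poly_roots_finite finite_subset by blast
  moreover have "coeff p (nat (m + N)) = c m"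
  proof -
    have "coeff p (nat (m + N)) = (\<Sum>k=-N..N. if k = m then c k else 0)"
      unfolding p_def coeff_sum coeff_monom using assms(2)
      by (intro sum.cong refl) (auto simp: nat_eq_iff)
    then show ?thesis using assms(2) by simp
  qed
  ultimately show ?thesis by simp
qed

lemma laurent_sum_unique:
  fixes b c :: "int \<Rightarrow> complex"
  assumes "\<And>z. z \<noteq> 0 \<Longrightarrow> (\<Sum>m=-N..N. b m * z powi m) = (\<Sum>m=-N..N. c m * z powi m)"
    and "m \<in> {-N..N}"
  shows "b m = c m"
  using laurent_sum_eq_0[where N = N and c = "\<lambda>m. b m - c m", OF _ assms(2)] assms(1)
  by (simp add: left_diff_distrib sum_subtractf)

text \<open>For fixed \<open>u\<close> the coefficients of the powers of \<open>z\<close> agree, and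
  these are themselves Laurent sums in \<open>u\<close>.\<close>

lemma laurent_sum_unique2:
  fixes b c :: "int \<Rightarrow> int \<Rightarrow> complex"
  assumes "\<And>z u. z \<noteq> 0 \<Longrightarrow> u \<noteq> 0 \<Longrightarrow>
      (\<Sum>m=-N..N. \<Sum>n=-N..N. b m n * z powi m * u powi n) =
      (\<Sum>m=-N..N. \<Sum>n=-N..N. c m n * z powi m * u powi n)"
    and "m \<in> {-N..N}" "n \<in> {-N..N}"
  shows "b m n = c m n"
proof -
  have "(\<Sum>n=-N..N. b m n * u powi n) = (\<Sum>n=-N..N. c m n * u powi n)" if "u \<noteq> 0" for u
    by (rule laurent_sum_unique[where N = N and m = m])
      (use assms that in \<open>simp_all add: sum_distrib_left sum_distrib_right mult_ac\<close>)
  then show ?thesis by (rule laurent_sum_unique[OF _ assms(3)])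
qed

text \<open>\<open>laurent_fun\<close> indexes monomials by functions on all naturals, so several
  indices may give the same power of the single variable; they are grouped by their value at 0.
  Coefficients that serve every large enough range \<open>{-M..M}\<close> let expansions of
  different functions be put on one common range.\<close>

lemma laurent_fun_1D:
  fixes f :: "complex \<Rightarrow> complex"
  assumes "laurent_fun 1 (\<lambda>z. f (z 0))"
  shows "\<exists>N c. \<forall>z M. z \<noteq> 0 \<longrightarrow> N \<le> M \<longrightarrow> f z = (\<Sum>m=-M..M. c m * z powi m)"
proof -
  from assms obtain S :: "(nat \<Rightarrow> int) set" and c where S: "finite S"
    and f: "\<And>z. z \<in> std_torus 1 \<Longrightarrow> f (z 0) = (\<Sum>m\<in>S. c m * (\<Prod>k<1. z k powi m k))"
    unfolding laurent_fun_def by blast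
  define b where "b = (\<lambda>j. \<Sum>m\<in>{m\<in>S. m 0 = j}. c m)"
  \<comment> \<open>A crude bound on all exponents; on larger ranges the additional coefficients
    \<open>b j\<close> are empty sums.\<close>
  define N where "N = (\<Sum>m\<in>S. \<bar>m 0\<bar>)"
  show ?thesis
  proof (intro exI allI impI)
    fix z :: complex and M assume z: "z \<noteq> 0" and M: "N \<le> M"
    have "\<bar>m 0\<bar> \<le> M" if "m \<in> S" for m
      using member_le_sum[of m S "\<lambda>m. \<bar>m 0\<bar>"] S that M by (simp add: N_def)
    then have sub: "(\<lambda>m. m 0) ` S \<subseteq> {-M..M}" by force
    have "f z = (\<Sum>m\<in>S. c m * z powi m 0)"
      using f[of "\<lambda>k\<in>{..<1}. z"] z by (auto simp: std_torus_def)
    also have "\<dots> = (\<Sum>j=-M..M. \<Sum>m\<in>{m\<in>S. m 0 = j}. c m * z powi m 0)"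
      using S sub by (intro sum.group [symmetric]) auto
    also have "\<dots> = (\<Sum>j=-M..M. b j * z powi j)"
      unfolding b_def sum_distrib_right by (intro sum.cong refl) auto
    finally show "f z = (\<Sum>m=-M..M. b m * z powi m)" .
  qed
qed

section \<open>Cocharacters as integer gradings\<close>

lemma invertible_matE:
  fixes A :: "complex mat"
  assumes A: "A \<in> carrier_mat d d" "invertible_mat A"
  obtains B where "B \<in> carrier_mat d d" "A * B = 1\<^sub>m d" "B * A = 1\<^sub>m d"
proof -
  obtain B where B: "A * B = 1\<^sub>m d" "B * A = 1\<^sub>m (dim_row B)"
    using A unfolding invertible_mat_def inverts_mat_def by auto
  have "dim_col B = d" using arg_cong[OF B(1), of dim_col] by simp
  moreover have "dim_row B = d" using arg_cong[OF B(2), of dim_col] A(1) by simp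
  ultimately have "B \<in> carrier_mat d d" "B * A = 1\<^sub>m d" using B(2) by (auto simp only: carrier_matI)
  then show thesis by (intro that[of B] B(1))
qed

text \<open>One vertex component of a cocharacter. The value \<open>L 1\<close> is not prescribed
  and is at first only an idempotent; for isometries it is later shown to be the identity.\<close>

definition mat_cochar :: "nat \<Rightarrow> (complex \<Rightarrow> complex mat) \<Rightarrow> bool" where
  "mat_cochar d L \<longleftrightarrow> (\<forall>z. z \<noteq> 0 \<longrightarrow> L z \<in> carrier_mat d d) \<and>
     (\<forall>z u. z \<noteq> 0 \<longrightarrow> u \<noteq> 0 \<longrightarrow> L (z * u) = L z * L u) \<and>
     (\<forall>k<d. \<forall>l<d. laurent_fun 1 (\<lambda>z. L (z 0) $$ (k, l)))"

text \<open>\<open>P m\<close> is the matrix coefficient of \<open>z powi m\<close>; for a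
  cocharacter these turn out to be the projections to the weight spaces. The range \<open>N\<close>
  is a parameter so that two cocharacters can share it.\<close>

definition weight_decomp :: "nat \<Rightarrow> int \<Rightarrow> (complex \<Rightarrow> complex mat) \<Rightarrow> (int \<Rightarrow> complex mat) \<Rightarrow> bool" where
  "weight_decomp d N L P \<longleftrightarrow> (\<forall>m. P m \<in> carrier_mat d d) \<and>
     (\<forall>z. z \<noteq> 0 \<longrightarrow> L z \<in> carrier_mat d d) \<and>
     (\<forall>z k l. z \<noteq> 0 \<longrightarrow> k < d \<longrightarrow> l < d \<longrightarrow>
        L z $$ (k, l) = (\<Sum>m=-N..N. P m $$ (k, l) * z powi m))"

lemma weight_decompD:
  assumes "weight_decomp d N L P"
  shows "P m \<in> carrier_mat d d" "z \<noteq> 0 \<Longrightarrow> L z \<in> carrier_mat d d"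
    "z \<noteq> 0 \<Longrightarrow> k < d \<Longrightarrow> l < d \<Longrightarrow> L z $$ (k, l) = (\<Sum>m=-N..N. P m $$ (k, l) * z powi m)"
  using assms unfolding weight_decomp_def by blast+

lemma weight_decomp_exists:
  assumes "mat_cochar d L"
  shows "\<exists>N P. \<forall>M\<ge>N. weight_decomp d M L P"
proof -
  \<comment> \<open>Each matrix entry has its own range and coefficients; a single predicate for
    both allows one choice over all \<open>k\<close> and \<open>l\<close>.\<close>
  define E where "E k l N c \<longleftrightarrow>
    (\<forall>z M. z \<noteq> 0 \<longrightarrow> N \<le> M \<longrightarrow> L z $$ (k, l) = (\<Sum>m=-M..M. c m * z powi m))"
    for k l :: nat and N :: int and c :: "int \<Rightarrow> complex"
  have "\<exists>N c. E k l N c" if kl: "k < d" "l < d" for k l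
  proof -
    have "laurent_fun 1 (\<lambda>z. L (z 0) $$ (k, l))" using kl assms by (simp add: mat_cochar_def)
    from laurent_fun_1D[of "\<lambda>z. L z $$ (k, l)", OF this] show ?thesis
      unfolding E_def .
  qed
  then obtain N c where "\<And>k l. k < d \<Longrightarrow> l < d \<Longrightarrow> E k l (N k l) (c k l)" by metis
  then have Nc: "\<And>k l z M. k < d \<Longrightarrow> l < d \<Longrightarrow> z \<noteq> 0 \<Longrightarrow> N k l \<le> M \<Longrightarrow>
      L z $$ (k, l) = (\<Sum>m=-M..M. c k l m * z powi m)" unfolding E_def by blast
  show ?thesis
  proof (intro exI allI impI)
    fix M assume M: "(\<Sum>k<d. \<Sum>l<d. \<bar>N k l\<bar>) \<le> M"
    have "N k l \<le> M" if "k < d" "l < d" for k l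
    proof -
      have "\<bar>N k l\<bar> \<le> (\<Sum>l<d. \<bar>N k l\<bar>)"
        using that by (intro member_le_sum[of l _ "\<lambda>l. \<bar>N k l\<bar>"]) auto
      also have "\<dots> \<le> (\<Sum>k<d. \<Sum>l<d. \<bar>N k l\<bar>)"
        using that by (intro member_le_sum[of k _ "\<lambda>k. \<Sum>l<d. \<bar>N k l\<bar>"]) (auto intro: sum_nonneg)
      finally show ?thesis using M by simp
    qed
    then have "L z $$ (k, l) = (\<Sum>m=-M..M. c k l m * z powi m)" if "z \<noteq> 0" "k < d" "l < d" for z k l
      using that by (intro Nc) auto
    moreover have "L z \<in> carrier_mat d d" if "z \<noteq> 0" for z
      using assms that by (simp add: mat_cochar_def)
    ultimately show "weight_decomp d M L (\<lambda>m. mat d d (\<lambda>(k, l). c k l m))"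
      unfolding weight_decomp_def by simp
  qed
qed

text \<open>Two independent variables keep the products \<open>P m * Q n\<close> apart: each is the
  coefficient of its own monomial.\<close>

lemma weight_decomp_mult_entry:
  assumes L: "weight_decomp d N L P" and M: "weight_decomp d N M Q"
    and "z \<noteq> 0" "u \<noteq> 0" "k < d" "l < d"
  shows "(L z * M u) $$ (k, l) = (\<Sum>m=-N..N. \<Sum>n=-N..N. (P m * Q n) $$ (k, l) * z powi m * u powi n)"
proof -
  note [simp del] = index_mult_mat(1)
  have "(L z * M u) $$ (k, l) = (\<Sum>j<d. L z $$ (k, j) * M u $$ (j, l))"
    using weight_decompD(2)[OF L] weight_decompD(2)[OF M] assms by (intro mat_mult_entry) auto
  also have "\<dots> = (\<Sum>j<d. \<Sum>m=-N..N. \<Sum>n=-N..N. P m $$ (k, j) * z powi m * (Q n $$ (j, l) * u powi n))"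
    using assms by (intro sum.cong refl)
      (simp add: weight_decompD(3)[OF L] weight_decompD(3)[OF M] sum_product)
  also have "\<dots> = (\<Sum>m=-N..N. \<Sum>j<d. \<Sum>n=-N..N. P m $$ (k, j) * z powi m * (Q n $$ (j, l) * u powi n))"
    by (rule sum.swap)
  also have "\<dots> = (\<Sum>m=-N..N. \<Sum>n=-N..N. \<Sum>j<d. P m $$ (k, j) * z powi m * (Q n $$ (j, l) * u powi n))"
    by (intro sum.cong refl sum.swap)
  also have "\<dots> = (\<Sum>m=-N..N. \<Sum>n=-N..N. (P m * Q n) $$ (k, l) * z powi m * u powi n)"
    using mat_mult_entry[OF weight_decompD(1)[OF L] weight_decompD(1)[OF M] assms(5,6)]
    by (simp add: sum_distrib_right sum_distrib_left mult_ac)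
  finally show ?thesis .
qed

text \<open>Compare coefficients in \<open>L z * L u = L (z * u)\<close>: the right-hand side
  contains only the monomials \<open>z powi m * u powi m\<close>.\<close>

lemma weight_proj_mult:
  assumes "mat_cochar d L" and L: "weight_decomp d N L P" and mn: "m \<in> {-N..N}" "n \<in> {-N..N}"
  shows "P m * P n = (if m = n then P m else 0\<^sub>m d d)"
proof (rule eq_matI)
  note c = weight_decompD(1)[OF L]
  fix k l assume "k < dim_row (if m = n then P m else 0\<^sub>m d d)"
    "l < dim_col (if m = n then P m else 0\<^sub>m d d)"
  then have kl: "k < d" "l < d" using c[of m] by (auto split: if_splits)
  have "(P m * P n) $$ (k, l) = (if m = n then P m $$ (k, l) else 0)"
  proof (rule laurent_sum_unique2[OF _ mn, where
        b = "\<lambda>m n. (P m * P n) $$ (k, l)" and c = "\<lambda>m n. if m = n then P m $$ (k, l) else 0"])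
    fix z u :: complex assume zu: "z \<noteq> 0" "u \<noteq> 0"
    have "(\<Sum>m=-N..N. \<Sum>n=-N..N. (P m * P n) $$ (k, l) * z powi m * u powi n) = L (z * u) $$ (k, l)"
      using weight_decomp_mult_entry[OF L L zu kl] assms(1) zu by (simp add: mat_cochar_def)
    also have "\<dots> = (\<Sum>m=-N..N. P m $$ (k, l) * z powi m * u powi m)"
      using zu kl by (simp add: weight_decompD(3)[OF L] power_int_mult_distrib mult_ac)
    also have "\<dots> = (\<Sum>m=-N..N. \<Sum>n=-N..N. if m = n then P m $$ (k, l) * z powi m * u powi n else 0)"
      by (intro sum.cong refl) (simp add: sum.delta)
    also have "\<dots> = (\<Sum>m=-N..N. \<Sum>n=-N..N. (if m = n then P m $$ (k, l) else 0) * z powi m * u powi n)"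
      by (intro sum.cong refl) auto
    finally show "(\<Sum>m=-N..N. \<Sum>n=-N..N. (P m * P n) $$ (k, l) * z powi m * u powi n) = \<dots>" .
  qed
  then show "(P m * P n) $$ (k, l) = (if m = n then P m else 0\<^sub>m d d) $$ (k, l)"
    using kl by auto
qed (use weight_decompD(1)[OF L] in auto)

text \<open>Both orders of the product expand into the same monomials, so commutation passes to the
  coefficients.\<close>

lemma weight_proj_commute:
  assumes L: "weight_decomp d N L P" and M: "weight_decomp d N M Q"
    and comm: "\<And>z u. z \<noteq> 0 \<Longrightarrow> u \<noteq> 0 \<Longrightarrow> L z * M u = M u * L z"
    and mn: "m \<in> {-N..N}" "n \<in> {-N..N}"
  shows "P m * Q n = Q n * P m"
proof (rule eq_matI)
  note c = weight_decompD(1)[OF L] weight_decompD(1)[OF M]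
  fix k l assume "k < dim_row (Q n * P m)" "l < dim_col (Q n * P m)"
  then have kl: "k < d" "l < d" using c(1)[of m] c(2)[of n] by auto
  show "(P m * Q n) $$ (k, l) = (Q n * P m) $$ (k, l)"
  proof (rule laurent_sum_unique2[OF _ mn, where
        b = "\<lambda>m n. (P m * Q n) $$ (k, l)" and c = "\<lambda>m n. (Q n * P m) $$ (k, l)"])
    fix z u :: complex assume zu: "z \<noteq> 0" "u \<noteq> 0"
    have "(\<Sum>m=-N..N. \<Sum>n=-N..N. (P m * Q n) $$ (k, l) * z powi m * u powi n) = (M u * L z) $$ (k, l)"
      using weight_decomp_mult_entry[OF L M zu kl] comm[OF zu] by simp
    also have "\<dots> = (\<Sum>n=-N..N. \<Sum>m=-N..N. (Q n * P m) $$ (k, l) * u powi n * z powi m)"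
      by (rule weight_decomp_mult_entry[OF M L zu(2,1) kl])
    also have "\<dots> = (\<Sum>m=-N..N. \<Sum>n=-N..N. (Q n * P m) $$ (k, l) * z powi m * u powi n)"
      by (subst sum.swap) (simp only: mult_ac)
    finally show "(\<Sum>m=-N..N. \<Sum>n=-N..N. (P m * Q n) $$ (k, l) * z powi m * u powi n) = \<dots>" .
  qed
qed (use weight_decompD(1)[OF L] weight_decompD(1)[OF M] in \<open>auto simp: carrier_matD[of _ d d]\<close>)

section \<open>Differentials of cocharacters and their trace pairing\<close>

definition mat_cochar_diff :: "nat \<Rightarrow> (complex \<Rightarrow> complex mat) \<Rightarrow> complex mat" where
  "mat_cochar_diff d L = mat d d (\<lambda>(k, l). deriv (\<lambda>z. L z $$ (k, l)) 1)"

lemma mat_cochar_diff_carrier [simp]: "mat_cochar_diff d L \<in> carrier_mat d d"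
  by (simp add: mat_cochar_diff_def)

text \<open>The derivative of \<open>z powi m\<close> at 1 is \<open>m\<close>, so the differential
  is the sum of the coefficients weighted by their exponents.\<close>

lemma mat_cochar_diff_entry:
  assumes L: "weight_decomp d N L P" and kl: "k < d" "l < d"
  shows "mat_cochar_diff d L $$ (k, l) = (\<Sum>m=-N..N. of_int m * P m $$ (k, l))"
proof -
  let ?g = "\<lambda>z. \<Sum>m=-N..N. P m $$ (k, l) * z powi m"
  \<comment> \<open>The expansion holds only away from 0, so it is used on a neighbourhood of 1 that
    avoids 0.\<close>
  have "eventually (\<lambda>z. z \<in> - {0 :: complex}) (nhds 1)"
    by (rule eventually_nhds_in_open) auto
  then have "eventually (\<lambda>z. L z $$ (k, l) = ?g z) (nhds 1)"
    by eventually_elim (use kl in \<open>simp add: weight_decompD(3)[OF L]\<close>)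
  then have "deriv (\<lambda>z. L z $$ (k, l)) 1 = deriv ?g 1"
    by (rule deriv_cong_ev) simp
  also have "(?g has_field_derivative (\<Sum>m=-N..N. of_int m * P m $$ (k, l))) (at 1)"
    by (auto intro!: derivative_eq_intros sum.cong)
  then have "deriv ?g 1 = (\<Sum>m=-N..N. of_int m * P m $$ (k, l))" by (rule DERIV_imp_deriv)
  finally show ?thesis using kl by (simp add: mat_cochar_diff_def)
qed

lemma mat_trace_cochar_diff_mult:
  assumes L: "weight_decomp d N L P" and M: "weight_decomp d N M Q"
  shows "mat_trace (mat_cochar_diff d L * mat_cochar_diff d M) =
    (\<Sum>m=-N..N. \<Sum>n=-N..N. of_int (m * n) * mat_trace (P m * Q n))"
proof -
  let ?h = "\<lambda>m n k l. of_int (m * n) * (P m $$ (k, l) * Q n $$ (l, k))"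
  have "mat_trace (mat_cochar_diff d L * mat_cochar_diff d M) =
      (\<Sum>k<d. \<Sum>l<d. \<Sum>m=-N..N. \<Sum>n=-N..N. ?h m n k l)"
    unfolding mat_trace_mult[OF mat_cochar_diff_carrier mat_cochar_diff_carrier]
    by (intro sum.cong refl)
      (simp add: mat_cochar_diff_entry[OF L] mat_cochar_diff_entry[OF M] sum_product mult_ac)
  also have "\<dots> = (\<Sum>k<d. \<Sum>m=-N..N. \<Sum>l<d. \<Sum>n=-N..N. ?h m n k l)"
    by (intro sum.cong refl sum.swap)
  also have "\<dots> = (\<Sum>k<d. \<Sum>m=-N..N. \<Sum>n=-N..N. \<Sum>l<d. ?h m n k l)"
    by (intro sum.cong refl sum.swap)
  also have "\<dots> = (\<Sum>m=-N..N. \<Sum>k<d. \<Sum>n=-N..N. \<Sum>l<d. ?h m n k l)"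
    by (rule sum.swap)
  also have "\<dots> = (\<Sum>m=-N..N. \<Sum>n=-N..N. \<Sum>k<d. \<Sum>l<d. ?h m n k l)"
    by (intro sum.cong refl sum.swap)
  finally show ?thesis
    by (simp add: mat_trace_mult[OF weight_decompD(1)[OF L] weight_decompD(1)[OF M]] sum_distrib_left)
qed

text \<open>The product of two commuting idempotents is idempotent, the projection to a joint weight
  space; the pairing is then a sum of integers \<open>m * n\<close> times integral traces.\<close>

lemma mat_trace_cochar_diff_mult_Ints:
  assumes L: "mat_cochar d L" and M: "mat_cochar d M"
    and comm: "\<And>z u. z \<noteq> 0 \<Longrightarrow> u \<noteq> 0 \<Longrightarrow> L z * M u = M u * L z"
  shows "mat_trace (mat_cochar_diff d L * mat_cochar_diff d M) \<in> \<int>"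
proof -
  obtain N1 P where P: "\<And>n. N1 \<le> n \<Longrightarrow> weight_decomp d n L P" using weight_decomp_exists[OF L] by blast
  obtain N2 Q where Q: "\<And>n. N2 \<le> n \<Longrightarrow> weight_decomp d n M Q" using weight_decomp_exists[OF M] by blast
  define N where "N = max N1 N2"
  have D: "weight_decomp d N L P" "weight_decomp d N M Q" using P Q by (simp_all add: N_def)
  have "mat_trace (P m * Q n) \<in> \<int>" if mn: "m \<in> {-N..N}" "n \<in> {-N..N}" for m n
  proof -
    note c = weight_decompD(1)[OF D(1), of m] weight_decompD(1)[OF D(2), of n]
    have "(P m * Q n) * (P m * Q n) = P m * (Q n * P m) * Q n"
      using c by (simp add: assoc_mult_mat[of _ d d _ d _ d])
    also have "\<dots> = P m * (P m * Q n) * Q n"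
      by (simp add: weight_proj_commute[OF D comm mn])
    also have "\<dots> = (P m * P m) * (Q n * Q n)"
      using c by (simp add: assoc_mult_mat[of _ d d _ d _ d])
    also have "\<dots> = P m * Q n"
      using weight_proj_mult[OF L D(1) mn(1,1)] weight_proj_mult[OF M D(2) mn(2,2)] by simp
    finally show ?thesis using c by (intro mat_trace_idempotent_Ints[of _ d]) auto
  qed
  then show ?thesis
    unfolding mat_trace_cochar_diff_mult[OF D] by (intro Ints_sum Ints_mult Ints_of_int) auto
qed

text \<open>The weights of an isometric representation of \<open>\<complex>\<^sup>\<times>\<close> come in pairs \<open>\<plusminus>m\<close>, so that the sum of
  their squares is even.\<close>

lemma mat_trace_cochar_diff_square_even:
  assumes L: "mat_cochar d L" and A: "A \<in> carrier_mat d d" "invertible_mat A"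
    and iso: "\<And>z. z \<noteq> 0 \<Longrightarrow> transpose_mat (L z) * A * L z = A"
  obtains k :: int where "mat_trace (mat_cochar_diff d L * mat_cochar_diff d L) = of_int (2 * k)"
proof -
  obtain N0 P where P: "\<And>n. N0 \<le> n \<Longrightarrow> weight_decomp d n L P" using weight_decomp_exists[OF L] by blast
  \<comment> \<open>Nonnegative, so that the range can later be split at 0.\<close>
  define N where "N = max N0 0"
  have D: "weight_decomp d N L P" and N: "0 \<le> N" using P by (simp_all add: N_def)
  note c = weight_decompD(1)[OF D]
  obtain A' where A': "A' \<in> carrier_mat d d" "A * A' = 1\<^sub>m d" "A' * A = 1\<^sub>m d"
    using invertible_matE[OF A] .
  have carr: "L z \<in> carrier_mat d d" if "z \<noteq> 0" for z using weight_decompD(2)[OF D that] .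
  have tr: "mat_trace (L z) = (\<Sum>m=-N..N. mat_trace (P m) * z powi m)" if "z \<noteq> 0" for z
  proof -
    have "mat_trace (L z) = (\<Sum>k<d. \<Sum>m=-N..N. P m $$ (k, k) * z powi m)"
      using carr[OF that] that by (simp add: mat_trace_def weight_decompD(3)[OF D])
    also have "\<dots> = (\<Sum>m=-N..N. \<Sum>k<d. P m $$ (k, k) * z powi m)" by (rule sum.swap)
    finally show ?thesis using c by (simp add: mat_trace_def sum_distrib_right carrier_matD[OF c])
  qed
  \<comment> \<open>The isometry condition says that \<open>A' * transpose_mat (L z) * A\<close> is
    a left inverse of \<open>L z\<close>.\<close>
  have left: "A' * transpose_mat (L z) * A * L z = 1\<^sub>m d" if "z \<noteq> 0" for z
  proof -
    have "A' * transpose_mat (L z) * A * L z = A' * (transpose_mat (L z) * A * L z)"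
      using carr[OF that] A A' by (simp add: assoc_mult_mat[of _ d d _ d _ d])
    then show ?thesis using iso[OF that] A' by simp
  qed
  \<comment> \<open>An idempotent with a left inverse is the identity.\<close>
  have one: "L 1 = 1\<^sub>m d"
  proof -
    let ?X = "A' * transpose_mat (L 1) * A"
    have X: "?X \<in> carrier_mat d d" using carr[of 1] A A' by auto
    have "L 1 = ?X * L 1 * L 1" using left[of 1] carr[of 1] by simp
    also have "\<dots> = ?X * (L 1 * L 1)" using X carr[of 1] by (intro assoc_mult_mat) auto
    also have "L 1 * L 1 = L 1"
      using L unfolding mat_cochar_def by (metis mult_1 zero_neq_one)
    finally show ?thesis using left[of 1] by simp
  qed
  \<comment> \<open>\<open>L (inverse z)\<close> is conjugate by \<open>A\<close> to the transpose
    of \<open>L z\<close>, and conjugation and transposition preserve traces.\<close>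
  have inv: "mat_trace (L (inverse z)) = mat_trace (L z)" if z: "z \<noteq> 0" for z
  proof -
    let ?X = "A' * transpose_mat (L z) * A"
    have z': "inverse z \<noteq> 0" using z by simp
    have X: "?X \<in> carrier_mat d d" using carr[OF z] A A' by auto
    have LL: "L z * L (inverse z) = 1\<^sub>m d"
      using L z z' one unfolding mat_cochar_def by (metis right_inverse)
    have "?X = ?X * (L z * L (inverse z))" by (simp only: LL right_mult_one_mat[OF X])
    also have "\<dots> = ?X * L z * L (inverse z)"
      using X carr[OF z] carr[OF z'] by (intro assoc_mult_mat [symmetric]) auto
    also have "\<dots> = L (inverse z)" using left[OF z] carr[OF z'] by simp
    finally show ?thesis
      using mat_trace_conj[OF A'(1) A(1) _ A'(2), of "transpose_mat (L z)"] carr[OF z]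
        mat_trace_transpose[OF carr[OF z]] by simp
  qed
  \<comment> \<open>The trace of \<open>L z\<close> is a Laurent polynomial invariant under
    inversion of \<open>z\<close>, so its coefficients are symmetric.\<close>
  have sym: "mat_trace (P (- m)) = mat_trace (P m)" if m: "m \<in> {-N..N}" for m
  proof (rule laurent_sum_unique[OF _ m, where b = "\<lambda>m. mat_trace (P (- m))"])
    fix z :: complex assume z: "z \<noteq> 0"
    have "(\<Sum>m=-N..N. mat_trace (P (- m)) * z powi m) = (\<Sum>m=-N..N. mat_trace (P m) * inverse z powi m)"
      by (rule sum.reindex_bij_witness[of _ uminus uminus]) (auto simp: power_int_minus power_int_inverse)
    also have "\<dots> = mat_trace (L z)" using tr[of "inverse z"] z inv[OF z] by simp
    finally show "(\<Sum>m=-N..N. mat_trace (P (- m)) * z powi m) = (\<Sum>m=-N..N. mat_trace (P m) * z powi m)"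
      using tr[OF z] by simp
  qed
  have "mat_trace (mat_cochar_diff d L * mat_cochar_diff d L) =
      (\<Sum>m=-N..N. \<Sum>n=-N..N. if m = n then of_int (m * m) * mat_trace (P m) else 0)"
    unfolding mat_trace_cochar_diff_mult[OF D D]
    by (intro sum.cong refl) (auto simp: weight_proj_mult[OF L D] mat_trace_def)
  also have "\<dots> = (\<Sum>m=-N..N. of_int (m * m) * mat_trace (P m))" by simp
  \<comment> \<open>The weight 0 contributes nothing and opposite weights contribute equally, whence
    the factor 2.\<close>
  also have "\<dots> = (\<Sum>m\<in>{-N..-1} \<union> {0} \<union> {1..N}. of_int (m * m) * mat_trace (P m))"
    using N by (intro sum.cong) auto
  also have "\<dots> = (\<Sum>m=-N..-1. of_int (m * m) * mat_trace (P m)) + (\<Sum>m=1..N. of_int (m * m) * mat_trace (P m))"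
    by (subst sum.union_disjoint; simp?)+
  also have "(\<Sum>m=-N..-1. of_int (m * m) * mat_trace (P m)) = (\<Sum>m=1..N. of_int (m * m) * mat_trace (P m))"
    by (rule sum.reindex_bij_witness[of _ uminus uminus]) (auto simp: sym)
  finally have *: "mat_trace (mat_cochar_diff d L * mat_cochar_diff d L) =
      2 * (\<Sum>m=1..N. of_int (m * m) * mat_trace (P m))" by simp
  have "(\<Sum>m=1..N. of_int (m * m) * mat_trace (P m)) \<in> \<int>"
  proof (intro Ints_sum Ints_mult Ints_of_int)
    fix m assume "m \<in> {1..N}"
    then have m: "m \<in> {-N..N}" by simp
    show "mat_trace (P m) \<in> \<int>"
      using mat_trace_idempotent_Ints[OF c] weight_proj_mult[OF L D m m] by simp
  qed
  then show thesis using * that by (auto elim!: Ints_cases)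
qed

section \<open>Antidiagonal normal form of a bilinear form\<close>

text \<open>Fewer than \<open>d\<close> linear conditions in dimension \<open>d\<close>: the square
  matrix with rows \<open>a k\<close> and zero rows added is singular.\<close>

lemma exists_orthogonal_vec:
  fixes a :: "nat \<Rightarrow> complex vec"
  assumes m: "m < d" and a: "\<And>k. k < m \<Longrightarrow> a k \<in> carrier_vec d"
  shows "\<exists>x. x \<in> carrier_vec d \<and> x \<noteq> 0\<^sub>v d \<and> (\<forall>k<m. a k \<bullet> x = 0)"
proof -
  define c where "c i = (if i < m then a i else 0\<^sub>v d)" for i
  \<comment> \<open>Row \<open>m\<close> is zeroed explicitly to match the shape in
    \<open>det_row_0\<close>; the rows after it are zero by the definition of
    \<open>c\<close>.\<close>
  define M where "M = mat\<^sub>r d d (\<lambda>i. if i = m then 0\<^sub>v d else c i)"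
  have c: "c \<in> {0..<d} \<rightarrow> carrier_vec d" using a by (auto simp: c_def)
  have M: "M \<in> carrier_mat d d" by (simp add: M_def)
  have "det M = 0" unfolding M_def by (rule det_row_0[OF m c])
  then obtain x where x: "x \<in> carrier_vec d" "x \<noteq> 0\<^sub>v d" "M *\<^sub>v x = 0\<^sub>v d"
    using det_0_iff_vec_prod_zero[OF M] by blast
  have "a k \<bullet> x = 0" if k: "k < m" for k
  proof -
    have "row M k = a k" using k m a[OF k] unfolding M_def by (subst row_mat_of_row_fun) (auto simp: c_def)
    then have "(M *\<^sub>v x) $ k = a k \<bullet> x" using k m M by simp
    then show ?thesis using x(3) k m by simp
  qed
  then show ?thesis using x by blast
qed

lemma mult_mat_zero_vec:
  fixes M :: "complex mat"
  shows "M \<in> carrier_mat n m \<Longrightarrow> M *\<^sub>v 0\<^sub>v m = 0\<^sub>v n"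
  by (intro eq_vecI) auto

lemma smult_mat_mult_vec:
  fixes M :: "complex mat"
  assumes "M \<in> carrier_mat n m" "x \<in> carrier_vec m"
  shows "(c \<cdot>\<^sub>m M) *\<^sub>v x = c \<cdot>\<^sub>v (M *\<^sub>v x)"
  using assms by (intro eq_vecI) auto

section \<open>Symmetric (\<open>s = 1\<close>) and antisymmetric (\<open>s = - 1\<close>) forms and
  their hyperbolic pairs\<close>

locale eps_form =
  fixes d :: nat and s :: complex and A :: "complex mat"
  assumes carrier: "A \<in> carrier_mat d d" and invertible: "invertible_mat A"
    and transpose: "transpose_mat A = s \<cdot>\<^sub>m A" and s: "s = 1 \<or> s = - 1"
begin

definition B :: "complex vec \<Rightarrow> complex vec \<Rightarrow> complex" where "B x y = x \<bullet> (A *\<^sub>v y)"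

lemma B_add_left:
  "x \<in> carrier_vec d \<Longrightarrow> x' \<in> carrier_vec d \<Longrightarrow> y \<in> carrier_vec d \<Longrightarrow> B (x + x') y = B x y + B x' y"
  using carrier by (simp add: B_def add_scalar_prod_distrib[of _ d])

lemma B_add_right:
  "x \<in> carrier_vec d \<Longrightarrow> y \<in> carrier_vec d \<Longrightarrow> y' \<in> carrier_vec d \<Longrightarrow> B x (y + y') = B x y + B x y'"
  using carrier by (simp add: B_def mult_add_distrib_mat_vec[of _ d d] scalar_prod_add_distrib[of _ d])

lemma B_smult_left:
  "x \<in> carrier_vec d \<Longrightarrow> y \<in> carrier_vec d \<Longrightarrow> B (c \<cdot>\<^sub>v x) y = c * B x y"
  using carrier by (simp add: B_def)

lemma B_smult_right:
  "x \<in> carrier_vec d \<Longrightarrow> y \<in> carrier_vec d \<Longrightarrow> B x (c \<cdot>\<^sub>v y) = c * B x y"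
  using carrier by (simp add: B_def mult_mat_vec[of _ d d])

lemma B_swap:
  assumes "x \<in> carrier_vec d" "y \<in> carrier_vec d"
  shows "B y x = s * B x y"
proof -
  have "B y x = (transpose_mat A *\<^sub>v y) \<bullet> x"
    using transpose_vec_mult_scalar[OF carrier assms] by (simp add: B_def)
  also have "\<dots> = s * ((A *\<^sub>v y) \<bullet> x)"
    using carrier assms by (simp add: transpose smult_mat_mult_vec[of _ d d])
  also have "(A *\<^sub>v y) \<bullet> x = B x y"
    unfolding B_def using carrier assms by (intro comm_scalar_prod) auto
  finally show ?thesis .
qed

lemma s_square [simp]: "s * s = 1" using s by auto

lemma B_swap_eq_0:
  "x \<in> carrier_vec d \<Longrightarrow> y \<in> carrier_vec d \<Longrightarrow> B x y = 0 \<Longrightarrow> B y x = 0"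
  using B_swap[of x y] by simp

text \<open>\<open>A *\<^sub>v x\<close> has a nonzero coordinate, so some unit vector pairs
  nontrivially with \<open>x\<close>; rescaling gives the value 1.\<close>

lemma nondegenerate:
  assumes "x \<in> carrier_vec d" "x \<noteq> 0\<^sub>v d"
  shows "\<exists>g\<in>carrier_vec d. B x g = 1"
proof -
  obtain A' where A': "A' \<in> carrier_mat d d" "A' * A = 1\<^sub>m d"
    using invertible_matE[OF carrier invertible] by blast
  have "A *\<^sub>v x \<noteq> 0\<^sub>v d"
  proof
    assume "A *\<^sub>v x = 0\<^sub>v d"
    then have "A' *\<^sub>v (A *\<^sub>v x) = A' *\<^sub>v 0\<^sub>v d" by simp
    also have "A' *\<^sub>v (A *\<^sub>v x) = (A' * A) *\<^sub>v x"
      using carrier A' assms(1) by (intro assoc_mult_mat_vec [symmetric]) auto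
    finally show False using A' assms by (simp add: mult_mat_zero_vec[OF A'(1)])
  qed
  moreover have Ax: "A *\<^sub>v x \<in> carrier_vec d" using carrier assms by simp
  ultimately obtain j where j: "j < d" "(A *\<^sub>v x) $ j \<noteq> 0"
    by (metis carrier_vecD eq_vecI index_zero_vec(1) index_zero_vec(2))
  have "B (unit_vec d j) x \<noteq> 0"
    using j carrier assms by (simp add: B_def scalar_prod_left_unit[OF Ax])
  then have nz: "B x (unit_vec d j) \<noteq> 0"
    using B_swap_eq_0[OF assms(1), of "unit_vec d j"] by auto
  show ?thesis
    by (rule bexI[of _ "inverse (B x (unit_vec d j)) \<cdot>\<^sub>v unit_vec d j"])
      (use nz assms in \<open>simp_all add: B_smult_right\<close>)
qed

text \<open>These are \<open>r\<close> mutually orthogonal hyperbolic planes; the pairings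
  \<open>B (q k) (p l)\<close> are not listed because \<open>B_swap\<close> determines them.\<close>

definition hyperbolic_system :: "nat \<Rightarrow> (nat \<Rightarrow> complex vec) \<Rightarrow> (nat \<Rightarrow> complex vec) \<Rightarrow> bool" where
  "hyperbolic_system r p q \<longleftrightarrow>
     (\<forall>k<r. p k \<in> carrier_vec d \<and> q k \<in> carrier_vec d) \<and>
     (\<forall>k<r. \<forall>l<r. B (p k) (p l) = 0 \<and> B (q k) (q l) = 0 \<and>
        B (p k) (q l) = (if k = l then 1 else 0))"

definition orth_to :: "nat \<Rightarrow> (nat \<Rightarrow> complex vec) \<Rightarrow> (nat \<Rightarrow> complex vec) \<Rightarrow> complex vec set" where
  "orth_to r p q = {x \<in> carrier_vec d. \<forall>k<r. B (p k) x = 0 \<and> B (q k) x = 0}"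

lemma orth_toD:
  assumes "x \<in> orth_to r p q"
  shows "x \<in> carrier_vec d" "k < r \<Longrightarrow> B (p k) x = 0" "k < r \<Longrightarrow> B (q k) x = 0"
  using assms by (auto simp: orth_to_def)

lemma hyperbolic_systemD:
  assumes "hyperbolic_system r p q" "k < r"
  shows "p k \<in> carrier_vec d" "q k \<in> carrier_vec d"
    "l < r \<Longrightarrow> B (p k) (p l) = 0" "l < r \<Longrightarrow> B (q k) (q l) = 0"
    "l < r \<Longrightarrow> B (p k) (q l) = (if k = l then 1 else 0)"
    "l < r \<Longrightarrow> B (q k) (p l) = (if k = l then s else 0)"
proof -
  show "p k \<in> carrier_vec d" "q k \<in> carrier_vec d"
    "l < r \<Longrightarrow> B (p k) (p l) = 0" "l < r \<Longrightarrow> B (q k) (q l) = 0"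
    "l < r \<Longrightarrow> B (p k) (q l) = (if k = l then 1 else 0)"
    using assms unfolding hyperbolic_system_def by blast+
  assume "l < r"
  then show "B (q k) (p l) = (if k = l then s else 0)"
    using assms B_swap[of "p l" "q k"] unfolding hyperbolic_system_def by auto
qed

lemma orth_to_comb:
  assumes H: "hyperbolic_system r p q" and "x \<in> orth_to r p q" "y \<in> orth_to r p q"
  shows "x + c \<cdot>\<^sub>v y \<in> orth_to r p q"
  using assms(2,3) hyperbolic_systemD(1,2)[OF H]
  by (simp add: orth_to_def B_add_right B_smult_right)

text \<open>Orthogonal projection to the complement of the hyperbolic planes, one plane at a time; a
  vector \<open>e\<close> orthogonal to the planes does not see the correction.\<close>

lemma hyperbolic_projection:
  assumes "hyperbolic_system r p q" "g \<in> carrier_vec d"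
  shows "\<exists>f \<in> orth_to r p q. \<forall>e \<in> orth_to r p q. B e f = B e g"
  using assms
proof (induction r)
  case 0
  then show ?case by (auto simp: orth_to_def)
next
  case (Suc r)
  note H = hyperbolic_systemD[OF Suc.prems(1)]
  have "hyperbolic_system r p q" using Suc.prems(1) by (simp add: hyperbolic_system_def)
  with Suc obtain f where f: "f \<in> orth_to r p q" "\<forall>e \<in> orth_to r p q. B e f = B e g" by blast
  \<comment> \<open>The coefficient of \<open>p r\<close> carries \<open>s\<close> because
    \<open>B (q r) (p r) = s\<close> and \<open>s * s = 1\<close>.\<close>
  let ?f = "f + (- B (p r) f) \<cdot>\<^sub>v q r + (- s * B (q r) f) \<cdot>\<^sub>v p r"
  note fc = orth_toD(1)[OF f(1)]
  have B: "B x ?f = B x f - B (p r) f * B x (q r) - s * B (q r) f * B x (p r)"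
    if "x \<in> carrier_vec d" for x
    using that fc H(1,2)[of r] by (simp add: B_add_right B_smult_right)
  have "?f \<in> orth_to (Suc r) p q"
    unfolding orth_to_def
  proof (intro CollectI conjI allI impI)
    fix k assume k: "k < Suc r"
    have "k = r \<or> k < r" using k by auto
    then show "B (p k) ?f = 0"
      using B[OF H(1)[OF k]] H(3,5)[OF k, of r] k orth_toD(2)[OF f(1)] by auto
    from \<open>k = r \<or> k < r\<close> show "B (q k) ?f = 0"
      using B[OF H(2)[OF k]] H(4,6)[OF k, of r] k orth_toD(3)[OF f(1)] by auto
  qed (use fc H(1,2)[of r] in auto)
  moreover have "B e ?f = B e g" if e: "e \<in> orth_to (Suc r) p q" for e
  proof -
    have "e \<in> orth_to r p q" using e by (simp add: orth_to_def)
    moreover have "B e (p r) = 0" "B e (q r) = 0"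
      using orth_toD[OF e] H(1,2)[of r] by (auto intro: B_swap_eq_0)
    ultimately show ?thesis using B[OF orth_toD(1)[OF e]] f(2) by simp
  qed
  ultimately show ?case by blast
qed

text \<open>Orthogonality to \<open>r\<close> pairs amounts to \<open>2 * r\<close> linear
  conditions, and \<open>u\<close> adds one more. The product with \<open>u\<close> is the plain dot
  product, so a coordinate can be prescribed to vanish.\<close>

lemma orth_to_nonzero:
  assumes H: "hyperbolic_system r p q" and r: "2 * r < d" and u: "u \<in> carrier_vec d"
  shows "\<exists>x \<in> orth_to r p q. x \<noteq> 0\<^sub>v d"
    and "2 * r + 1 < d \<Longrightarrow> \<exists>x \<in> orth_to r p q. x \<noteq> 0\<^sub>v d \<and> u \<bullet> x = 0"
proof -
  define a where "a k = (if k < r then A *\<^sub>v p k else if k < 2 * r then A *\<^sub>v q (k - r) else u)" for k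
  have a: "a k \<in> carrier_vec d" if "k < 2 * r + 1" for k
    using that u hyperbolic_systemD(1,2)[OF H] carrier by (auto simp: a_def)
  have orth: "x \<in> orth_to r p q" if x: "x \<in> carrier_vec d" "\<forall>k<2*r. a k \<bullet> x = 0" for x
    unfolding orth_to_def
  proof (intro CollectI conjI allI impI x)
    fix k assume k: "k < r"
    note c = hyperbolic_systemD(1,2)[OF H k]
    have "a k \<bullet> x = 0" "a (k + r) \<bullet> x = 0" using x(2) k by auto
    then have "(A *\<^sub>v p k) \<bullet> x = 0" "(A *\<^sub>v q k) \<bullet> x = 0" using k by (simp_all add: a_def)
    then have "B x (p k) = 0" "B x (q k) = 0"
      unfolding B_def using comm_scalar_prod[of x d "A *\<^sub>v p k"] comm_scalar_prod[of x d "A *\<^sub>v q k"]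
        carrier c x(1) by auto
    then show "B (p k) x = 0" "B (q k) x = 0" using B_swap_eq_0 c x(1) by blast+
  qed
  show "\<exists>x \<in> orth_to r p q. x \<noteq> 0\<^sub>v d"
    using exists_orthogonal_vec[OF r, of a] a orth by fastforce
  assume "2 * r + 1 < d"
  from exists_orthogonal_vec[OF this, of a] a obtain x where
    x: "x \<in> carrier_vec d" "x \<noteq> 0\<^sub>v d" "\<forall>k<2 * r + 1. a k \<bullet> x = 0" by blast
  have "u \<bullet> x = 0" using x(3)[rule_format, of "2 * r"] by (simp add: a_def)
  then show "\<exists>x \<in> orth_to r p q. x \<noteq> 0\<^sub>v d \<and> u \<bullet> x = 0" using x orth[of x] by auto
qed

text \<open>In the antisymmetric case every vector is isotropic. In the symmetric case the
  complement has room for two independent vectors, and the form restricted to the line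
  \<open>x + t y\<close> is a quadratic polynomial in \<open>t\<close> with a complex root.\<close>

lemma isotropic_exists:
  assumes H: "hyperbolic_system r p q" and r: "2 * r + 2 \<le> d"
  shows "\<exists>e \<in> orth_to r p q. e \<noteq> 0\<^sub>v d \<and> B e e = 0"
proof -
  obtain x where x: "x \<in> orth_to r p q" "x \<noteq> 0\<^sub>v d"
    using orth_to_nonzero(1)[OF H, of "0\<^sub>v d"] r by auto
  note xc = orth_toD(1)[OF x(1)]
  show ?thesis
  proof (cases "s = 1")
    case False
    then have "s = - 1" using s by simp
    then have "B x x = 0" using B_swap[OF xc xc] by simp
    then show ?thesis using x by blast
  next
    case True
    obtain j where j: "j < d" "x $ j \<noteq> 0"
      using x(2) xc by (metis carrier_vecD eq_vecI index_zero_vec(1) index_zero_vec(2))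
    \<comment> \<open>\<open>y\<close> vanishes in a coordinate where \<open>x\<close> does not, so
      no \<open>x + t y\<close> is the zero vector.\<close>
    obtain y where y: "y \<in> orth_to r p q" "y \<noteq> 0\<^sub>v d" "unit_vec d j \<bullet> y = 0"
      using orth_to_nonzero(2)[OF H, of "unit_vec d j"] r by auto
    note yc = orth_toD(1)[OF y(1)]
    have yj: "y $ j = 0" using y(3) scalar_prod_left_unit[OF yc j(1)] by simp
    show ?thesis
    proof (cases "B y y = 0")
      case True
      then show ?thesis using y by blast
    next
      case nz: False
      \<comment> \<open>A root of \<open>B y y * t\<^sup>2 + 2 * B x y * t + B x x\<close>, by
        completing the square.\<close>
      define t where "t = (- B x y + csqrt ((B x y)\<^sup>2 - B y y * B x x)) / B y y"
      let ?e = "x + t \<cdot>\<^sub>v y"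
      have "B y y * t + B x y = csqrt ((B x y)\<^sup>2 - B y y * B x x)"
        using nz by (simp add: t_def)
      then have "(B y y * t + B x y)\<^sup>2 = (B x y)\<^sup>2 - B y y * B x x" by simp
      then have "B y y * (B x x + 2 * t * B x y + t * t * B y y) = 0"
        by (simp add: power2_eq_square algebra_simps)
      then have "B x x + 2 * t * B x y + t * t * B y y = 0" using nz by simp
      moreover have "B ?e ?e = B x x + 2 * t * B x y + t * t * B y y"
        using xc yc B_swap[OF xc yc] True
        by (simp add: B_add_right B_add_left B_smult_right B_smult_left algebra_simps)
      moreover have "?e $ j = x $ j" using xc yc j yj by simp
      then have "?e \<noteq> 0\<^sub>v d" using j by auto
      moreover have "?e \<in> orth_to r p q" by (rule orth_to_comb[OF H x(1) y(1)])
      ultimately show ?thesis by auto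
    qed
  qed
qed

text \<open>An isotropic \<open>e\<close> in the complement gets a partner from nondegeneracy;
  projecting the partner back to the complement keeps its pairing with \<open>e\<close>.\<close>

lemma hyperbolic_system_extend:
  assumes H: "hyperbolic_system r p q" and r: "2 * r + 2 \<le> d"
  shows "\<exists>p q. hyperbolic_system (Suc r) p q"
proof -
  obtain e where e: "e \<in> orth_to r p q" "e \<noteq> 0\<^sub>v d" "B e e = 0"
    using isotropic_exists[OF assms] by blast
  note ec = orth_toD(1)[OF e(1)]
  obtain g where g: "g \<in> carrier_vec d" "B e g = 1" using nondegenerate[OF ec e(2)] by blast
  obtain f where f: "f \<in> orth_to r p q" "B e f = 1"
    using hyperbolic_projection[OF H g(1)] g(2) e(1) by auto
  note fc = orth_toD(1)[OF f(1)]
  \<comment> \<open>Subtracting half of \<open>B f f\<close> times \<open>e\<close> makes the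
    partner isotropic; for antisymmetric forms \<open>B f f\<close> is already 0.\<close>
  let ?f = "f + (- (B f f / 2)) \<cdot>\<^sub>v e"
  have f': "?f \<in> orth_to r p q" by (rule orth_to_comb[OF H f(1) e(1)])
  note f'c = orth_toD(1)[OF f']
  have "B e ?f = 1" using ec fc e f by (simp add: B_add_right B_smult_right)
  moreover have "B ?f ?f = 0"
  proof -
    have "B ?f ?f = B f f - B f f / 2 * (1 + s)"
      using ec fc e f B_swap[OF ec fc]
      by (simp add: B_add_right B_add_left B_smult_right B_smult_left field_simps)
    also have "\<dots> = 0" using B_swap[OF fc fc] s by auto
    finally show ?thesis .
  qed
  moreover have "B e (p k) = 0" "B e (q k) = 0" "B ?f (p k) = 0" "B ?f (q k) = 0" if "k < r" for k
    using that orth_toD[OF e(1)] orth_toD[OF f'] hyperbolic_systemD(1,2)[OF H] ec f'c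
    by (blast intro: B_swap_eq_0)+
  ultimately have "hyperbolic_system (Suc r) (p(r := e)) (q(r := ?f))"
    using hyperbolic_systemD[OF H] e ec f'c orth_toD(2,3)[OF f'] orth_toD(2,3)[OF e(1)]
    unfolding hyperbolic_system_def by (simp add: less_Suc_eq all_conj_distrib)
  then show ?thesis by blast
qed

lemma hyperbolic_system_exists:
  "2 * r \<le> d \<Longrightarrow> \<exists>p q. hyperbolic_system r p q"
proof (induction r)
  case 0
  then show ?case by (simp add: hyperbolic_system_def)
next
  case (Suc r)
  then show ?case using hyperbolic_system_extend[of r] by auto
qed

lemma gram_matrix_entry:
  assumes "P \<in> carrier_mat d d" "k < d" "l < d"
  shows "(transpose_mat P * A * P) $$ (k, l) = B (col P k) (col P l)"
proof -
  have "(transpose_mat P * A * P) $$ (k, l) = (transpose_mat P * (A * P)) $$ (k, l)"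
    using assms carrier by (subst assoc_mult_mat[of _ d d _ d _ d]) auto
  then show ?thesis using assms carrier by (simp add: B_def col_mult2[of _ d d _ d])
qed

text \<open>Order the basis as \<open>p 0, p 1, ...\<close>, a middle vector if \<open>d\<close> is
  odd, then \<open>..., q 1, q 0\<close>. Asserting only the pattern of zeros allows both signs and
  any nonzero norm of the middle vector.\<close>

lemma antidiagonal_basis:
  shows "\<exists>P Q. P \<in> carrier_mat d d \<and> Q \<in> carrier_mat d d \<and> P * Q = 1\<^sub>m d \<and> Q * P = 1\<^sub>m d \<and>
    (\<forall>k<d. \<forall>l<d. (transpose_mat P * A * P) $$ (k, l) = 0 \<longleftrightarrow> k + l + 1 \<noteq> d)"
proof -
  define r where "r = d div 2"
  have r2: "2 * r \<le> d" by (simp add: r_def)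
  obtain p q where H: "hyperbolic_system r p q"
    using hyperbolic_system_exists[of r] by (auto simp: r_def)
  note h = hyperbolic_systemD[OF H]
  \<comment> \<open>A vector orthogonal to all the planes, for odd \<open>d\<close>; for even
    \<open>d\<close> the implication is vacuous and \<open>c\<close> never uses \<open>m\<close>
    below \<open>d\<close>.\<close>
  obtain m where m: "odd d \<Longrightarrow> m \<in> orth_to r p q \<and> m \<noteq> 0\<^sub>v d"
    using orth_to_nonzero(1)[OF H, of "0\<^sub>v d"] r_def by (cases "odd d") (auto elim!: oddE)
  define c where "c k = (if k < r then p k else if d - 1 - k < r then q (d - 1 - k) else m)" for k
  have mid: "odd d \<and> k = r" if "k < d" "\<not> k < r" "\<not> d - 1 - k < r" for k
    using that unfolding r_def by presburger
  have cases: "k < r \<or> (d - 1 - k < r \<and> \<not> k < r) \<or> (odd d \<and> k = r \<and> \<not> d - 1 - k < r)" if "k < d" for k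
    using mid[OF that] by auto
  have c: "c k \<in> carrier_vec d" if "k < d" for k
    using cases[OF that] h(1,2) m by (auto simp: c_def orth_to_def)
  define P where "P = mat d d (\<lambda>(j, k). c k $ j)"
  have P: "P \<in> carrier_mat d d" by (simp add: P_def)
  have colP: "col P k = c k" if "k < d" for k
    using that c[OF that] by (auto simp: P_def)
  define J where "J = transpose_mat P * A * P"
  have J: "J \<in> carrier_mat d d" using P carrier by (simp add: J_def)
  have Je: "J $$ (k, l) = B (c k) (c l)" if "k < d" "l < d" for k l
    using gram_matrix_entry[OF P that] colP that by (simp add: J_def)
  have mB: "B (p k) m = 0" "B (q k) m = 0" "B m (p k) = 0" "B m (q k) = 0" if "k < r" "odd d" for k
    using m[OF that(2)] that h(1,2)[OF that(1)] by (auto simp: orth_to_def intro: B_swap_eq_0)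
  have Jz: "J $$ (k, l) = 0" if kl: "k < d" "l < d" "k + l + 1 \<noteq> d" for k l
  proof -
    have "k \<noteq> r \<or> l \<noteq> r" if "odd d" using that kl unfolding r_def by presburger
    moreover have "d - 1 - k \<noteq> l" "k \<noteq> d - 1 - l" using kl by auto
    ultimately show ?thesis
      using cases[OF kl(1)] cases[OF kl(2)] h(3-6) mB by (auto simp: Je[OF kl(1,2)] c_def)
  qed
  \<comment> \<open>If \<open>P\<close> kills \<open>x\<close>, so does the Gram matrix, whose known
    nonzero entries force all coordinates of \<open>x\<close> except the middle one to be 0. The
    norm of \<open>m\<close> is not yet known to be nonzero, so the middle coordinate is excluded by
    \<open>m\<close> itself being nonzero.\<close>
  have "det P \<noteq> 0"
  proof
    assume "det P = 0"
    then obtain x where x: "x \<in> carrier_vec d" "x \<noteq> 0\<^sub>v d" "P *\<^sub>v x = 0\<^sub>v d"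
      using det_0_iff_vec_prod_zero[OF P] by blast
    have Jx: "J *\<^sub>v x = 0\<^sub>v d"
      using x P carrier unfolding J_def
      by (simp add: assoc_mult_mat_vec[of _ d d _ d] mult_mat_zero_vec[of _ d d])
    have z: "x $ l = 0" if l: "l < d" "l < r \<or> d - 1 - l < r" for l
    proof -
      let ?k = "d - 1 - l"
      have k: "?k < d" using l by simp
      have "0 = (J *\<^sub>v x) $ ?k" using Jx k by simp
      also have "\<dots> = (\<Sum>j<d. J $$ (?k, j) * x $ j)"
        using J k x(1) by (auto simp: scalar_prod_def lessThan_atLeast0 intro!: sum.cong)
      also have "\<dots> = (\<Sum>j\<in>{l}. J $$ (?k, j) * x $ j)"
        using l k by (intro sum.mono_neutral_right) (auto simp: Jz)
      finally have "B (c ?k) (c l) * x $ l = 0" using Je[OF k l(1)] by simp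
      moreover have "B (c ?k) (c l) \<noteq> 0"
      proof (cases "l < r")
        case True
        then have "\<not> ?k < r" "d - 1 - ?k = l" using l r2 by auto
        then show ?thesis using True h(6)[of l l] s by (auto simp: c_def)
      next
        case False
        then show ?thesis using l h(5)[of ?k ?k] by (simp add: c_def)
      qed
      ultimately show ?thesis by simp
    qed
    obtain l where l: "l < d" "x $ l \<noteq> 0"
      using x(1,2) by (metis carrier_vecD eq_vecI index_zero_vec(1) index_zero_vec(2))
    then have ml: "odd d" "l = r" "\<not> d - 1 - l < r" using z[of l] cases[of l] by auto
    have xz: "x $ j = 0" if "j < d" "j \<noteq> l" for j
      using z[OF that(1)] mid[OF that(1)] ml(2) that(2) by blast
    have "m \<in> carrier_vec d" "m \<noteq> 0\<^sub>v d" using m[OF ml(1)] by (auto simp: orth_to_def)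
    then obtain i where i: "i < d" "m $ i \<noteq> 0"
      by (metis carrier_vecD eq_vecI index_zero_vec(1) index_zero_vec(2))
    have "0 = (P *\<^sub>v x) $ i" using x(3) i by simp
    also have "\<dots> = (\<Sum>j<d. P $$ (i, j) * x $ j)"
      using P i x(1) by (auto simp: scalar_prod_def lessThan_atLeast0 intro!: sum.cong)
    also have "\<dots> = (\<Sum>j\<in>{l}. P $$ (i, j) * x $ j)"
      using l by (intro sum.mono_neutral_right) (auto simp: xz)
    finally have "m $ i * x $ l = 0" using l(1) i(1) ml(2,3) by (simp add: P_def c_def)
    then show False using l(2) i(2) by simp
  qed
  from det_non_zero_imp_unit[OF P this] obtain Q where
    Q: "Q \<in> carrier_mat d d" "P * Q = 1\<^sub>m d" "Q * P = 1\<^sub>m d"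
    unfolding Units_def ring_mat_def by auto
  obtain A' where A': "A' \<in> carrier_mat d d" "A * A' = 1\<^sub>m d" "A' * A = 1\<^sub>m d"
    using invertible_matE[OF carrier invertible] .
  \<comment> \<open>The inverse of the Gram matrix, built from the inverses of \<open>P\<close> and
    \<open>A\<close>.\<close>
  define X where "X = Q * A' * transpose_mat Q"
  have X: "X \<in> carrier_mat d d" using Q A' by (simp add: X_def)
  have "J * X = transpose_mat P * (A * (P * Q) * A') * transpose_mat Q"
    using P Q(1) A'(1) carrier by (simp add: J_def X_def assoc_mult_mat[of _ d d _ d _ d])
  also have "\<dots> = transpose_mat P * transpose_mat Q"
    using P Q A' carrier by simp
  also have "\<dots> = transpose_mat (Q * P)"
    using P Q by (intro transpose_mult [symmetric]) auto
  finally have JX: "J * X = 1\<^sub>m d" using Q by simp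
  \<comment> \<open>A zero on the antidiagonal would make a whole row of the invertible matrix
    \<open>J\<close> vanish; this also settles the norm of the middle vector.\<close>
  have Jnz: "J $$ (k, l) \<noteq> 0" if kl: "k < d" "l < d" "k + l + 1 = d" for k l
  proof
    assume zero: "J $$ (k, l) = 0"
    have "J $$ (k, j) = 0" if "j < d" for j
      using Jz[of k j] zero that kl by (cases "j = l") auto
    then have "(J * X) $$ (k, k) = 0"
      using mat_mult_entry[OF J X kl(1,1)] by simp
    then show False using JX kl by simp
  qed
  have "\<forall>k<d. \<forall>l<d. J $$ (k, l) = 0 \<longleftrightarrow> k + l + 1 \<noteq> d" using Jz Jnz by blast
  then show ?thesis using P Q unfolding J_def by blast
qed

end

section \<open>The split torus at a vertex\<close>

text \<open>The factors at \<open>k\<close> and \<open>d - 1 - k\<close> cancel, and only an odd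
  \<open>d\<close> has a position fixed by the reflection.\<close>

lemma prod_reflected_pairs:
  fixes f :: "nat \<Rightarrow> complex"
  assumes f: "\<And>k. k < d div 2 \<Longrightarrow> f k * f (d - 1 - k) = 1"
  shows "(\<Prod>k<d. f k) = (if even d then 1 else f (d div 2))"
proof -
  define r where "r = d div 2"
  define q where "q = d - r"
  have q: "d = q + r" "r \<le> q" by (auto simp: q_def r_def)
  have pairs: "(\<Prod>k<r. f k) * (\<Prod>k\<in>{q..<d}. f k) = 1"
  proof -
    have "(\<Prod>k\<in>{q..<d}. f k) = (\<Prod>k<r. f (d - 1 - k))"
      by (rule prod.reindex_bij_witness[of _ "\<lambda>k. d - 1 - k" "\<lambda>k. d - 1 - k"]) (use q in auto)
    then have "(\<Prod>k<r. f k) * (\<Prod>k\<in>{q..<d}. f k) = (\<Prod>k<r. f k * f (d - 1 - k))"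
      by (simp add: prod.distrib)
    also have "\<dots> = 1" using f by (intro prod.neutral) (auto simp: r_def)
    finally show ?thesis .
  qed
  have mid: "(\<Prod>k\<in>{r..<q}. f k) = (if even d then 1 else f (d div 2))"
  proof (cases "even d")
    case True
    then have "q = r" by (auto simp: q_def r_def)
    then show ?thesis using True by simp
  next
    case False
    then have "q = Suc r" by (auto simp: q_def r_def elim!: oddE)
    then show ?thesis using False by (simp add: r_def)
  qed
  have "(\<Prod>k<d. f k) = (\<Prod>k\<in>({..<r} \<union> {q..<d}) \<union> {r..<q}. f k)"
    using q by (intro prod.cong) auto
  also have "\<dots> = (\<Prod>k\<in>{..<r} \<union> {q..<d}. f k) * (\<Prod>k\<in>{r..<q}. f k)"
    using q by (intro prod.union_disjoint) auto
  also have "(\<Prod>k\<in>{..<r} \<union> {q..<d}. f k) = (\<Prod>k<r. f k) * (\<Prod>k\<in>{q..<d}. f k)"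
    using q by (intro prod.union_disjoint) auto
  finally show ?thesis using pairs mid by simp
qed

lemma det_mat_diag: "det (mat_diag d f) = (\<Prod>k<d. f k :: complex)"
proof -
  have "det (mat_diag d f) = prod_list (diag_mat (mat_diag d f))"
    by (rule det_upper_triangular[of _ d]) (auto simp: mat_diag_def upper_triangular_def)
  also have "\<dots> = (\<Prod>k<d. f k)"
    by (auto simp: prod_list_diag_prod mat_diag_def lessThan_atLeast0 intro!: prod.cong)
  finally show ?thesis .
qed

text \<open>The diagonal \<open>u 0, u 1, ..., (1), ..., inverse (u 1), inverse (u 0)\<close>; the
  value 1 in the middle of an odd dimension gives determinant 1.\<close>

definition torus_weight :: "nat \<Rightarrow> (nat \<Rightarrow> complex) \<Rightarrow> nat \<Rightarrow> complex" where
  "torus_weight d u k =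
     (if k < d div 2 then u k else if d - 1 - k < d div 2 then inverse (u (d - 1 - k)) else 1)"

lemma torus_weight_mult:
  "torus_weight d (\<lambda>k. u k * u' k) k = torus_weight d u k * torus_weight d u' k"
  by (simp add: torus_weight_def)

lemma torus_weight_reflect:
  assumes "\<And>k. k < d div 2 \<Longrightarrow> u k \<noteq> 0" "k < d"
  shows "torus_weight d u k * torus_weight d u (d - 1 - k) = 1"
proof -
  consider "k < d div 2" "\<not> d - 1 - k < d div 2" "d - 1 - (d - 1 - k) = k"
    | "d - 1 - k < d div 2" "\<not> k < d div 2"
    | "\<not> k < d div 2" "\<not> d - 1 - k < d div 2" "d - 1 - (d - 1 - k) = k"
    using assms(2) by linarith
  then show ?thesis by cases (use assms(1) in \<open>auto simp: torus_weight_def\<close>)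
qed

lemma torus_weight_cong:
  "(\<And>k. k < d div 2 \<Longrightarrow> u k = u' k) \<Longrightarrow> torus_weight d u k = torus_weight d u' k"
  by (simp add: torus_weight_def)

definition mat_unit :: "nat \<Rightarrow> nat \<Rightarrow> nat \<Rightarrow> complex mat" where
  "mat_unit d a b = mat d d (\<lambda>(k, l). if k = a \<and> l = b then 1 else 0)"

lemma mat_unit_carrier [simp]: "mat_unit d a b \<in> carrier_mat d d"
  by (simp add: mat_unit_def)

lemma mult_mat_unit:
  assumes "M \<in> carrier_mat d d" "a < d"
  shows "M * mat_unit d a b = mat d d (\<lambda>(k, l). if l = b then M $$ (k, a) else 0)"
proof (rule eq_matI)
  fix k l assume "k < dim_row (mat d d (\<lambda>(k, l). if l = b then M $$ (k, a) else 0))"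
    "l < dim_col (mat d d (\<lambda>(k, l). if l = b then M $$ (k, a) else 0))"
  then have kl: "k < d" "l < d" by auto
  have "(M * mat_unit d a b) $$ (k, l) = (\<Sum>m<d. if m = a then (if l = b then M $$ (k, a) else 0) else 0)"
    unfolding mat_mult_entry[OF assms(1) mat_unit_carrier kl]
    by (intro sum.cong) (use kl in \<open>auto simp: mat_unit_def\<close>)
  then show "(M * mat_unit d a b) $$ (k, l) = mat d d (\<lambda>(k, l). if l = b then M $$ (k, a) else 0) $$ (k, l)"
    using kl assms(2) by simp
qed (use assms in \<open>auto simp: mat_unit_def\<close>)

lemma mat_unit_mult:
  assumes "M \<in> carrier_mat d d" "b < d"
  shows "mat_unit d a b * M = mat d d (\<lambda>(k, l). if k = a then M $$ (b, l) else 0)"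
proof (rule eq_matI)
  fix k l assume "k < dim_row (mat d d (\<lambda>(k, l). if k = a then M $$ (b, l) else 0))"
    "l < dim_col (mat d d (\<lambda>(k, l). if k = a then M $$ (b, l) else 0))"
  then have kl: "k < d" "l < d" by auto
  have "(mat_unit d a b * M) $$ (k, l) = (\<Sum>m<d. if m = b then (if k = a then M $$ (b, l) else 0) else 0)"
    unfolding mat_mult_entry[OF mat_unit_carrier assms(1) kl]
    by (intro sum.cong) (use kl in \<open>auto simp: mat_unit_def\<close>)
  then show "(mat_unit d a b * M) $$ (k, l) = mat d d (\<lambda>(k, l). if k = a then M $$ (b, l) else 0) $$ (k, l)"
    using kl assms(2) by simp
qed (use assms in \<open>auto simp: mat_unit_def\<close>)

text \<open>The columns of \<open>P\<close> form a basis with antidiagonal Gram matrix, and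
  \<open>Q\<close> inverts \<open>P\<close>. Recording only which entries vanish treats both kinds
  of forms alike.\<close>

locale antidiagonal_frame =
  fixes d :: nat and A P Q :: "complex mat"
  assumes A: "A \<in> carrier_mat d d" and P: "P \<in> carrier_mat d d" and Q: "Q \<in> carrier_mat d d"
    and PQ: "P * Q = 1\<^sub>m d" and QP: "Q * P = 1\<^sub>m d"
    and antidiagonal: "\<And>k l. k < d \<Longrightarrow> l < d \<Longrightarrow> (transpose_mat P * A * P) $$ (k, l) = 0 \<longleftrightarrow> k + l + 1 \<noteq> d"
begin

definition J :: "complex mat" where "J = transpose_mat P * A * P"

definition conj :: "complex mat \<Rightarrow> complex mat" where "conj X = P * X * Q"

lemma J: "J \<in> carrier_mat d d"
  using A P by (simp add: J_def)

lemma J_eq_0_iff: "k < d \<Longrightarrow> l < d \<Longrightarrow> J $$ (k, l) = 0 \<longleftrightarrow> k + l + 1 \<noteq> d"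
  using antidiagonal by (simp add: J_def)

lemma conj_carrier [simp]: "X \<in> carrier_mat d d \<Longrightarrow> conj X \<in> carrier_mat d d"
  using P Q by (simp add: conj_def)

lemma conj_one [simp]: "conj (1\<^sub>m d) = 1\<^sub>m d"
  using P PQ by (simp add: conj_def)

lemma conj_mult:
  assumes "X \<in> carrier_mat d d" "Y \<in> carrier_mat d d"
  shows "conj X * conj Y = conj (X * Y)"
proof -
  have "conj X * conj Y = P * X * (Q * P) * Y * Q"
    using assms P Q by (simp add: conj_def assoc_mult_mat[of _ d d _ d _ d])
  then show ?thesis
    using assms P Q by (simp add: QP conj_def assoc_mult_mat[of _ d d _ d _ d])
qed

lemma conj_add:
  assumes "X \<in> carrier_mat d d" "Y \<in> carrier_mat d d"
  shows "conj (X + Y) = conj X + conj Y"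
  using assms P Q by (simp add: conj_def mult_add_distrib_mat[of _ d d] add_mult_distrib_mat[of _ d d])

lemma conj_minus:
  assumes "X \<in> carrier_mat d d" "Y \<in> carrier_mat d d"
  shows "conj (X - Y) = conj X - conj Y"
  using assms P Q by (simp add: conj_def mult_minus_distrib_mat[of _ d d] minus_mult_distrib_mat[of _ d d])

lemma conj_smult:
  assumes "X \<in> carrier_mat d d"
  shows "conj (c \<cdot>\<^sub>m X) = c \<cdot>\<^sub>m conj X"
  using assms P Q by (simp add: conj_def mult_smult_distrib[of _ d d] mult_smult_assoc_mat[of _ d d])

lemma conj_inverse:
  assumes "X \<in> carrier_mat d d"
  shows "Q * conj X * P = X"
proof -
  have "Q * conj X * P = (Q * P) * X * (Q * P)"
    using assms P Q by (simp add: conj_def assoc_mult_mat[of _ d d _ d _ d])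
  then show ?thesis using assms by (simp add: QP)
qed

lemma conj_surj:
  assumes "g \<in> carrier_mat d d"
  shows "conj (Q * g * P) = g" "Q * g * P \<in> carrier_mat d d"
proof -
  have "conj (Q * g * P) = (P * Q) * g * (P * Q)"
    using assms P Q by (simp add: conj_def assoc_mult_mat[of _ d d _ d _ d])
  then show "conj (Q * g * P) = g" using assms by (simp add: PQ)
qed (use assms P Q in simp)

lemma conj_eq_iff:
  assumes "X \<in> carrier_mat d d" "Y \<in> carrier_mat d d"
  shows "conj X = conj Y \<longleftrightarrow> X = Y"
  using conj_inverse assms by metis

lemma mat_trace_conj_eq: "X \<in> carrier_mat d d \<Longrightarrow> mat_trace (conj X) = mat_trace X"
  unfolding conj_def by (rule mat_trace_conj[OF P Q _ QP])

lemma conj_entry: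
  assumes "X \<in> carrier_mat d d" "k < d" "l < d"
  shows "conj X $$ (k, l) = (\<Sum>m<d. \<Sum>n<d. P $$ (k, m) * Q $$ (n, l) * X $$ (m, n))"
proof -
  have "conj X $$ (k, l) = (\<Sum>n<d. (P * X) $$ (k, n) * Q $$ (n, l))"
    unfolding conj_def using assms P Q by (intro mat_mult_entry) auto
  also have "\<dots> = (\<Sum>n<d. (\<Sum>m<d. P $$ (k, m) * X $$ (m, n)) * Q $$ (n, l))"
    by (intro sum.cong refl arg_cong2[where f = "(*)"] mat_mult_entry[OF P assms(1,2)]) simp
  also have "\<dots> = (\<Sum>n<d. \<Sum>m<d. P $$ (k, m) * Q $$ (n, l) * X $$ (m, n))"
    by (simp add: sum_distrib_left sum_distrib_right mult_ac)
  finally show ?thesis by (subst sum.swap)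
qed

lemma conj_in_isometries_iff:
  assumes X: "X \<in> carrier_mat d d"
  shows "conj X \<in> isometries d A \<longleftrightarrow> transpose_mat X * J * X = J"
proof -
  have tP: "transpose_mat P \<in> carrier_mat d d" and tQ: "transpose_mat Q \<in> carrier_mat d d"
    and tX: "transpose_mat X \<in> carrier_mat d d" using P Q X by auto
  have tPQ: "transpose_mat P * transpose_mat Q = 1\<^sub>m d" and tQP: "transpose_mat Q * transpose_mat P = 1\<^sub>m d"
    by (simp_all add: PQ QP flip: transpose_mult[OF Q P] transpose_mult[OF P Q])
  have tc: "transpose_mat (conj X) = transpose_mat Q * (transpose_mat X * transpose_mat P)"
    using P Q X by (simp add: conj_def transpose_mult[of _ d d _ d])
  have A_J: "A = transpose_mat Q * J * Q"
  proof -
    have "transpose_mat Q * J * Q = (transpose_mat Q * transpose_mat P) * A * (P * Q)"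
      using A P Q tP tQ by (simp add: J_def assoc_mult_mat[of _ d d _ d _ d])
    then show ?thesis using A by (simp add: tQP PQ)
  qed
  have *: "transpose_mat (conj X) * A * conj X = transpose_mat Q * (transpose_mat X * J * X) * Q"
    using A P Q X tP tQ tX unfolding tc unfolding conj_def J_def
    by (simp add: assoc_mult_mat[of _ d d _ d _ d])
  have inj: "Y = Z" if "transpose_mat Q * Y * Q = transpose_mat Q * Z * Q"
    "Y \<in> carrier_mat d d" "Z \<in> carrier_mat d d" for Y Z
  proof -
    have "transpose_mat P * (transpose_mat Q * Y * Q) * P = (transpose_mat P * transpose_mat Q) * Y * (Q * P)"
      if "Y \<in> carrier_mat d d" for Y
      using that P Q tP tQ by (simp add: assoc_mult_mat[of _ d d _ d _ d])
    then have "transpose_mat P * (transpose_mat Q * Y * Q) * P = Y" if "Y \<in> carrier_mat d d" for Y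
      using that by (simp add: tPQ QP)
    then show ?thesis using that by metis
  qed
  show ?thesis
    unfolding isometries_def using * A_J inj[of "transpose_mat X * J * X" J] X tX J by auto
qed

text \<open>Multiplying \<open>J\<close> by the diagonal matrix on both sides scales the entry
  \<open>(k, l)\<close> by \<open>f k * f l\<close>, so only the antidiagonal,
  \<open>l = d - 1 - k\<close>, imposes a condition.\<close>

lemma mat_diag_isometry_iff:
  "conj (mat_diag d f) \<in> isometries d A \<longleftrightarrow> (\<forall>k<d. f k * f (d - 1 - k) = 1)"
proof -
  have D: "mat_diag d f \<in> carrier_mat d d" by simp
  have tD: "transpose_mat (mat_diag d f) = mat_diag d f" by (auto simp: mat_diag_def)
  have e: "(mat_diag d f * J * mat_diag d f) $$ (k, l) = f k * f l * J $$ (k, l)" if "k < d" "l < d" for k l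
    using that J by (simp add: mat_diag_mult_left[OF J] mat_diag_mult_right[of _ d])
  have "mat_diag d f * J * mat_diag d f = J \<longleftrightarrow> (\<forall>k<d. \<forall>l<d. f k * f l * J $$ (k, l) = J $$ (k, l))"
  proof
    assume eq: "mat_diag d f * J * mat_diag d f = J"
    show "\<forall>k<d. \<forall>l<d. f k * f l * J $$ (k, l) = J $$ (k, l)"
      using e unfolding eq by simp
  next
    assume "\<forall>k<d. \<forall>l<d. f k * f l * J $$ (k, l) = J $$ (k, l)"
    then show "mat_diag d f * J * mat_diag d f = J"
      by (intro eq_matI) (use e J in \<open>auto simp: carrier_matD[OF mat_diag_dim]\<close>)
  qed
  also have "\<dots> \<longleftrightarrow> (\<forall>k<d. \<forall>l<d. k + l + 1 = d \<longrightarrow> f k * f l = 1)"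
    using J_eq_0_iff by auto
  also have "\<dots> \<longleftrightarrow> (\<forall>k<d. f k * f (d - 1 - k) = 1)"
  proof -
    have "k + l + 1 = d \<longleftrightarrow> l = d - 1 - k" if "k < d" for k l using that by auto
    then show ?thesis by auto
  qed
  finally show ?thesis using conj_in_isometries_iff[OF D] by (simp add: tD)
qed

definition torus_elt :: "(nat \<Rightarrow> complex) \<Rightarrow> complex mat" where
  "torus_elt u = conj (mat_diag d (torus_weight d u))"

lemma torus_elt_carrier [simp]: "torus_elt u \<in> carrier_mat d d"
  by (simp add: torus_elt_def)

lemma det_conj: "X \<in> carrier_mat d d \<Longrightarrow> det (conj X) = det X"
  using P Q det_mult[OF P Q] by (simp add: conj_def det_mult[of _ d] PQ mult.commute)

lemma torus_elt_isometry:
  assumes "\<And>k. k < d div 2 \<Longrightarrow> u k \<noteq> 0"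
  shows "torus_elt u \<in> isometries d A" "det (torus_elt u) = 1"
proof -
  show "torus_elt u \<in> isometries d A"
    unfolding torus_elt_def mat_diag_isometry_iff using torus_weight_reflect[of d u] assms by blast
  have "det (torus_elt u) = (\<Prod>k<d. torus_weight d u k)"
    by (simp add: torus_elt_def det_conj det_mat_diag)
  also have "\<dots> = (if even d then 1 else torus_weight d u (d div 2))"
    using assms by (intro prod_reflected_pairs torus_weight_reflect) auto
  also have "\<dots> = 1" by (auto simp: torus_weight_def elim!: oddE)
  finally show "det (torus_elt u) = 1" .
qed

lemma torus_elt_mult: "torus_elt u * torus_elt u' = torus_elt (\<lambda>k. u k * u' k)"
  by (simp add: torus_elt_def conj_mult flip: torus_weight_mult)

lemma torus_elt_eq_iff: "torus_elt u = torus_elt u' \<longleftrightarrow> (\<forall>k<d div 2. u k = u' k)"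
proof
  assume "torus_elt u = torus_elt u'"
  then have eq: "mat_diag d (torus_weight d u) = mat_diag d (torus_weight d u')"
    by (simp add: torus_elt_def conj_eq_iff)
  show "\<forall>k<d div 2. u k = u' k"
  proof (intro allI impI)
    fix k assume k: "k < d div 2"
    then have "mat_diag d (torus_weight d u) $$ (k, k) = torus_weight d u k"
      "mat_diag d (torus_weight d u') $$ (k, k) = torus_weight d u' k" by (auto simp: mat_diag_def)
    then show "u k = u' k" using eq k by (simp add: torus_weight_def)
  qed
next
  assume "\<forall>k<d div 2. u k = u' k"
  then have "torus_weight d u = torus_weight d u'" by (intro ext torus_weight_cong) auto
  then show "torus_elt u = torus_elt u'" by (simp add: torus_elt_def)
qed

text \<open>The parameters \<open>k + 2\<close> give an element of the torus with distinct eigenvalues.\<close>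

lemma torus_weight_generic_inj:
  assumes "torus_weight d (\<lambda>k. of_nat (k + 2)) k = torus_weight d (\<lambda>k. of_nat (k + 2)) l" "k < d" "l < d"
  shows "k = l"
proof -
  \<comment> \<open>The weights are real, so their order separates them: above 1 in the first half,
    below 1 in the second, equal to 1 in the middle.\<close>
  define w :: "nat \<Rightarrow> real" where "w k =
    (if k < d div 2 then real (k + 2) else if d - 1 - k < d div 2 then inverse (real (d - 1 - k + 2)) else 1)" for k
  have "torus_weight d (\<lambda>k. of_nat (k + 2)) k = complex_of_real (w k)" for k
    by (simp add: torus_weight_def w_def)
  then have w: "w k = w l" using assms(1) by simp
  have small: "inverse (real (n + 2)) < 1" for n by (simp add: field_simps)
  have big: "1 < real (n + 2)" for n by simp
  have mid: "k = d div 2" if "k < d" "\<not> k < d div 2" "\<not> d - 1 - k < d div 2" for k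
    using that by linarith
  show ?thesis
    using w small[of "d - 1 - k"] small[of "d - 1 - l"] big[of k] big[of l]
      mid[OF assms(2)] mid[OF assms(3)] assms(2,3)
    by (auto simp: w_def split: if_splits)
qed

text \<open>Commuting with distinct eigenvalues forces a diagonal matrix, and the form pairs its
  entries. The middle entry of an odd dimension, which the form leaves as 1 or -1, is fixed by the
  determinant.\<close>

lemma torus_elt_self_centralizing:
  assumes g: "g \<in> isometries d A" and det: "odd d \<Longrightarrow> det g = 1"
    and comm: "g * torus_elt (\<lambda>k. of_nat (k + 2)) = torus_elt (\<lambda>k. of_nat (k + 2)) * g"
  shows "\<exists>u. (\<forall>k. u k \<noteq> 0) \<and> g = torus_elt u"
proof -
  define X where "X = Q * g * P"
  define t where "t = torus_weight d (\<lambda>k. of_nat (k + 2))"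
  have "g \<in> carrier_mat d d" using g by (simp add: isometries_def)
  note gX = conj_surj[OF this, folded X_def]
  have "conj (X * mat_diag d t) = conj (mat_diag d t * X)"
    using comm gX by (simp add: torus_elt_def t_def flip: conj_mult)
  then have XD: "X * mat_diag d t = mat_diag d t * X"
    by (simp add: conj_eq_iff[OF mult_carrier_mat[OF gX(2) mat_diag_dim] mult_carrier_mat[OF mat_diag_dim gX(2)]])
  have offdiag: "X $$ (k, l) = 0" if "k < d" "l < d" "k \<noteq> l" for k l
  proof -
    have "X $$ (k, l) * t l = t k * X $$ (k, l)"
      using arg_cong[OF XD, of "\<lambda>M. M $$ (k, l)"] that gX(2)
      by (simp add: mat_diag_mult_left[OF gX(2)] mat_diag_mult_right[OF gX(2)])
    moreover have "t k \<noteq> t l" using torus_weight_generic_inj that unfolding t_def by blast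
    ultimately show ?thesis by auto
  qed
  define f where "f k = X $$ (k, k)" for k
  have X: "X = mat_diag d f"
    by (rule eq_matI) (use gX(2) offdiag in \<open>auto simp: mat_diag_def f_def\<close>)
  have "conj (mat_diag d f) \<in> isometries d A" using g gX(1) by (simp add: X)
  then have f: "\<forall>k<d. f k * f (d - 1 - k) = 1" unfolding mat_diag_isometry_iff .
  have mid: "f (d div 2) = 1" if "odd d"
  proof -
    have "1 = det X" using det[OF that] det_conj[OF gX(2)] gX(1) by simp
    also have "\<dots> = (if even d then 1 else f (d div 2))"
      unfolding X det_mat_diag by (rule prod_reflected_pairs) (use f in auto)
    finally show ?thesis using that by simp
  qed
  \<comment> \<open>The value 1 beyond the first half keeps all parameters nonzero, as the
    conclusion demands.\<close>
  define u where "u k = (if k < d div 2 then f k else 1)" for k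
  have "f k \<noteq> 0" if "k < d" for k using f that by (metis mult_zero_left zero_neq_one)
  then have "u k \<noteq> 0" for k by (simp add: u_def)
  moreover have "torus_weight d u k = f k" if "k < d" for k
  proof -
    have "k < d div 2 \<or> (\<not> k < d div 2 \<and> d - 1 - k < d div 2) \<or>
        (odd d \<and> k = d div 2 \<and> \<not> d - 1 - k < d div 2)"
      using that by presburger
    then consider "k < d div 2" | "\<not> k < d div 2" "d - 1 - k < d div 2"
      | "odd d" "k = d div 2" "\<not> d - 1 - k < d div 2"
      by blast
    then show ?thesis
    proof cases
      case 2
      then have "inverse (f (d - 1 - k)) = f k"
        using f[rule_format, OF that] by (intro inverse_unique) (simp add: mult.commute)
      then show ?thesis using 2 by (simp add: torus_weight_def u_def)
    qed (auto simp: torus_weight_def u_def mid)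
  qed
  then have "mat_diag d (torus_weight d u) = X" unfolding X by (auto simp: mat_diag_def)
  then have "torus_elt u = g" using gX(1) by (simp add: torus_elt_def)
  ultimately show ?thesis by blast
qed

section \<open>Root vectors\<close>

definition root_vec :: "nat \<Rightarrow> nat \<Rightarrow> complex mat" where
  "root_vec a b = conj (mat_unit d a b)"

lemma root_vec_carrier [simp]: "root_vec a b \<in> carrier_mat d d"
  by (simp add: root_vec_def)

lemma root_vec_nonzero:
  assumes "a < d" "b < d"
  shows "root_vec a b \<noteq> 0\<^sub>m d d"
proof
  assume "root_vec a b = 0\<^sub>m d d"
  also have "0\<^sub>m d d = conj (0\<^sub>m d d)" using P Q by (simp add: conj_def)
  finally have eq: "mat_unit d a b = 0\<^sub>m d d" by (simp add: root_vec_def conj_eq_iff)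
  have "mat_unit d a b $$ (a, b) = 1" using assms by (simp add: mat_unit_def)
  then show False using assms by (simp add: eq)
qed

text \<open>The one-parameter group of the long root with root vector \<open>E\<^sub>a\<^sub>b\<close>, where \<open>a\<close> and \<open>b\<close> are
  paired by the antidiagonal form; it exists only for antisymmetric forms.\<close>

lemma root_group_isometry:
  assumes ab: "a + b + 1 = d" "a \<noteq> b" and anti: "transpose_mat A = - A"
  shows "1\<^sub>m d + c \<cdot>\<^sub>m root_vec a b \<in> isometries d A"
proof -
  have abd: "a < d" "b < d" using ab by auto
  let ?E = "mat_unit d a b" and ?E' = "mat_unit d b a"
  have "transpose_mat J = transpose_mat P * transpose_mat A * P"
    using A P by (simp add: J_def transpose_mult[of _ d d _ d] assoc_mult_mat[of _ d d _ d _ d])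
  also have "\<dots> = - J" unfolding anti J_def using A P by simp
  finally have "transpose_mat J $$ (b, a) = (- J) $$ (b, a)" by simp
  \<comment> \<open>The terms linear in \<open>c\<close> sit at \<open>(b, b)\<close> with
    coefficients \<open>J $$ (a, b)\<close> and \<open>J $$ (b, a)\<close>, which cancel; the
    quadratic term carries \<open>J $$ (a, a)\<close>, which is off the antidiagonal.\<close>
  then have Jab: "J $$ (a, b) = - J $$ (b, a)" using abd J by simp
  have Jaa: "J $$ (a, a) = 0" using J_eq_0_iff[of a a] ab by auto
  have JE: "J * ?E = mat d d (\<lambda>(k, l). if l = b then J $$ (k, a) else 0)"
    by (rule mult_mat_unit[OF J abd(1)])
  have EJ: "?E' * J = mat d d (\<lambda>(k, l). if k = b then J $$ (a, l) else 0)"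
    by (rule mat_unit_mult[OF J abd(1)])
  have EJE: "?E' * (J * ?E) = mat d d (\<lambda>(k, l). if k = b then (J * ?E) $$ (a, l) else 0)"
    using J by (intro mat_unit_mult) (auto simp: abd)
  let ?X = "1\<^sub>m d + c \<cdot>\<^sub>m ?E"
  have X: "?X \<in> carrier_mat d d" by simp
  have tX: "transpose_mat ?X = 1\<^sub>m d + c \<cdot>\<^sub>m ?E'"
    by (auto simp: mat_unit_def)
  have JX: "J * ?X = J + c \<cdot>\<^sub>m (J * ?E)"
    using J by (simp add: mult_add_distrib_mat[of _ d d _ d] mult_smult_distrib[of _ d d _ d])
  have "transpose_mat ?X * J * ?X = transpose_mat ?X * (J * ?X)"
    using J X by (intro assoc_mult_mat[of _ d d _ d _ d]) auto
  also have "\<dots> = (J + c \<cdot>\<^sub>m (?E' * J)) + c \<cdot>\<^sub>m (J * ?E + c \<cdot>\<^sub>m (?E' * (J * ?E)))"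
    unfolding tX JX using J
    by (simp add: add_mult_distrib_mat[of _ d d _ _ d] mult_add_distrib_mat[of _ d d _ d]
        mult_smult_distrib[of _ d d _ d] mult_smult_assoc_mat[of _ d d _ d])
  also have "\<dots> = J"
  proof (rule eq_matI)
    fix k l assume "k < dim_row J" "l < dim_col J"
    then have kl: "k < d" "l < d" using J by auto
    have z: "J $$ (k, a) = 0" if "k \<noteq> b" using J_eq_0_iff[OF kl(1) abd(1)] ab that by auto
    have z': "J $$ (a, l) = 0" if "l \<noteq> b" using J_eq_0_iff[OF abd(1) kl(2)] ab that by auto
    show "((J + c \<cdot>\<^sub>m (?E' * J)) + c \<cdot>\<^sub>m (J * ?E + c \<cdot>\<^sub>m (?E' * (J * ?E)))) $$ (k, l) = J $$ (k, l)"
      unfolding EJE unfolding JE EJ using kl J abd z z' Jab Jaa by (auto simp: algebra_simps)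
  qed (use J in \<open>auto simp: mat_unit_def\<close>)
  finally have "conj ?X \<in> isometries d A" unfolding conj_in_isometries_iff[OF X] .
  then show ?thesis by (simp add: conj_add conj_smult root_vec_def)
qed

lemma torus_elt_root_vec:
  assumes "a < d" "b < d"
  shows "torus_elt u * root_vec a b = torus_weight d u a \<cdot>\<^sub>m root_vec a b"
    "root_vec a b * torus_elt u = torus_weight d u b \<cdot>\<^sub>m root_vec a b"
proof -
  have "mat_diag d (torus_weight d u) * mat_unit d a b = torus_weight d u a \<cdot>\<^sub>m mat_unit d a b"
    by (subst mat_diag_mult_left[of _ d d]) (auto simp: mat_unit_def)
  then show "torus_elt u * root_vec a b = torus_weight d u a \<cdot>\<^sub>m root_vec a b"
    by (simp add: torus_elt_def root_vec_def conj_mult conj_smult)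
  have "mat_unit d a b * mat_diag d (torus_weight d u) = torus_weight d u b \<cdot>\<^sub>m mat_unit d a b"
    by (subst mat_diag_mult_right[of _ d d]) (auto simp: mat_unit_def)
  then show "root_vec a b * torus_elt u = torus_weight d u b \<cdot>\<^sub>m root_vec a b"
    by (simp add: torus_elt_def root_vec_def conj_mult conj_smult)
qed

lemma root_vec_mult:
  assumes "a < d" "b < d"
  shows "root_vec a b * root_vec b a = root_vec a a"
proof -
  have "mat_unit d a b * mat_unit d b a = mat_unit d a a"
    unfolding mat_unit_mult[OF mat_unit_carrier assms(2)] using assms by (auto simp: mat_unit_def)
  then show ?thesis by (simp add: root_vec_def conj_mult)
qed

end

section \<open>A maximal torus of the gauge group and a long coroot\<close>

lemma laurent_fun_monomial: "laurent_fun r (\<lambda>z. c * (\<Prod>k<r. z k powi m k))"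
  unfolding laurent_fun_def by (intro exI[of _ "{m}"] exI[of _ "\<lambda>_. c"]) simp

lemma laurent_fun_const: "laurent_fun r (\<lambda>z. c)"
  using laurent_fun_monomial[of r c "\<lambda>_. 0"] by simp

lemma prod_powi_indicator:
  fixes z :: "nat \<Rightarrow> complex"
  assumes "j < r"
  shows "(\<Prod>k<r. z k powi (if k = j then a else 0)) = z j powi a"
proof -
  have "(\<Prod>k<r. z k powi (if k = j then a else 0)) = (\<Prod>k<r. if k = j then z j powi a else 1)"
    by (intro prod.cong) auto
  then show ?thesis using assms by (simp add: prod.delta)
qed

lemma laurent_fun_coord: "j < r \<Longrightarrow> laurent_fun r (\<lambda>z. z j)"
  using laurent_fun_monomial[of r 1 "\<lambda>k. if k = j then 1 else 0"] by (simp add: prod_powi_indicator)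

lemma laurent_fun_inverse_coord: "j < r \<Longrightarrow> laurent_fun r (\<lambda>z. inverse (z j))"
  using laurent_fun_monomial[of r 1 "\<lambda>k. if k = j then - 1 else 0"]
  by (simp add: prod_powi_indicator power_int_minus)

lemma laurent_fun_cmult:
  assumes "laurent_fun r f"
  shows "laurent_fun r (\<lambda>z. a * f z)"
proof -
  from assms obtain S and c :: "(nat \<Rightarrow> int) \<Rightarrow> complex" where
    "finite S" "\<forall>z\<in>std_torus r. f z = (\<Sum>m\<in>S. c m * (\<Prod>k<r. z k powi m k))"
    unfolding laurent_fun_def by blast
  then show ?thesis
    unfolding laurent_fun_def
    by (intro exI[of _ S] exI[of _ "\<lambda>m. a * c m"]) (simp add: sum_distrib_left mult.assoc)
qed

lemma laurent_fun_add:
  assumes "laurent_fun r f" "laurent_fun r g"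
  shows "laurent_fun r (\<lambda>z. f z + g z)"
proof -
  from assms(1) obtain S and c :: "(nat \<Rightarrow> int) \<Rightarrow> complex" where S: "finite S"
    and f: "\<And>z. z \<in> std_torus r \<Longrightarrow> f z = (\<Sum>m\<in>S. c m * (\<Prod>k<r. z k powi m k))"
    unfolding laurent_fun_def by blast
  from assms(2) obtain S' and c' :: "(nat \<Rightarrow> int) \<Rightarrow> complex" where S': "finite S'"
    and g: "\<And>z. z \<in> std_torus r \<Longrightarrow> g z = (\<Sum>m\<in>S'. c' m * (\<Prod>k<r. z k powi m k))"
    unfolding laurent_fun_def by blast
  let ?c = "\<lambda>m. (if m \<in> S then c m else 0) + (if m \<in> S' then c' m else 0)"
  have "f z + g z = (\<Sum>m\<in>S \<union> S'. ?c m * (\<Prod>k<r. z k powi m k))" if z: "z \<in> std_torus r" for z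
  proof -
    have "f z = (\<Sum>m\<in>S \<union> S'. (if m \<in> S then c m else 0) * (\<Prod>k<r. z k powi m k))"
      unfolding f[OF z] using S S' by (intro sum.mono_neutral_cong_left) auto
    moreover have "g z = (\<Sum>m\<in>S \<union> S'. (if m \<in> S' then c' m else 0) * (\<Prod>k<r. z k powi m k))"
      unfolding g[OF z] using S S' by (intro sum.mono_neutral_cong_left) auto
    ultimately show ?thesis by (simp add: distrib_right sum.distrib)
  qed
  then show ?thesis
    unfolding laurent_fun_def using S S' by (intro exI[of _ "S \<union> S'"] exI[of _ ?c]) auto
qed

lemma laurent_fun_sum:
  "(\<And>i. i \<in> I \<Longrightarrow> laurent_fun r (f i)) \<Longrightarrow> laurent_fun r (\<lambda>z. \<Sum>i\<in>I. f i z)"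
  by (induction I rule: infinite_finite_induct) (auto simp: laurent_fun_const laurent_fun_add)

text \<open>Entries of a torus element are fixed linear combinations of its weights. The inverses of
  the parameters get their own assumption because the inverse of a Laurent polynomial is in general
  not one.\<close>

lemma (in antidiagonal_frame) laurent_fun_torus_elt:
  assumes "\<And>k. k < d div 2 \<Longrightarrow> laurent_fun r (\<lambda>z. u z k)"
    "\<And>k. k < d div 2 \<Longrightarrow> laurent_fun r (\<lambda>z. inverse (u z k))"
    and kl: "k < d" "l < d"
  shows "laurent_fun r (\<lambda>z. torus_elt (u z) $$ (k, l))"
proof -
  have w: "laurent_fun r (\<lambda>z. torus_weight d (u z) m)" for m
    using assms(1)[of m] assms(2)[of "d - 1 - m"]
    by (cases "m < d div 2"; cases "d - 1 - m < d div 2") (simp_all add: torus_weight_def laurent_fun_const)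
  have "laurent_fun r (\<lambda>z. mat_diag d (torus_weight d (u z)) $$ (m, n))" if "m < d" "n < d" for m n
    using that w[of n] by (cases "m = n") (auto simp: mat_diag_def laurent_fun_const)
  then show ?thesis
    unfolding torus_elt_def conj_entry[OF mat_diag_dim kl]
    by (intro laurent_fun_sum laurent_fun_cmult) auto
qed

lemma smult_smult_mat: "c \<cdot>\<^sub>m (c' \<cdot>\<^sub>m (A :: complex mat)) = (c * c') \<cdot>\<^sub>m A"
  by (rule eq_matI) auto

lemma torus_commute:
  assumes "is_torus n G T'" "s \<in> T'" "t \<in> T'"
  shows "fam_mult s t = fam_mult t s"
proof -
  from assms(1) obtain r \<phi> where \<phi>: "is_torus_hom n r G \<phi>" "T' = \<phi> ` std_torus r"
    unfolding is_torus_def by blast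
  from assms(2,3) obtain z w where zw: "z \<in> std_torus r" "w \<in> std_torus r" "s = \<phi> z" "t = \<phi> w"
    using \<phi>(2) by blast
  have "fam_mult s t = \<phi> (\<lambda>k\<in>{..<r}. z k * w k)" using \<phi>(1) zw by (simp add: is_torus_hom_def)
  also have "\<dots> = \<phi> (\<lambda>k\<in>{..<r}. w k * z k)" by (simp only: mult.commute)
  also have "\<dots> = fam_mult t s" using \<phi>(1) zw by (simp add: is_torus_hom_def)
  finally show ?thesis .
qed

lemma torus_subset: "is_torus n G T' \<Longrightarrow> T' \<subseteq> G"
  unfolding is_torus_def is_torus_hom_def by auto

text \<open>Symplectic vertices have even dimension and hence no middle weight; at orthogonal
  vertices the determinant condition controls it. So both kinds of factor get a torus with
  \<open>v i div 2\<close> parameters.\<close>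

locale gauge_frame =
  fixes eps :: "'q::finite \<Rightarrow> sign" and v :: "'q \<Rightarrow> nat" and omV P Q :: "'q matfam"
  assumes frame: "\<And>i. antidiagonal_frame (v i) (omV i) (P i) (Q i)"
    and antisym: "\<And>i. eps i = Minus \<Longrightarrow> transpose_mat (omV i) = - omV i"
    and even_dim: "\<And>i. eps i = Minus \<Longrightarrow> even (v i)"
begin

sublocale F: antidiagonal_frame "v i" "omV i" "P i" "Q i" for i
  by (rule frame)

abbreviation G :: "'q matfam set" where "G \<equiv> gauge_group eps v omV"

definition tor :: "('q \<Rightarrow> nat \<Rightarrow> complex) \<Rightarrow> 'q matfam" where
  "tor u = (\<lambda>i. F.torus_elt i (u i))"

definition T :: "'q matfam set" where
  "T = {tor u |u. \<forall>i k. u i k \<noteq> 0}"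

lemma tor_in_gauge_group: "(\<And>i k. u i k \<noteq> 0) \<Longrightarrow> tor u \<in> G"
  using F.torus_elt_isometry
  by (auto simp: tor_def gauge_group_def SO_group_def Sp_group_def split: sign.splits)

lemma tor_mult: "fam_mult (tor u) (tor u') = tor (\<lambda>i k. u i k * u' i k)"
  by (simp add: fam_mult_def tor_def F.torus_elt_mult)

lemma tor_eq_iff: "tor u = tor u' \<longleftrightarrow> (\<forall>i. \<forall>k<v i div 2. u i k = u' i k)"
  by (simp add: tor_def fun_eq_iff F.torus_elt_eq_iff)

lemma tor_one: "tor (\<lambda>i k. 1) = fam_one v"
proof
  fix i
  have "torus_weight (v i) (\<lambda>k. 1) = (\<lambda>k. 1)" by (auto simp: torus_weight_def)
  then show "tor (\<lambda>i k. 1) i = fam_one v i"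
    by (simp add: tor_def fam_one_def F.torus_elt_def)
qed

text \<open>A bijection \<open>h\<close> numbers the parameter places \<open>(i, k)\<close> of all
  vertices by \<open>0, ..., r - 1\<close>, which identifies \<open>T\<close> with the standard
  torus of rank \<open>r\<close>.\<close>

lemma T_is_torus: "is_torus v G T"
proof -
  let ?S = "SIGMA i:(UNIV :: 'q set). {..<v i div 2}"
  have "finite ?S" by simp
  then obtain h where h: "bij_betw h ?S {0..<card ?S}" using ex_bij_betw_finite_nat by blast
  define r where "r = card ?S"
  have hr: "h (i, k) < r" if "k < v i div 2" for i k
    using bij_betwE[OF h] that by (force simp: r_def)
  have hinj: "h (i, k) = h (j, l) \<longleftrightarrow> i = j \<and> k = l" if "k < v i div 2" "l < v j div 2" for i j k l
    using bij_betw_imp_inj_on[OF h] that by (auto simp: inj_on_def)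
  have hsurj: "\<exists>i k. k < v i div 2 \<and> n = h (i, k)" if "n < r" for n
  proof -
    have "n \<in> h ` ?S" using bij_betw_imp_surj_on[OF h] that by (simp add: r_def)
    then show ?thesis by auto
  qed
  define par where "par z = (\<lambda>i k. if k < v i div 2 then z (h (i, k)) else 1)" for z :: "nat \<Rightarrow> complex"
  have nz: "par z i k \<noteq> 0" if "z \<in> std_torus r" for z i k
    using that hr[of k i] by (auto simp: par_def std_torus_def PiE_iff)
  have hom: "is_torus_hom v r G (\<lambda>z. tor (par z))"
    unfolding is_torus_hom_def
  proof (intro conjI ballI allI impI)
    fix z w assume "z \<in> std_torus r" "w \<in> std_torus r"
    show "tor (par z) \<in> G" using nz[OF \<open>z \<in> std_torus r\<close>] by (rule tor_in_gauge_group)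
    show "tor (par (\<lambda>k\<in>{..<r}. z k * w k)) = fam_mult (tor (par z)) (tor (par w))"
      by (auto simp: tor_mult tor_eq_iff par_def hr)
  next
    fix i k l assume "k < v i" "l < v i"
    then show "laurent_fun r (\<lambda>z. tor (par z) i $$ (k, l))"
      unfolding tor_def
      by (intro F.laurent_fun_torus_elt)
        (auto simp: par_def hr intro: laurent_fun_coord laurent_fun_inverse_coord)
  qed
  have inj: "inj_on (\<lambda>z. tor (par z)) (std_torus r)"
  proof (rule inj_onI)
    fix z w assume zw: "z \<in> std_torus r" "w \<in> std_torus r" "tor (par z) = tor (par w)"
    show "z = w"
    proof (rule PiE_ext)
      show "z \<in> {..<r} \<rightarrow>\<^sub>E (UNIV - {0})" "w \<in> {..<r} \<rightarrow>\<^sub>E (UNIV - {0})"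
        using zw by (simp_all add: std_torus_def)
      fix n assume "n \<in> {..<r}"
      then obtain i k where "k < v i div 2" "n = h (i, k)" using hsurj by blast
      then show "z n = w n" using zw(3) by (simp add: tor_eq_iff par_def)
    qed
  qed
  have "T = (\<lambda>z. tor (par z)) ` std_torus r"
  proof
    show "(\<lambda>z. tor (par z)) ` std_torus r \<subseteq> T"
      using nz unfolding T_def by blast
    show "T \<subseteq> (\<lambda>z. tor (par z)) ` std_torus r"
    proof
      fix t assume "t \<in> T"
      then obtain u where u: "t = tor u" "\<And>i k. u i k \<noteq> 0" unfolding T_def by blast
      \<comment> \<open>Inverse of the parametrization: coordinate \<open>n\<close> is the parameter
        at the place numbered \<open>n\<close>.\<close>
      define z where "z = (\<lambda>n\<in>{..<r}. case inv_into ?S h n of (i, k) \<Rightarrow> u i k)"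
      have "z \<in> std_torus r" using u(2) by (auto simp: z_def std_torus_def split: prod.splits)
      moreover have "tor (par z) = t"
        unfolding u(1) tor_eq_iff
      proof (intro allI impI)
        fix i k assume k: "k < v i div 2"
        then have "inv_into ?S h (h (i, k)) = (i, k)"
          by (intro inv_into_f_f[OF bij_betw_imp_inj_on[OF h]]) auto
        then show "par z i k = u i k" using k hr[OF k] by (simp add: par_def z_def)
      qed
      ultimately show "t \<in> (\<lambda>z. tor (par z)) ` std_torus r" by blast
    qed
  qed
  then show ?thesis unfolding is_torus_def using hom inj by blast
qed

lemma T_is_maximal_torus: "is_maximal_torus v G T"
  unfolding is_maximal_torus_def
proof (intro conjI allI impI T_is_torus)
  fix T' assume T': "is_torus v G T' \<and> T \<subseteq> T'"
  have "t \<in> T" if t: "t \<in> T'" for t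
  proof -
    \<comment> \<open>The generic parameters at all vertices simultaneously; commuting with this one
      element is a condition at each vertex separately.\<close>
    have "tor (\<lambda>i k. of_nat (k + 2)) \<in> T"
    proof -
      have "of_nat (k + 2) \<noteq> (0 :: complex)" for k unfolding of_nat_eq_0_iff by simp
      then show ?thesis unfolding T_def by blast
    qed
    then have comm: "fam_mult t (tor (\<lambda>i k. of_nat (k + 2))) = fam_mult (tor (\<lambda>i k. of_nat (k + 2))) t"
      using T' t torus_commute by blast
    have tG: "t \<in> G" using T' t torus_subset by blast
    have "\<exists>u. (\<forall>k. u k \<noteq> 0) \<and> t i = F.torus_elt i u" for i
    proof (rule F.torus_elt_self_centralizing)
      have "t i \<in> (case eps i of Plus \<Rightarrow> SO_group (v i) (omV i) | Minus \<Rightarrow> Sp_group (v i) (omV i))"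
        using tG by (simp add: gauge_group_def)
      \<comment> \<open>At orthogonal vertices the determinant is 1 by definition of the group; at
        symplectic ones the dimension is even and the condition is vacuous.\<close>
      then show "t i \<in> isometries (v i) (omV i)" "odd (v i) \<Longrightarrow> det (t i) = 1"
        using even_dim[of i] by (auto simp: SO_group_def Sp_group_def split: sign.splits)
      show "t i * F.torus_elt i (\<lambda>k. of_nat (k + 2)) = F.torus_elt i (\<lambda>k. of_nat (k + 2)) * t i"
        using fun_cong[OF comm, of i] by (simp only: fam_mult_def tor_def)
    qed
    then obtain u where "\<And>i. (\<forall>k. u i k \<noteq> 0) \<and> t i = F.torus_elt i (u i)" by metis
    then show ?thesis unfolding T_def by (intro CollectI exI[of _ u]) (auto simp: tor_def)
  qed
  then show "T' = T" using T' by blast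
qed

definition root_fam :: "'q \<Rightarrow> nat \<Rightarrow> nat \<Rightarrow> 'q matfam" where
  "root_fam i a b = (\<lambda>j. if j = i then F.root_vec i a b else 0\<^sub>m (v j) (v j))"

text \<open>The line through the identity in the direction of the root vector stays in the group, so
  it serves as the curve.\<close>

lemma root_fam_in_lie_alg:
  assumes "eps i = Minus" "a + b + 1 = v i" "a \<noteq> b"
  shows "root_fam i a b \<in> lie_alg v G"
proof -
  define \<gamma> where "\<gamma> s = (\<lambda>j. if j = i then 1\<^sub>m (v i) + s \<cdot>\<^sub>m F.root_vec i a b else 1\<^sub>m (v j))" for s
  have "\<gamma> s \<in> G" for s
  proof -
    have "tor (\<lambda>i k. 1) \<in> G" by (rule tor_in_gauge_group) simp
    then have one: "1\<^sub>m (v j) \<in> (case eps j of Plus \<Rightarrow> SO_group (v j) (omV j) | Minus \<Rightarrow> Sp_group (v j) (omV j))" for j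
      by (simp add: tor_one gauge_group_def fam_one_def)
    show ?thesis
      using one F.root_group_isometry[OF assms(2,3) antisym[OF assms(1)], of s] assms(1)
      by (auto simp: gauge_group_def \<gamma>_def Sp_group_def)
  qed
  moreover have "\<gamma> 0 = fam_one v"
    by (auto simp: \<gamma>_def fam_one_def fun_eq_iff carrier_matD[OF F.root_vec_carrier] intro!: eq_matI)
  moreover have "((\<lambda>s. \<gamma> s j $$ (k, l)) has_field_derivative root_fam i a b j $$ (k, l)) (at 0)"
    if "k < v j" "l < v j" for j k l
    using that unfolding \<gamma>_def root_fam_def
    by (cases "j = i") (auto simp: carrier_matD[OF F.root_vec_carrier] intro!: derivative_eq_intros)
  moreover have "root_fam i a b j \<in> carrier_mat (v j) (v j)" for j
    by (simp add: root_fam_def)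
  ultimately show ?thesis unfolding lie_alg_def by blast
qed

text \<open>In the standard numbering, the coroot of the long root \<open>2 \<epsilon>\<^sub>0\<close> at the vertex \<open>i\<close>.\<close>

definition long_coroot :: "'q \<Rightarrow> complex \<Rightarrow> 'q matfam" where
  "long_coroot i z = tor (\<lambda>j k. if j = i \<and> k = 0 then z else 1)"

text \<open>The diagonal of the coroot has \<open>z\<close> at position 0, its inverse at position
  \<open>d - 1\<close> and 1 elsewhere; these are the derivatives at 1.\<close>

definition long_coroot_diff :: "nat \<Rightarrow> nat \<Rightarrow> complex" where
  "long_coroot_diff d k = (if k = 0 then 1 else if k = d - 1 then - 1 else 0)"

lemma long_coroot_deriv:
  assumes i: "eps i = Minus" "v i \<noteq> 0" and kl: "k < v j" "l < v j"
  shows "((\<lambda>z. long_coroot i z j $$ (k, l)) has_field_derivative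
    (if j = i then F.conj i (mat_diag (v i) (long_coroot_diff (v i))) else 0\<^sub>m (v j) (v j)) $$ (k, l)) (at 1)"
proof (cases "j = i")
  case False
  then show ?thesis using kl by (simp add: long_coroot_def tor_def)
next
  case True
  have v: "0 < v i div 2" using even_dim[OF i(1)] i(2) by (auto elim!: evenE)
  have w: "((\<lambda>z. torus_weight (v i) (\<lambda>k. if k = 0 then z else 1) m) has_field_derivative
      long_coroot_diff (v i) m) (at 1)" if "m < v i" for m
  proof -
    \<comment> \<open>Position 0, the rest of the first half, the last position, the rest of the
      second half; an even dimension has no middle position.\<close>
    have "m = 0 \<or> (m \<noteq> 0 \<and> m < v i div 2 \<and> m \<noteq> v i - 1) \<or>
        (m \<noteq> 0 \<and> \<not> m < v i div 2 \<and> m = v i - 1) \<or>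
        (m \<noteq> 0 \<and> \<not> m < v i div 2 \<and> m \<noteq> v i - 1 \<and> v i - 1 - m \<noteq> 0)"
      using that v by arith
    then consider "m = 0" | "m \<noteq> 0" "m < v i div 2" "m \<noteq> v i - 1"
      | "m \<noteq> 0" "\<not> m < v i div 2" "m = v i - 1"
      | "m \<noteq> 0" "\<not> m < v i div 2" "m \<noteq> v i - 1" "v i - 1 - m \<noteq> 0"
      by metis
    then show ?thesis
    proof cases
      case 3
      then show ?thesis using v
        by (auto simp: torus_weight_def long_coroot_diff_def intro!: derivative_eq_intros)
    next
      case 4
      then have "(\<lambda>z. torus_weight (v i) (\<lambda>k. if k = 0 then z else 1) m) = (\<lambda>z. 1)"
        by (auto simp: torus_weight_def fun_eq_iff)
      then show ?thesis using 4 by (simp add: long_coroot_diff_def)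
    qed (use v in \<open>auto simp: torus_weight_def long_coroot_diff_def\<close>)
  qed
  have "((\<lambda>z. F.torus_elt i (\<lambda>k. if k = 0 then z else 1) $$ (k, l)) has_field_derivative
      F.conj i (mat_diag (v i) (long_coroot_diff (v i))) $$ (k, l)) (at 1)"
    unfolding F.torus_elt_def F.conj_entry[OF mat_diag_dim kl[unfolded True]]
  proof (intro DERIV_sum DERIV_cmult)
    fix m n assume "m \<in> {..<v i}" "n \<in> {..<v i}"
    then show "((\<lambda>z. mat_diag (v i) (torus_weight (v i) (\<lambda>k. if k = 0 then z else 1)) $$ (m, n))
        has_field_derivative mat_diag (v i) (long_coroot_diff (v i)) $$ (m, n)) (at 1)"
      using w by (cases "m = n") (auto simp: mat_diag_def)
  qed
  then show ?thesis using True by (simp add: long_coroot_def tor_def)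
qed

lemma cochar_diff_long_coroot:
  assumes "eps i = Minus" "v i \<noteq> 0"
  shows "cochar_diff v (long_coroot i) =
    (\<lambda>j. if j = i then F.conj i (mat_diag (v i) (long_coroot_diff (v i))) else 0\<^sub>m (v j) (v j))"
proof
  fix j
  show "cochar_diff v (long_coroot i) j =
    (if j = i then F.conj i (mat_diag (v i) (long_coroot_diff (v i))) else 0\<^sub>m (v j) (v j))" (is "_ = ?D")
  proof (rule eq_matI)
    have D: "?D \<in> carrier_mat (v j) (v j)" by simp
    show "dim_row (cochar_diff v (long_coroot i) j) = dim_row ?D"
      "dim_col (cochar_diff v (long_coroot i) j) = dim_col ?D"
      using carrier_matD[OF D] by (simp_all add: cochar_diff_def)
    fix k l assume "k < dim_row ?D" "l < dim_col ?D"
    then have kl: "k < v j" "l < v j" using carrier_matD[OF D] by simp_all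
    then show "cochar_diff v (long_coroot i) j $$ (k, l) = ?D $$ (k, l)"
      using DERIV_imp_deriv[OF long_coroot_deriv[OF assms kl]] by (simp add: cochar_diff_def)
  qed
qed

text \<open>A curve in \<open>lie_alg\<close> must lie in the group for all complex parameters;
  composing the coroot with \<open>exp\<close> avoids 0 and keeps the velocity.\<close>

lemma long_coroot_diff_in_lie_alg:
  assumes "eps i = Minus" "v i \<noteq> 0"
  shows "cochar_diff v (long_coroot i) \<in> lie_alg v G"
proof -
  let ?\<gamma> = "\<lambda>s. long_coroot i (exp s)"
  have "?\<gamma> s \<in> G" for s
    unfolding long_coroot_def by (rule tor_in_gauge_group) simp
  moreover have "?\<gamma> 0 = fam_one v"
    using tor_one by (simp add: long_coroot_def cong: if_cong)
  moreover have "((\<lambda>s. ?\<gamma> s j $$ (k, l)) has_field_derivative cochar_diff v (long_coroot i) j $$ (k, l)) (at 0)"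
    if "k < v j" "l < v j" for j k l
  proof -
    have "((\<lambda>z. long_coroot i z j $$ (k, l)) has_field_derivative
        cochar_diff v (long_coroot i) j $$ (k, l)) (at (exp 0))"
      using long_coroot_deriv[OF assms that] by (simp add: cochar_diff_long_coroot[OF assms])
    from DERIV_chain2[OF this DERIV_exp[of 0]] show ?thesis by simp
  qed
  moreover have "cochar_diff v (long_coroot i) j \<in> carrier_mat (v j) (v j)" for j
    by (simp add: cochar_diff_def)
  ultimately show ?thesis unfolding lie_alg_def by (intro CollectI conjI exI[of _ ?\<gamma>]) auto
qed

text \<open>This is the copy of SL2 at the positions 0 and \<open>b = v i - 1\<close>: the bracket
  of the root vectors at \<open>(0, b)\<close> and \<open>(b, 0)\<close> is the diagonal matrix with
  1 at position 0 and -1 at position \<open>b\<close>.\<close>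

lemma long_coroot_is_coroot:
  assumes i: "eps i = Minus" "v i \<noteq> 0"
  shows "is_coroot v G T (long_coroot i)"
proof -
  define b where "b = v i - 1"
  have v: "0 < v i div 2" using even_dim[OF i(1)] i(2) by (auto elim!: evenE)
  have b: "0 + b + 1 = v i" "b + 0 + 1 = v i" "0 \<noteq> b" "b \<noteq> 0" "0 < v i" "b < v i" "\<not> b < v i div 2"
    "v i - 1 - b = 0"
    using v by (auto simp: b_def)
  \<comment> \<open>The character of the long root, the square of the first eigenvalue, read off
    after returning to the adapted basis.\<close>
  define \<alpha> where "\<alpha> t = ((Q i * t i * P i) $$ (0, 0))\<^sup>2" for t :: "'q matfam"
  have \<alpha>: "\<alpha> (tor u) = (u i 0)\<^sup>2" for u
    using v b by (simp add: \<alpha>_def tor_def F.torus_elt_def F.conj_inverse mat_diag_def torus_weight_def)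
  have cochar: "is_cocharacter v T (long_coroot i)"
    unfolding is_cocharacter_def is_torus_hom_def
  proof (intro conjI ballI allI impI)
    fix z w :: "nat \<Rightarrow> complex" assume zw: "z \<in> std_torus 1" "w \<in> std_torus 1"
    have "z 0 \<noteq> 0" using zw(1) by (auto simp: std_torus_def PiE_iff)
    then show "long_coroot i (z 0) \<in> T"
      unfolding long_coroot_def T_def
      by (intro CollectI exI conjI refl) (auto split: if_splits)
    show "long_coroot i ((\<lambda>k\<in>{..<1}. z k * w k) 0) = fam_mult (long_coroot i (z 0)) (long_coroot i (w 0))"
      by (auto simp: long_coroot_def tor_mult tor_eq_iff)
  next
    fix j k l assume kl: "k < v j" "l < v j"
    have "laurent_fun 1 (\<lambda>z. if j = i \<and> m = 0 then z 0 else 1)"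
      "laurent_fun 1 (\<lambda>z. inverse (if j = i \<and> m = 0 then z 0 else 1))" for m :: nat
      by (cases "j = i"; cases "m = 0"; simp add: laurent_fun_coord laurent_fun_inverse_coord laurent_fun_const)+
    then show "laurent_fun 1 (\<lambda>z. long_coroot i (z 0) j $$ (k, l))"
      unfolding long_coroot_def tor_def
      using kl by (intro F.laurent_fun_torus_elt)
  qed
  \<comment> \<open>Conjugation scales the root vector at \<open>(0, b)\<close> by the quotient of
    these two weights, the square of \<open>u 0\<close>.\<close>
  have w0: "torus_weight (v i) u 0 = u 0" "torus_weight (v i) u b = inverse (u 0)" for u
    using v b by (auto simp: torus_weight_def)
  have x: "root_fam i 0 b \<in> root_space v G T \<alpha>"
    unfolding root_space_def
  proof (intro CollectI conjI ballI root_fam_in_lie_alg i b)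
    fix t assume "t \<in> T"
    then obtain u where u: "t = tor u" "\<And>i k. u i k \<noteq> 0" unfolding T_def by blast
    show "fam_mult t (root_fam i 0 b) = fam_smult (\<alpha> t) (fam_mult (root_fam i 0 b) t)"
    proof
      fix j
      show "fam_mult t (root_fam i 0 b) j = fam_smult (\<alpha> t) (fam_mult (root_fam i 0 b) t) j"
      proof (cases "j = i")
        case True
        then show ?thesis using u(2)[of i 0] b
          by (simp add: u(1) \<alpha>[unfolded tor_def] fam_mult_def fam_smult_def root_fam_def tor_def F.torus_elt_root_vec w0
              smult_smult_mat power2_eq_square mult.assoc)
      qed (auto simp: u(1) fam_mult_def fam_smult_def root_fam_def tor_def
          left_mult_zero_mat[OF F.torus_elt_carrier] right_mult_zero_mat[OF F.torus_elt_carrier])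
    qed
  qed
  have y: "root_fam i b 0 \<in> root_space v G T (\<lambda>t. inverse (\<alpha> t))"
    unfolding root_space_def
  proof (intro CollectI conjI ballI root_fam_in_lie_alg i b)
    fix t assume "t \<in> T"
    then obtain u where u: "t = tor u" "\<And>i k. u i k \<noteq> 0" unfolding T_def by blast
    show "fam_mult t (root_fam i b 0) = fam_smult (inverse (\<alpha> t)) (fam_mult (root_fam i b 0) t)"
    proof
      fix j
      show "fam_mult t (root_fam i b 0) j = fam_smult (inverse (\<alpha> t)) (fam_mult (root_fam i b 0) t) j"
      proof (cases "j = i")
        case True
        then show ?thesis using u(2)[of i 0] b
          by (simp add: u(1) \<alpha>[unfolded tor_def] fam_mult_def fam_smult_def root_fam_def tor_def F.torus_elt_root_vec w0
              smult_smult_mat power2_eq_square mult.assoc)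
      qed (auto simp: u(1) fam_mult_def fam_smult_def root_fam_def tor_def
          left_mult_zero_mat[OF F.torus_elt_carrier] right_mult_zero_mat[OF F.torus_elt_carrier])
    qed
  qed
  have nz: "root_fam i 0 b \<noteq> (\<lambda>i. 0\<^sub>m (v i) (v i))"
  proof
    assume "root_fam i 0 b = (\<lambda>i. 0\<^sub>m (v i) (v i))"
    from fun_cong[OF this, of i] show False
      using F.root_vec_nonzero[OF b(5,6)] by (simp add: root_fam_def)
  qed
  have bracket: "cochar_diff v (long_coroot i) = fam_bracket (root_fam i 0 b) (root_fam i b 0)"
  proof
    fix j
    have "mat_diag (v i) (long_coroot_diff (v i)) = mat_unit (v i) 0 0 - mat_unit (v i) b b"
      using b by (auto simp: mat_diag_def mat_unit_def long_coroot_diff_def b_def)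
    then show "cochar_diff v (long_coroot i) j = fam_bracket (root_fam i 0 b) (root_fam i b 0) j"
      using b unfolding cochar_diff_long_coroot[OF i]
      by (simp add: fam_bracket_def root_fam_def F.root_vec_mult F.conj_minus)
        (auto simp: F.root_vec_def minus_r_inv_mat)
  qed
  have "\<alpha> (long_coroot i z) = z\<^sup>2" for z
    by (simp add: long_coroot_def \<alpha>)
  then show ?thesis
    unfolding is_coroot_def using cochar x y nz bracket by blast
qed

lemma mat_trace_long_coroot_diff_square:
  assumes "eps i = Minus" "v i \<noteq> 0"
  shows "mat_trace (cochar_diff v (long_coroot i) i * cochar_diff v (long_coroot i) i) = 2"
proof -
  have v: "1 < v i" using even_dim[OF assms(1)] assms(2) by (auto elim!: evenE)
  let ?D = "\<lambda>k. long_coroot_diff (v i) k * long_coroot_diff (v i) k"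
  have "mat_trace (cochar_diff v (long_coroot i) i * cochar_diff v (long_coroot i) i) =
      mat_trace (F.conj i (mat_diag (v i) ?D))"
    by (simp add: cochar_diff_long_coroot[OF assms] F.conj_mult)
  also have "\<dots> = mat_trace (mat_diag (v i) ?D)" by (simp add: F.mat_trace_conj_eq)
  also have "\<dots> = (\<Sum>k<v i. ?D k)" by (simp add: mat_trace_def mat_diag_def)
  also have "\<dots> = (\<Sum>k\<in>{0, v i - 1}. ?D k)"
    using v by (intro sum.mono_neutral_right) (auto simp: long_coroot_diff_def)
  also have "\<dots> = 2" using v by (simp add: long_coroot_diff_def)
  finally show ?thesis .
qed

end

section \<open>The trace form\<close>

text \<open>Transposition gives \<open>det A = (- 1) ^ d * det A\<close>, impossible for odd
  \<open>d\<close> and invertible \<open>A\<close>.\<close>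

lemma antisym_form_even:
  assumes "antisym_form d A"
  shows "even d"
proof (rule ccontr)
  assume "odd d"
  have A: "A \<in> carrier_mat d d" "transpose_mat A = - A" "invertible_mat A"
    using assms by (simp_all add: antisym_form_def)
  obtain B where B: "B \<in> carrier_mat d d" "A * B = 1\<^sub>m d" using invertible_matE[OF A(1,3)] by blast
  have "det A = det (transpose_mat A)" using det_transpose[OF A(1)] by simp
  also have "transpose_mat A = (- 1) \<cdot>\<^sub>m A" unfolding A(2) by (rule eq_matI) auto
  also have "det \<dots> = (- 1) ^ d * det A" using A(1) by simp
  finally have "det A = 0" using \<open>odd d\<close> by simp
  then show False using det_mult[OF A(1) B(1)] B(2) by simp
qed

lemma lie_algD_carrier: "a \<in> lie_alg n G \<Longrightarrow> a i \<in> carrier_mat (n i) (n i)"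
  by (simp add: lie_alg_def)

lemma mat_triple_mult_entry:
  fixes X Y Z :: "complex mat"
  assumes "X \<in> carrier_mat d d" "Y \<in> carrier_mat d d" "Z \<in> carrier_mat d d" "k < d" "l < d"
  shows "(X * Y * Z) $$ (k, l) = (\<Sum>m<d. (\<Sum>n<d. X $$ (k, n) * Y $$ (n, m)) * Z $$ (m, l))"
proof -
  have "(X * Y * Z) $$ (k, l) = (\<Sum>m<d. (X * Y) $$ (k, m) * Z $$ (m, l))"
    using assms by (intro mat_mult_entry) auto
  also have "\<dots> = (\<Sum>m<d. (\<Sum>n<d. X $$ (k, n) * Y $$ (n, m)) * Z $$ (m, l))"
    by (intro sum.cong refl arg_cong2[where f = "(*)"] mat_mult_entry[OF assms(1,2,4)]) simp
  finally show ?thesis .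
qed

text \<open>Differentiate the isometry equation along the curve \<open>\<gamma>\<close>, entry by
  entry.\<close>

lemma lie_alg_infinitesimal_isometry:
  assumes om: "\<And>i. om i \<in> carrier_mat (v i) (v i)"
    and a: "a \<in> lie_alg v (gauge_group eps v om)" and kl: "k < v i" "l < v i"
  shows "(transpose_mat (a i) * om i) $$ (k, l) + (om i * a i) $$ (k, l) = 0"
proof -
  note [simp del] = index_mult_mat(1)
  from a obtain \<gamma> where \<gamma>: "\<And>s. \<gamma> s \<in> gauge_group eps v om" "\<gamma> 0 = fam_one v"
    and d: "\<And>k l. k < v i \<Longrightarrow> l < v i \<Longrightarrow>
      ((\<lambda>s. \<gamma> s i $$ (k, l)) has_field_derivative a i $$ (k, l)) (at 0)"
    unfolding lie_alg_def by blast
  have c: "\<gamma> s i \<in> carrier_mat (v i) (v i)" for s using gauge_group_carrier(1)[OF \<gamma>(1)] .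
  have ac: "a i \<in> carrier_mat (v i) (v i)" by (rule lie_algD_carrier[OF a])
  let ?f = "\<lambda>s. \<Sum>m<v i. (\<Sum>n<v i. \<gamma> s i $$ (n, k) * om i $$ (n, m)) * \<gamma> s i $$ (m, l)"
  let ?f' = "\<Sum>m<v i. (\<Sum>n<v i. a i $$ (n, k) * om i $$ (n, m)) * \<gamma> 0 i $$ (m, l) +
      a i $$ (m, l) * (\<Sum>n<v i. \<gamma> 0 i $$ (n, k) * om i $$ (n, m))"
  have "(?f has_field_derivative ?f') (at 0)"
    using kl by (intro DERIV_sum DERIV_mult DERIV_cmult_right d) auto
  moreover have "?f = (\<lambda>s. om i $$ (k, l))"
  proof
    fix s
    have "?f s = (transpose_mat (\<gamma> s i) * om i * \<gamma> s i) $$ (k, l)"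
      using mat_triple_mult_entry[of "transpose_mat (\<gamma> s i)" "v i" "om i" "\<gamma> s i" k l] c[of s] om[of i] kl
      by simp
    then show "?f s = om i $$ (k, l)" using gauge_group_carrier(2)[OF \<gamma>(1)] by simp
  qed
  ultimately have "((\<lambda>s. om i $$ (k, l)) has_field_derivative ?f') (at 0)" by (simp only:)
  then have "?f' = 0" by (rule DERIV_unique[OF _ DERIV_const])
  \<comment> \<open>At \<open>s = 0\<close> the curve is the identity, so in each term of the
    product rule one sum collapses.\<close>
  moreover have "?f' = (\<Sum>m<v i. (if m = l then \<Sum>n<v i. a i $$ (n, k) * om i $$ (n, m) else 0)) +
      (\<Sum>m<v i. a i $$ (m, l) * om i $$ (k, m))"
    unfolding sum.distrib
  proof (intro arg_cong2[where f = "(+)"] sum.cong refl)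
    fix m assume "m \<in> {..<v i}"
    then have m: "m < v i" by simp
    then show "(\<Sum>n<v i. a i $$ (n, k) * om i $$ (n, m)) * \<gamma> 0 i $$ (m, l) =
        (if m = l then \<Sum>n<v i. a i $$ (n, k) * om i $$ (n, m) else 0)"
      using kl by (simp add: \<gamma>(2) fam_one_def)
    have "(\<Sum>n<v i. \<gamma> 0 i $$ (n, k) * om i $$ (n, m)) = (\<Sum>n<v i. if n = k then om i $$ (n, m) else 0)"
      using kl by (intro sum.cong) (auto simp: \<gamma>(2) fam_one_def)
    then show "a i $$ (m, l) * (\<Sum>n<v i. \<gamma> 0 i $$ (n, k) * om i $$ (n, m)) = a i $$ (m, l) * om i $$ (k, m)"
      using kl by simp
  qed
  moreover have "(transpose_mat (a i) * om i) $$ (k, l) = (\<Sum>n<v i. a i $$ (n, k) * om i $$ (n, l))"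
    using mat_mult_entry[of "transpose_mat (a i)" "v i" "om i" k l] ac om[of i] kl by simp
  moreover have "(om i * a i) $$ (k, l) = (\<Sum>m<v i. a i $$ (m, l) * om i $$ (k, m))"
    using mat_mult_entry[OF om ac kl] by (simp add: mult.commute)
  ultimately show ?thesis using kl by simp
qed

text \<open>\<open>om i\<close> conjugates \<open>a i\<close> to the negative of its transpose,
  while conjugation and transposition both preserve traces.\<close>

lemma lie_alg_traceless:
  assumes om: "\<And>i. om i \<in> carrier_mat (v i) (v i)" "\<And>i. invertible_mat (om i)"
    and a: "a \<in> lie_alg v (gauge_group eps v om)"
  shows "mat_trace (a i) = 0"
proof -
  have ac: "a i \<in> carrier_mat (v i) (v i)" by (rule lie_algD_carrier[OF a])
  obtain B where B: "B \<in> carrier_mat (v i) (v i)" "om i * B = 1\<^sub>m (v i)" "B * om i = 1\<^sub>m (v i)"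
    using invertible_matE[OF om] .
  have c: "transpose_mat (a i) * om i \<in> carrier_mat (v i) (v i)" "om i * a i \<in> carrier_mat (v i) (v i)"
    using ac om(1)[of i] by auto
  have "mat_trace (a i) = mat_trace (transpose_mat (a i) * om i * B)"
    using ac om(1)[of i] B mat_trace_transpose[OF ac] by (simp add: assoc_mult_mat[of _ "v i" "v i" _ "v i" _ "v i"])
  also have "\<dots> = (\<Sum>k<v i. \<Sum>l<v i. (transpose_mat (a i) * om i) $$ (k, l) * B $$ (l, k))"
    by (rule mat_trace_mult[OF c(1) B(1)])
  also have "\<dots> = (\<Sum>k<v i. \<Sum>l<v i. - ((om i * a i) $$ (k, l) * B $$ (l, k)))"
    using lie_alg_infinitesimal_isometry[OF om(1) a, of _ i, folded eq_neg_iff_add_eq_0]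
    by (intro sum.cong refl) (simp del: index_mult_mat(1))
  also have "\<dots> = - mat_trace (om i * a i * B)"
    by (simp add: mat_trace_mult[OF c(2) B(1)] sum_negf del: index_mult_mat(1))
  also have "mat_trace (om i * a i * B) = mat_trace (a i)"
    by (rule mat_trace_conj[OF om(1) B(1) ac B(3)])
  finally show ?thesis by simp
qed

section \<open>The trace form in terms of the vertex components\<close>

definition edge_pairs :: "'q set set \<Rightarrow> ('q \<Rightarrow> sign) \<Rightarrow> ('q \<times> 'q) set" where
  "edge_pairs Q1 eps = {(i, j). {i, j} \<in> Q1 \<and> eps i = Plus \<and> eps j = Minus}"

lemma sum_matter_basis:
  fixes g :: "'q::finite matter_index \<Rightarrow> complex"
  shows "(\<Sum>p\<in>matter_basis Q1 eps v w. g p) =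
    (\<Sum>(i, j)\<in>edge_pairs Q1 eps. \<Sum>k<v i. \<Sum>l<v j. g (Edge i j k l)) +
    (\<Sum>i\<in>UNIV. \<Sum>k<v i. \<Sum>l<w i. g (Framing i k l))"
proof -
  let ?E = "SIGMA e:edge_pairs Q1 eps. {..<v (fst e)} \<times> {..<v (snd e)}"
  let ?F = "SIGMA i:(UNIV :: 'q set). {..<v i} \<times> {..<w i}"
  let ?e = "\<lambda>(e, k, l). Edge (fst e) (snd e) k l :: 'q matter_index" and ?f = "\<lambda>(i, k, l). Framing i k l"
  have b: "matter_basis Q1 eps v w = ?e ` ?E \<union> ?f ` ?F"
    by (force simp: matter_basis_def edge_pairs_def image_iff)
  have "(\<Sum>p\<in>matter_basis Q1 eps v w. g p) = sum g (?e ` ?E) + sum g (?f ` ?F)"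
    unfolding b by (intro sum.union_disjoint) auto
  also have "sum g (?e ` ?E) = (\<Sum>e\<in>edge_pairs Q1 eps. \<Sum>(k, l)\<in>{..<v (fst e)} \<times> {..<v (snd e)}. g (Edge (fst e) (snd e) k l))"
    by (subst sum.reindex) (auto simp: inj_on_def sum.Sigma case_prod_unfold prod_eq_iff)
  also have "\<dots> = (\<Sum>(i, j)\<in>edge_pairs Q1 eps. \<Sum>k<v i. \<Sum>l<v j. g (Edge i j k l))"
    by (simp add: sum.cartesian_product case_prod_unfold)
  also have "sum g (?f ` ?F) = (\<Sum>i\<in>UNIV. \<Sum>(k, l)\<in>{..<v i} \<times> {..<w i}. g (Framing i k l))"
    by (subst sum.reindex) (auto simp: inj_on_def sum.Sigma case_prod_unfold prod_eq_iff)
  also have "\<dots> = (\<Sum>i\<in>UNIV. \<Sum>k<v i. \<Sum>l<w i. g (Framing i k l))"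
    by (simp add: sum.cartesian_product case_prod_unfold)
  finally show ?thesis .
qed

text \<open>The product rule: the differential of a tensor product is \<open>a i\<close> tensor 1
  plus 1 tensor \<open>a j\<close>.\<close>

lemma matter_drep_Edge:
  assumes "\<And>i. a i \<in> carrier_mat (v i) (v i)" "k < v i" "l < v j" "k' < v i'" "l' < v j'"
  shows "matter_drep v w a (Edge i j k l) (Edge i' j' k' l') =
    (if i' = i \<and> j' = j then a i $$ (k, k') * (if l' = l then 1 else 0) + (if k' = k then 1 else 0) * a j $$ (l, l')
     else 0)"
proof (cases "i' = i \<and> j' = j")
  case True
  have e: "fam_add (fam_one v) (fam_smult s a) i $$ (k, k') = (if k' = k then 1 else 0) + s * a i $$ (k, k')"
    if "k < v i" "k' < v i" for s i k k'
    using that carrier_matD[OF assms(1)] by (auto simp: fam_add_def fam_one_def fam_smult_def)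
  have "((\<lambda>s. ((if k' = k then 1 else 0) + s * a i $$ (k, k')) * ((if l' = l then 1 else 0) + s * a j $$ (l, l')))
      has_field_derivative a i $$ (k, k') * (if l' = l then 1 else 0) + (if k' = k then 1 else 0) * a j $$ (l, l')) (at 0)"
    by (auto intro!: derivative_eq_intros)
  then show ?thesis
    using True assms(2-5) by (auto simp: matter_drep_def matter_rep_def e intro!: DERIV_imp_deriv)
qed (auto simp: matter_drep_def matter_rep_def)

lemma matter_drep_Edge_other:
  "(i', j') \<noteq> (i, j) \<Longrightarrow> matter_drep v w a (Edge i j k l) (Edge i' j' k' l') = 0"
  by (cases "i = i'") (simp_all add: matter_drep_def matter_rep_def)

lemma matter_drep_Framing:
  assumes "\<And>i. a i \<in> carrier_mat (v i) (v i)" "k < v i" "l < w i" "k' < v i'" "l' < w i'"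
  shows "matter_drep v w a (Framing i k l) (Framing i' k' l') =
    (if i' = i then a i $$ (k, k') * (if l' = l then 1 else 0) else 0)"
proof (cases "i' = i")
  case True
  have e: "fam_add (fam_one v) (fam_smult s a) i $$ (k, k') = (if k' = k then 1 else 0) + s * a i $$ (k, k')"
    if "k < v i" "k' < v i" for s i k k'
    using that carrier_matD[OF assms(1)] by (auto simp: fam_add_def fam_one_def fam_smult_def)
  have one: "fam_one w i $$ (l, l') = (if l' = l then 1 else 0)" if "l < w i" "l' < w i"
    using that by (auto simp: fam_one_def)
  have "((\<lambda>s. ((if k' = k then 1 else 0) + s * a i $$ (k, k')) * (if l' = l then 1 else 0))
      has_field_derivative a i $$ (k, k') * (if l' = l then 1 else 0)) (at 0)"
    by (auto intro!: derivative_eq_intros)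
  then show ?thesis
    using True assms(2-5) one by (auto simp: matter_drep_def matter_rep_def e intro!: DERIV_imp_deriv)
qed (auto simp: matter_drep_def matter_rep_def)

lemma matter_drep_Framing_other:
  "i' \<noteq> i \<Longrightarrow> matter_drep v w a (Framing i k l) (Framing i' k' l') = 0"
  by (simp add: matter_drep_def matter_rep_def)

lemma matter_drep_mixed:
  "matter_drep v w a (Edge i j k l) (Framing i' k' l') = 0"
  "matter_drep v w a (Framing i' k' l') (Edge i j k l) = 0"
  by (simp_all add: matter_drep_def matter_rep_def)

text \<open>The diagonal entry at \<open>l\<close> of a product of two matrices of the form scalar
  plus perturbation, with \<open>C\<close> a row of the first perturbation and \<open>C'\<close> a
  column of the second; it evaluates the sum over the second tensor index.\<close>

lemma sum_diagonal_perturbation: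
  fixes C C' :: "nat \<Rightarrow> complex"
  assumes "l < n"
  shows "(\<Sum>l'<n. (x * (if l' = l then 1 else 0) + y * C l') * (x' * (if l = l' then 1 else 0) + y' * C' l')) =
    x * x' + x * y' * C' l + y * x' * C l + y * y' * (\<Sum>l'<n. C l' * C' l')"
proof -
  have *: "(\<Sum>l'<n. g l') = g l + (\<Sum>l'\<in>{..<n} - {l}. g l')" for g :: "nat \<Rightarrow> complex"
    using assms by (intro sum.remove) auto
  have "(\<Sum>l'\<in>{..<n} - {l}. (x * (if l' = l then 1 else 0) + y * C l') * (x' * (if l = l' then 1 else 0) + y' * C' l')) =
      (\<Sum>l'\<in>{..<n} - {l}. y * y' * (C l' * C' l'))"
    by (intro sum.cong refl) auto
  then show ?thesis unfolding * by (simp add: algebra_simps flip: sum_distrib_left)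
qed

text \<open>In the product of two sums of the form \<open>a i\<close> tensor 1 plus 1 tensor
  \<open>a j\<close>, terms on the same side give a trace times the dimension of the other side, and
  mixed terms give a product of two traces.\<close>

lemma matter_trace_form_eq:
  fixes v w :: "'q::finite \<Rightarrow> nat"
  assumes a: "\<And>i. a i \<in> carrier_mat (v i) (v i)" and b: "\<And>i. b i \<in> carrier_mat (v i) (v i)"
  shows "matter_trace_form Q1 eps v w a b =
    (\<Sum>(i, j)\<in>edge_pairs Q1 eps. of_nat (v j) * mat_trace (a i * b i) + mat_trace (a i) * mat_trace (b j) +
       mat_trace (b i) * mat_trace (a j) + of_nat (v i) * mat_trace (a j * b j)) +
    (\<Sum>i\<in>UNIV. of_nat (w i) * mat_trace (a i * b i))"
proof -
  let ?E = "edge_pairs Q1 eps"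
  let ?S = "\<lambda>p. \<Sum>q\<in>matter_basis Q1 eps v w. matter_drep v w a p q * matter_drep v w b q p"
  have E: "?S (Edge i j k l) = (\<Sum>k'<v i. a i $$ (k, k') * b i $$ (k', k)) + a i $$ (k, k) * b j $$ (l, l) +
      b i $$ (k, k) * a j $$ (l, l) + (\<Sum>l'<v j. a j $$ (l, l') * b j $$ (l', l))"
    if e: "(i, j) \<in> ?E" and kl: "k < v i" "l < v j" for i j k l
  proof -
    let ?h = "\<lambda>k' l'. (a i $$ (k, k') * (if l' = l then 1 else 0) + (if k' = k then 1 else 0) * a j $$ (l, l')) *
        (b i $$ (k', k) * (if l = l' then 1 else 0) + (if k = k' then 1 else 0) * b j $$ (l', l))"
    let ?f = "\<lambda>(i', j'). \<Sum>k'<v i'. \<Sum>l'<v j'. matter_drep v w a (Edge i j k l) (Edge i' j' k' l') *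
        matter_drep v w b (Edge i' j' k' l') (Edge i j k l)"
    have "?S (Edge i j k l) = sum ?f ?E"
      by (simp add: sum_matter_basis matter_drep_mixed)
    also have "\<dots> = sum ?f {(i, j)}"
    proof (intro sum.mono_neutral_right ballI)
      fix x assume "x \<in> ?E - {(i, j)}"
      then show "?f x = 0" by (cases x) (simp add: matter_drep_Edge_other)
    qed (use e in auto)
    also have "\<dots> = (\<Sum>k'<v i. \<Sum>l'<v j. ?h k' l')"
      using kl by (simp add: matter_drep_Edge[OF a] matter_drep_Edge[OF b])
    also have "\<dots> = (\<Sum>k'<v i. a i $$ (k, k') * b i $$ (k', k) +
        a i $$ (k, k') * (if k = k' then 1 else 0) * b j $$ (l, l) +
        (if k' = k then 1 else 0) * b i $$ (k', k) * a j $$ (l, l) +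
        (if k' = k then 1 else 0) * (if k = k' then 1 else 0) * (\<Sum>l'<v j. a j $$ (l, l') * b j $$ (l', l)))"
      by (intro sum.cong refl sum_diagonal_perturbation kl)
    also have "\<dots> = (\<Sum>k'<v i. a i $$ (k, k') * b i $$ (k', k) +
        (if k' = k then a i $$ (k, k) * b j $$ (l, l) + b i $$ (k, k) * a j $$ (l, l) +
          (\<Sum>l'<v j. a j $$ (l, l') * b j $$ (l', l)) else 0))"
      by (intro sum.cong refl) auto
    finally show ?thesis using kl by (simp add: sum.distrib add.assoc)
  qed
  have F: "?S (Framing i k l) = (\<Sum>k'<v i. a i $$ (k, k') * b i $$ (k', k))"
    if kl: "k < v i" "l < w i" for i k l
  proof -
    let ?f = "\<lambda>i'. \<Sum>k'<v i'. \<Sum>l'<w i'. matter_drep v w a (Framing i k l) (Framing i' k' l') *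
        matter_drep v w b (Framing i' k' l') (Framing i k l)"
    have "?S (Framing i k l) = (\<Sum>i'\<in>UNIV. ?f i')"
      by (simp add: sum_matter_basis matter_drep_mixed)
    also have "\<dots> = sum ?f {i}"
      by (intro sum.mono_neutral_right) (auto simp: matter_drep_Framing_other)
    also have "\<dots> = (\<Sum>k'<v i. \<Sum>l'<w i. a i $$ (k, k') * (if l' = l then 1 else 0) *
        (b i $$ (k', k) * (if l = l' then 1 else 0)))"
      using kl by (simp add: matter_drep_Framing[OF a] matter_drep_Framing[OF b])
    also have "\<dots> = (\<Sum>k'<v i. \<Sum>l'<w i. if l' = l then a i $$ (k, k') * b i $$ (k', k) else 0)"
      by (intro sum.cong refl) auto
    finally show ?thesis using kl by simp
  qed
  have tr: "mat_trace (a i) = (\<Sum>k<v i. a i $$ (k, k))" "mat_trace (b i) = (\<Sum>k<v i. b i $$ (k, k))" for i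
    using carrier_matD[OF a] carrier_matD[OF b] by (simp_all add: mat_trace_def)
  have pr: "mat_trace (a i) * mat_trace (b j) = (\<Sum>k<v i. \<Sum>l<v j. a i $$ (k, k) * b j $$ (l, l))"
    "mat_trace (b i) * mat_trace (a j) = (\<Sum>k<v i. \<Sum>l<v j. b i $$ (k, k) * a j $$ (l, l))" for i j
    by (simp_all add: tr sum_product)
  have "matter_trace_form Q1 eps v w a b = (\<Sum>p\<in>matter_basis Q1 eps v w. ?S p)"
    by (simp add: matter_trace_form_def)
  also have "\<dots> = (\<Sum>(i, j)\<in>?E. \<Sum>k<v i. \<Sum>l<v j. ?S (Edge i j k l)) +
      (\<Sum>i\<in>UNIV. \<Sum>k<v i. \<Sum>l<w i. ?S (Framing i k l))"
    by (rule sum_matter_basis)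
  also have "(\<Sum>i\<in>UNIV. \<Sum>k<v i. \<Sum>l<w i. ?S (Framing i k l)) = (\<Sum>i\<in>UNIV. of_nat (w i) * mat_trace (a i * b i))"
    by (intro sum.cong refl) (simp add: F mat_trace_mult[OF a b] sum_distrib_left)
  also have "(\<Sum>(i, j)\<in>?E. \<Sum>k<v i. \<Sum>l<v j. ?S (Edge i j k l)) =
      (\<Sum>(i, j)\<in>?E. of_nat (v j) * mat_trace (a i * b i) + mat_trace (a i) * mat_trace (b j) +
       mat_trace (b i) * mat_trace (a j) + of_nat (v i) * mat_trace (a j * b j))"
  proof (intro sum.cong refl, clarsimp)
    fix i j assume e: "(i, j) \<in> ?E"
    have "(\<Sum>k<v i. \<Sum>l<v j. ?S (Edge i j k l)) =
        (\<Sum>k<v i. \<Sum>l<v j. (\<Sum>k'<v i. a i $$ (k, k') * b i $$ (k', k)) + a i $$ (k, k) * b j $$ (l, l) +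
          b i $$ (k, k) * a j $$ (l, l) + (\<Sum>l'<v j. a j $$ (l, l') * b j $$ (l', l)))"
      by (intro sum.cong refl E e) auto
    also have "\<dots> = of_nat (v j) * mat_trace (a i * b i) + mat_trace (a i) * mat_trace (b j) +
       mat_trace (b i) * mat_trace (a j) + of_nat (v i) * mat_trace (a j * b j)"
      by (simp add: sum.distrib mat_trace_mult[OF a b] pr sum_distrib_left)
    finally show "(\<Sum>k<v i. \<Sum>l<v j. ?S (Edge i j k l)) = \<dots>" .
  qed
  finally show ?thesis .
qed

text \<open>The coefficient \<open>c i\<close> of the overview.\<close>

definition level :: "'q set set \<Rightarrow> ('q \<Rightarrow> nat) \<Rightarrow> ('q \<Rightarrow> nat) \<Rightarrow> 'q \<Rightarrow> nat" where
  "level Q1 v w i = w i + (\<Sum>j | {j, i} \<in> Q1. v j)"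

text \<open>Products of single traces vanish on the Lie algebra, and each edge contributes to both
  its ends with the dimension of the other end.\<close>

lemma matter_trace_form_lie_alg:
  fixes v w :: "'q::finite \<Rightarrow> nat"
  assumes Q: "orthosymplectic_quiver Q1 eps" and S: "orthosymplectic_spaces eps v w omV omW"
    and a: "a \<in> lie_alg v (gauge_group eps v omV)" and b: "b \<in> lie_alg v (gauge_group eps v omV)"
  shows "matter_trace_form Q1 eps v w a b = (\<Sum>i\<in>UNIV. of_nat (level Q1 v w i) * mat_trace (a i * b i))"
proof -
  let ?t = "\<lambda>i. mat_trace (a i * b i)" and ?E = "edge_pairs Q1 eps"
  note S' = orthosymplectic_spaces_carrier(1,3)[OF S]
  have "(\<Sum>(i, j)\<in>?E. of_nat (v j) * ?t i + mat_trace (a i) * mat_trace (b j) +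
       mat_trace (b i) * mat_trace (a j) + of_nat (v i) * ?t j) =
      (\<Sum>(i, j)\<in>?E. of_nat (v j) * ?t i) + (\<Sum>(i, j)\<in>?E. of_nat (v i) * ?t j)"
    by (simp add: lie_alg_traceless[OF S' a] case_prod_unfold sum.distrib)
  also have "(\<Sum>(i, j)\<in>?E. of_nat (v j) * ?t i) = (\<Sum>i\<in>UNIV. \<Sum>j\<in>UNIV. if (i, j) \<in> ?E then of_nat (v j) * ?t i else 0)"
    unfolding sum.cartesian_product by (intro sum.mono_neutral_cong_left) auto
  also have "(\<Sum>(i, j)\<in>?E. of_nat (v i) * ?t j) = (\<Sum>i\<in>UNIV. \<Sum>j\<in>UNIV. if (i, j) \<in> ?E then of_nat (v i) * ?t j else 0)"
    unfolding sum.cartesian_product by (intro sum.mono_neutral_cong_left) auto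
  also have "\<dots> = (\<Sum>i\<in>UNIV. \<Sum>j\<in>UNIV. if (j, i) \<in> ?E then of_nat (v j) * ?t i else 0)"
    by (rule sum.swap)
  \<comment> \<open>The ends of an edge have opposite signs, so exactly one of the two ordered pairs
    lies in \<open>edge_pairs\<close>, and the two sums together count every neighbour once.\<close>
  also have "(\<Sum>i\<in>UNIV. \<Sum>j\<in>UNIV. if (i, j) \<in> ?E then of_nat (v j) * ?t i else 0) + \<dots> =
      (\<Sum>i\<in>UNIV. \<Sum>j\<in>UNIV. if {j, i} \<in> Q1 then of_nat (v j) * ?t i else 0)"
    unfolding sum.distrib [symmetric]
  proof (intro sum.cong refl)
    fix i j
    have "{j, i} \<in> Q1 \<Longrightarrow> eps j \<noteq> eps i" using Q by (auto simp: orthosymplectic_quiver_def)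
    then show "(if (i, j) \<in> ?E then of_nat (v j) * ?t i else 0) + (if (j, i) \<in> ?E then of_nat (v j) * ?t i else 0) =
        (if {j, i} \<in> Q1 then of_nat (v j) * ?t i else 0)"
      by (cases "eps i"; cases "eps j") (auto simp: edge_pairs_def insert_commute)
  qed
  also have "\<dots> = (\<Sum>i\<in>UNIV. of_nat (\<Sum>j | {j, i} \<in> Q1. v j) * ?t i)"
    by (intro sum.cong refl) (simp add: sum.If_cases sum_distrib_right Collect_conj_eq flip: sum.inter_filter)
  finally show ?thesis
    unfolding matter_trace_form_eq[OF lie_algD_carrier[OF a] lie_algD_carrier[OF b]]
    by (simp add: level_def distrib_right sum.distrib)
qed

section \<open>Anomaly cancellation\<close>

lemma cocharacter_component:
  assumes T: "T \<subseteq> gauge_group eps v om" and lam: "is_cocharacter v T lam"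
  shows "z \<noteq> 0 \<Longrightarrow> lam z \<in> T" "mat_cochar (v i) (\<lambda>z. lam z i)"
    "cochar_diff v lam i = mat_cochar_diff (v i) (\<lambda>z. lam z i)"
proof -
  \<comment> \<open>The point of the rank 1 standard torus with coordinate \<open>z\<close>.\<close>
  let ?e = "\<lambda>z :: complex. (\<lambda>k\<in>{..<1::nat}. z)"
  have e: "?e z \<in> std_torus 1" if "z \<noteq> 0" for z using that by (auto simp: std_torus_def)
  have hom: "is_torus_hom v 1 T (\<lambda>z. lam (z 0))" using lam by (simp add: is_cocharacter_def)
  have mem: "lam z \<in> T" if "z \<noteq> 0" for z
    using hom e[OF that] unfolding is_torus_hom_def by fastforce
  then show "z \<noteq> 0 \<Longrightarrow> lam z \<in> T" .
  have mult: "lam (z * u) = fam_mult (lam z) (lam u)" if "z \<noteq> 0" "u \<noteq> 0" for z u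
  proof -
    have "lam ((\<lambda>k\<in>{..<1}. ?e z k * ?e u k) 0) = fam_mult (lam (?e z 0)) (lam (?e u 0))"
      using hom e[OF that(1)] e[OF that(2)] unfolding is_torus_hom_def by blast
    then show ?thesis by simp
  qed
  have "lam z i \<in> carrier_mat (v i) (v i)" if "z \<noteq> 0" for z
    by (rule gauge_group_carrier(1)[OF subsetD[OF T mem[OF that]]])
  then show "mat_cochar (v i) (\<lambda>z. lam z i)"
    using hom mult by (simp add: mat_cochar_def is_torus_hom_def fam_mult_def)
  show "cochar_diff v lam i = mat_cochar_diff (v i) (\<lambda>z. lam z i)"
    by (simp add: cochar_diff_def mat_cochar_diff_def)
qed

lemma mat_trace_zero_dim:
  "A \<in> carrier_mat 0 0 \<Longrightarrow> mat_trace A = 0"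
  by (auto simp: mat_trace_def)

lemma mat_trace_add:
  "A \<in> carrier_mat d d \<Longrightarrow> B \<in> carrier_mat d d \<Longrightarrow> mat_trace (A + B) = mat_trace A + mat_trace B"
  by (auto simp: mat_trace_def sum.distrib)

lemma mat_trace_smult: "A \<in> carrier_mat d d \<Longrightarrow> mat_trace (c \<cdot>\<^sub>m A) = c * mat_trace A"
  by (auto simp: mat_trace_def sum_distrib_left)

lemma weighted_trace_form_invariant:
  fixes v :: "'q::finite \<Rightarrow> nat"
  shows "invariant_sym_bilinear v (gauge_group eps v om) (\<lambda>a b. \<Sum>i\<in>UNIV. m i * mat_trace (a i * b i))"
  unfolding invariant_sym_bilinear_def
proof (intro conjI ballI allI impI)
  let ?L = "lie_alg v (gauge_group eps v om)"
  fix a b assume "a \<in> ?L" "b \<in> ?L"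
  note a = lie_algD_carrier[OF \<open>a \<in> ?L\<close>] and b = lie_algD_carrier[OF \<open>b \<in> ?L\<close>]
  show "(\<Sum>i\<in>UNIV. m i * mat_trace (a i * b i)) = (\<Sum>i\<in>UNIV. m i * mat_trace (b i * a i))"
    by (intro sum.cong refl arg_cong2[where f = "(*)"] mat_trace_comm[OF a b])
  fix c
  have "mat_trace (c \<cdot>\<^sub>m a i * b i) = c * mat_trace (a i * b i)" for i
    using mat_trace_smult[OF mult_carrier_mat[OF a b]] by (simp add: mult_smult_assoc_mat[OF a b])
  then show "(\<Sum>i\<in>UNIV. m i * mat_trace (fam_smult c a i * b i)) = c * (\<Sum>i\<in>UNIV. m i * mat_trace (a i * b i))"
    by (simp add: fam_smult_def sum_distrib_left mult_ac)
next
  let ?L = "lie_alg v (gauge_group eps v om)"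
  fix a a' b assume "a \<in> ?L" "a' \<in> ?L" "b \<in> ?L"
  note a = lie_algD_carrier[OF \<open>a \<in> ?L\<close>] and a' = lie_algD_carrier[OF \<open>a' \<in> ?L\<close>]
    and b = lie_algD_carrier[OF \<open>b \<in> ?L\<close>]
  have "mat_trace ((a i + a' i) * b i) = mat_trace (a i * b i) + mat_trace (a' i * b i)" for i
    unfolding add_mult_distrib_mat[OF a a' b]
    by (rule mat_trace_add[OF mult_carrier_mat[OF a b] mult_carrier_mat[OF a' b]])
  then show "(\<Sum>i\<in>UNIV. m i * mat_trace (fam_add a a' i * b i)) =
      (\<Sum>i\<in>UNIV. m i * mat_trace (a i * b i)) + (\<Sum>i\<in>UNIV. m i * mat_trace (a' i * b i))"
    by (simp add: fam_add_def distrib_left sum.distrib)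
next
  let ?G = "gauge_group eps v om"
  fix g h a b assume "g \<in> ?G" "h \<in> ?G" and gh: "fam_mult g h = fam_one v"
    and ab: "a \<in> lie_alg v ?G" "b \<in> lie_alg v ?G"
  note g = gauge_group_carrier(1)[OF \<open>g \<in> ?G\<close>] and h = gauge_group_carrier(1)[OF \<open>h \<in> ?G\<close>]
    and a = lie_algD_carrier[OF ab(1)] and b = lie_algD_carrier[OF ab(2)]
  have "mat_trace ((g i * a i * h i) * (g i * b i * h i)) = mat_trace (a i * b i)" for i
  proof -
    have hg: "h i * g i = 1\<^sub>m (v i)"
      using fun_cong[OF gh, of i] by (intro mat_mult_left_right_inverse[OF g h]) (simp add: fam_mult_def fam_one_def)
    note c = g[of i] h[of i] a[of i] b[of i]
    have "(g i * a i * h i) * (g i * b i * h i) = g i * (a i * (h i * g i) * b i) * h i"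
      using c by (simp add: assoc_mult_mat[of _ "v i" "v i" _ "v i" _ "v i"])
    also have "\<dots> = g i * (a i * b i) * h i" using c by (simp add: hg)
    finally show ?thesis
      using mat_trace_conj[OF g h mult_carrier_mat[OF a b] hg] by simp
  qed
  then show "(\<Sum>i\<in>UNIV. m i * mat_trace (fam_mult (fam_mult g a) h i * fam_mult (fam_mult g b) h i)) =
      (\<Sum>i\<in>UNIV. m i * mat_trace (a i * b i))"
    by (simp add: fam_mult_def)
qed

text \<open>With natural numbers as weights, integrality and evenness can be checked at each vertex
  separately.\<close>

lemma weighted_trace_form_in_Bil:
  fixes v :: "'q::finite \<Rightarrow> nat" and m :: "'q \<Rightarrow> nat"
  assumes om: "\<And>i. om i \<in> carrier_mat (v i) (v i)" "\<And>i. invertible_mat (om i)"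
  shows "(\<lambda>a b. \<Sum>i\<in>UNIV. of_nat (m i) * mat_trace (a i * b i)) \<in> Bil v (gauge_group eps v om)"
  unfolding Bil_def
proof (intro CollectI conjI allI impI weighted_trace_form_invariant)
  fix T lam mu
  assume "is_maximal_torus v (gauge_group eps v om) T"
    and lm: "is_cocharacter v T lam \<and> is_cocharacter v T mu"
  then have T: "is_torus v (gauge_group eps v om) T" by (simp add: is_maximal_torus_def)
  note lam = cocharacter_component[OF torus_subset[OF T] conjunct1[OF lm]]
    and mu = cocharacter_component[OF torus_subset[OF T] conjunct2[OF lm]]
  have "mat_trace (cochar_diff v lam i * cochar_diff v mu i) \<in> \<int>" for i
    unfolding lam(3) mu(3)
  proof (rule mat_trace_cochar_diff_mult_Ints[OF lam(2) mu(2)])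
    fix z u :: complex assume "z \<noteq> 0" "u \<noteq> 0"
    then have "fam_mult (lam z) (mu u) = fam_mult (mu u) (lam z)"
      using torus_commute[OF T] lam(1) mu(1) by blast
    then show "lam z i * mu u i = mu u i * lam z i" by (simp add: fam_mult_def fun_eq_iff)
  qed
  then show "(\<Sum>i\<in>UNIV. of_nat (m i) * mat_trace (cochar_diff v lam i * cochar_diff v mu i)) \<in> \<int>"
    by (intro Ints_sum Ints_mult Ints_of_nat)
next
  fix T \<nu>
  assume "is_maximal_torus v (gauge_group eps v om) T" and \<nu>: "is_coroot v (gauge_group eps v om) T \<nu>"
  then have T: "is_torus v (gauge_group eps v om) T" and "is_cocharacter v T \<nu>"
    by (simp_all add: is_maximal_torus_def is_coroot_def)
  note nu = cocharacter_component[OF torus_subset[OF T] this(2)]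
  have "\<exists>k :: int. mat_trace (cochar_diff v \<nu> i * cochar_diff v \<nu> i) = of_int (2 * k)" for i
  proof (rule mat_trace_cochar_diff_square_even[OF nu(2) om])
    fix z :: complex assume "z \<noteq> 0"
    then have "\<nu> z \<in> gauge_group eps v om" using nu(1) torus_subset[OF T] by blast
    then show "transpose_mat (\<nu> z i) * om i * \<nu> z i = om i" by (rule gauge_group_carrier(2))
  next
    fix k :: int
    assume "mat_trace (mat_cochar_diff (v i) (\<lambda>z. \<nu> z i) * mat_cochar_diff (v i) (\<lambda>z. \<nu> z i)) = of_int (2 * k)"
    then show ?thesis unfolding nu(3) by blast
  qed
  then obtain k :: "'q \<Rightarrow> int" where
    "\<And>i. mat_trace (cochar_diff v \<nu> i * cochar_diff v \<nu> i) = of_int (2 * k i)" by metis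
  then have "(\<Sum>i\<in>UNIV. of_nat (m i) * mat_trace (cochar_diff v \<nu> i * cochar_diff v \<nu> i)) =
      of_int (2 * (\<Sum>i\<in>UNIV. int (m i) * k i))"
    by (simp add: sum_distrib_left mult_ac)
  then show "\<exists>k :: int. (\<Sum>i\<in>UNIV. of_nat (m i) * mat_trace (cochar_diff v \<nu> i * cochar_diff v \<nu> i)) = of_int (2 * k)"
    by blast
qed

text \<open>Half of the trace form is the weighted form with halved levels. Where
  \<open>v i = 0\<close> the halving may round, but the trace of an empty matrix is 0.\<close>

lemma anomaly_cancellation_if_level_even:
  fixes v w :: "'q::finite \<Rightarrow> nat"
  assumes Q: "orthosymplectic_quiver Q1 eps" and S: "orthosymplectic_spaces eps v w omV omW"
    and even: "\<And>i. v i \<noteq> 0 \<Longrightarrow> even (level Q1 v w i)"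
  shows "anomaly_cancellation Q1 eps v w omV"
  unfolding anomaly_cancellation_def in_twice_Bil_def
proof (intro bexI ballI)
  note om = orthosymplectic_spaces_carrier(1,3)[OF S]
  show "(\<lambda>a b. \<Sum>i\<in>UNIV. of_nat (level Q1 v w i div 2) * mat_trace (a i * b i)) \<in> Bil v (gauge_group eps v omV)"
    by (rule weighted_trace_form_in_Bil[OF om])
  fix a b
  assume ab: "a \<in> lie_alg v (gauge_group eps v omV)" "b \<in> lie_alg v (gauge_group eps v omV)"
  have "of_nat (level Q1 v w i) * mat_trace (a i * b i) =
      2 * (of_nat (level Q1 v w i div 2) * mat_trace (a i * b i))" for i
  proof (cases "v i = 0")
    case True
    then have "a i * b i \<in> carrier_mat 0 0"
      using lie_algD_carrier[OF ab(1), of i] lie_algD_carrier[OF ab(2), of i] by simp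
    then show ?thesis by (simp add: mat_trace_zero_dim)
  next
    case False
    then obtain n where "level Q1 v w i = 2 * n" using even by (blast elim: evenE)
    then show ?thesis by simp
  qed
  then show "matter_trace_form Q1 eps v w a b =
      2 * (\<Sum>i\<in>UNIV. of_nat (level Q1 v w i div 2) * mat_trace (a i * b i))"
    unfolding matter_trace_form_lie_alg[OF Q S ab] sum_distrib_left by (intro sum.cong refl)
qed

lemma gauge_frame_exists:
  fixes v w :: "'q::finite \<Rightarrow> nat"
  assumes S: "orthosymplectic_spaces eps v w omV omW"
  shows "\<exists>P Q. gauge_frame eps v omV P Q"
proof -
  have form: "case eps i of Plus \<Rightarrow> sym_form (v i) (omV i) | Minus \<Rightarrow> antisym_form (v i) (omV i)" for i
    using S by (auto simp: orthosymplectic_spaces_def split: sign.splits)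
  have "\<exists>P Q. antidiagonal_frame (v i) (omV i) P Q" for i
  proof -
    have "eps_form (v i) (case eps i of Plus \<Rightarrow> 1 | Minus \<Rightarrow> - 1) (omV i)"
    proof
      show "omV i \<in> carrier_mat (v i) (v i)" "invertible_mat (omV i)"
        using orthosymplectic_spaces_carrier[OF S] by blast+
      show "transpose_mat (omV i) = (case eps i of Plus \<Rightarrow> 1 | Minus \<Rightarrow> - 1) \<cdot>\<^sub>m omV i"
        using form[of i] by (cases "eps i") (auto simp: sym_form_def antisym_form_def intro!: eq_matI)
    qed (simp split: sign.splits)
    from eps_form.antidiagonal_basis[OF this] show ?thesis
      using orthosymplectic_spaces_carrier(1)[OF S] unfolding antidiagonal_frame_def by blast
  qed
  then obtain P Q where "\<And>i. antidiagonal_frame (v i) (omV i) (P i) (Q i)" by metis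
  moreover have "transpose_mat (omV i) = - omV i" "even (v i)" if "eps i = Minus" for i
    using form[of i] that antisym_form_even by (auto simp: antisym_form_def)
  ultimately show ?thesis unfolding gauge_frame_def by blast
qed

text \<open>On the long coroot at \<open>i\<close> the form is twice the level, and also twice the
  even integer that the form in \<open>Bil\<close> takes there.\<close>

lemma level_even_if_anomaly_cancellation:
  fixes v w :: "'q::finite \<Rightarrow> nat"
  assumes Q: "orthosymplectic_quiver Q1 eps" and S: "orthosymplectic_spaces eps v w omV omW"
    and anomaly: "anomaly_cancellation Q1 eps v w omV" and i: "eps i = Minus" "v i \<noteq> 0"
  shows "even (level Q1 v w i)"
proof -
  obtain P R where "gauge_frame eps v omV P R" using gauge_frame_exists[OF S] by blast
  then interpret gauge_frame eps v omV P R .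
  let ?D = "cochar_diff v (long_coroot i)"
  obtain B where B: "B \<in> Bil v G"
    and F: "\<And>a b. a \<in> lie_alg v G \<Longrightarrow> b \<in> lie_alg v G \<Longrightarrow> matter_trace_form Q1 eps v w a b = 2 * B a b"
    using anomaly unfolding anomaly_cancellation_def in_twice_Bil_def by blast
  note D = long_coroot_diff_in_lie_alg[OF i]
  obtain k :: int where k: "B ?D ?D = of_int (2 * k)"
    using B T_is_maximal_torus long_coroot_is_coroot[OF i] unfolding Bil_def by blast
  have "matter_trace_form Q1 eps v w ?D ?D = (\<Sum>j\<in>UNIV. of_nat (level Q1 v w j) * mat_trace (?D j * ?D j))"
    by (rule matter_trace_form_lie_alg[OF Q S D D])
  \<comment> \<open>The coroot has zero differential at all other vertices.\<close>
  also have "\<dots> = (\<Sum>j\<in>{i}. of_nat (level Q1 v w j) * mat_trace (?D j * ?D j))"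
    by (intro sum.mono_neutral_right) (auto simp: cochar_diff_long_coroot[OF i] mat_trace_def)
  also have "\<dots> = of_nat (level Q1 v w i) * 2"
    by (simp add: mat_trace_long_coroot_diff_square[OF i])
  finally have "of_nat (level Q1 v w i) * 2 = (of_int (4 * k) :: complex)"
    using F[OF D D] k by simp
  then have "(of_int (int (level Q1 v w i) * 2) :: complex) = of_int (4 * k)" by simp
  then have "int (level Q1 v w i) * 2 = 4 * k" unfolding of_int_eq_iff .
  then have "int (level Q1 v w i) = 2 * k" by simp
  then show ?thesis by presburger
qed

text \<open>The space \<open>W\<close> at an orthogonal vertex and the spaces \<open>V\<close> at
  its neighbours carry antisymmetric forms, so every summand is even.\<close>

lemma level_even_Plus:
  assumes Q: "orthosymplectic_quiver Q1 eps" and S: "orthosymplectic_spaces eps v w omV omW"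
    and i: "eps i = Plus"
  shows "even (level Q1 v w i)"
proof -
  have "antisym_form (w i) (omW i)"
    using S i by (auto simp: orthosymplectic_spaces_def split: sign.splits)
  then have "even (w i)" by (rule antisym_form_even)
  moreover have "even (v j)" if "{j, i} \<in> Q1" for j
  proof -
    have "eps j \<noteq> eps i" using Q that unfolding orthosymplectic_quiver_def by blast
    then have "eps j = Minus" using i by (cases "eps j") auto
    then have "antisym_form (v j) (omV j)"
      using S by (auto simp: orthosymplectic_spaces_def split: sign.splits)
    then show ?thesis by (rule antisym_form_even)
  qed
  ultimately show ?thesis by (auto simp: level_def intro!: dvd_sum)
qed

text \<open>If \<open>v i = 0\<close> at a symplectic vertex, its factor of the group is trivial and
  its level has no influence on the trace form, so cancellation cannot constrain it. The first
  clause is the criterion when all symplectic \<open>v i\<close> are nonzero; the second, valid in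
  general, restricts it to the vertices with nonzero \<open>v i\<close>.\<close>

theorem proposition4p2:
  fixes Q1 :: "'q::finite set set"
    and eps :: "'q \<Rightarrow> sign"
    and v w :: "'q \<Rightarrow> nat"
    and omV omW :: "'q \<Rightarrow> complex mat"
  assumes "orthosymplectic_quiver Q1 eps"
    and "orthosymplectic_spaces eps v w omV omW"
  shows "((\<forall>i. eps i = Minus \<longrightarrow> v i \<noteq> 0) \<longrightarrow>
           (anomaly_cancellation Q1 eps v w omV \<longleftrightarrow>
             (\<forall>i. eps i = Minus \<longrightarrow> [w i + (\<Sum>j | {j, i} \<in> Q1. v j) = 0] (mod 2)))) \<and>
         (anomaly_cancellation Q1 eps v w omV \<longleftrightarrow>
           (\<forall>i. eps i = Minus \<and> v i \<noteq> 0 \<longrightarrow> [w i + (\<Sum>j | {j, i} \<in> Q1. v j) = 0] (mod 2))) \<and>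
         (\<forall>i. eps i = Plus \<longrightarrow> [w i + (\<Sum>j | {j, i} \<in> Q1. v j) = 0] (mod 2))"
proof -
  have cong: "[w i + (\<Sum>j | {j, i} \<in> Q1. v j) = 0] (mod 2) \<longleftrightarrow> even (level Q1 v w i)" for i
    by (simp add: level_def cong_0_iff)
  have plus: "even (level Q1 v w i)" if "eps i = Plus" for i
    by (rule level_even_Plus[OF assms that])
  have iff: "anomaly_cancellation Q1 eps v w omV \<longleftrightarrow>
      (\<forall>i. eps i = Minus \<and> v i \<noteq> 0 \<longrightarrow> even (level Q1 v w i))"
  proof
    assume "anomaly_cancellation Q1 eps v w omV"
    then show "\<forall>i. eps i = Minus \<and> v i \<noteq> 0 \<longrightarrow> even (level Q1 v w i)"
      using level_even_if_anomaly_cancellation[OF assms] by blast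
  next
    assume "\<forall>i. eps i = Minus \<and> v i \<noteq> 0 \<longrightarrow> even (level Q1 v w i)"
    then have "even (level Q1 v w i)" if "v i \<noteq> 0" for i
      using that plus by (cases "eps i") auto
    then show "anomaly_cancellation Q1 eps v w omV"
      by (rule anomaly_cancellation_if_level_even[OF assms])
  qed
  show ?thesis unfolding cong iff using plus by blast
qed

end
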